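(* Let $k\ge 1$ and $n\ge 0$ be integers. Let $$F^{(k)}_n=\{P\in\mathbb{C}[x_1,\dots,x_n]^{S_n}\mid P=0 \text{ if } x_1=\dots=x_{k+1}\}$$ (for $n\le k$ the condition is vacuous and $F^{(k)}_n=\mathbb{C}[x_1,\dots,x_n]^{S_n}$), and let $$I^{(k,2)}_n=\mathrm{span}_{\mathbb{C}}\{P_\lambda(x_1,\dots,x_n;\beta)|_{\beta=-1/(k+1)}\mid \lambda\in\pi_n,\ \lambda_i-\lambda_{i+k}\ge 2\ (1\le i\le n-k)\},$$ where $P_\lambda$ are the Jack polynomials. Then $F^{(k)}_n=I^{(k,2)}_n$.
   Context: Partitions: $\pi_n$ is the set of partitions $\lambda=(\lambda_1\ge\dots\ge\lambda_n\ge 0)$ of length at most $n$. Dominance order: for $|\mu|=|\lambda|$, $\mu\le\lambda$ means $\mu_1+\dots+\mu_i\le\lambda_1+\dots+\lambda_i$ for $1\le i\le n$. The orbit sums are $m_\lambda=\sum_{\alpha\in S_n\lambda}x^\alpha$. Jack polynomials: let $K_{ij}$ be the operator exchanging the variables $x_i,x_j$, $\partial_i=\partial/\partial x_i$, $\hat D_i=x_i\partial_i+\beta\sum_{j\neq i}\frac{x_{\max\{i,j\}}}{x_i-x_j}(1-K_{ij})+\beta(n-i)$ ($1\le i\le n$), which are commuting operators, and $S(u,\beta)=\prod_{i=1}^n(u+\hat D_i)$. The Jack polynomials $P_\lambda=P_\lambda(x;\beta)$, $\lambda\in\pi_n$, are the unique $\mathbb{C}(\beta)$-basis of $\mathbb{C}(\beta)[x_1,\dots,x_n]^{S_n}$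 ($\beta$ an indeterminate) such that $S(u,\beta)P_\lambda=\prod_{i=1}^n(u+\lambda_i+(n-i)\beta)\,P_\lambda$ and $P_\lambda=m_\lambda+\sum_{\mu<\lambda}u_{\lambda\mu}(\beta)m_\mu$ with $u_{\lambda\mu}(\beta)\in\mathbb{C}(\beta)$. For the partitions $\lambda$ in the definition of $I^{(k,2)}_n$, the coefficients of $P_\lambda$ have no pole at $\beta=-1/(k+1)$, so the specialization is well defined. For $n=0$ both spaces equal $\mathbb{C}$. *)

theory Defs
  imports
    "HOL-Library.Poly_Mapping"
    "HOL-Library.FuncSet"
    "HOL-Combinatorics.Permutations"
    "HOL-Computational_Algebra.Polynomial"
    "HOL-Computational_Algebra.Fraction_Field"
    Complex_Main
begin

text \<open>
  Polynomials are elements of the monoid algebra over finitely supported exponents; the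
  exponent \<open>\<alpha>\<close> stands for the monomial \<open>x\<^sup>\<alpha>\<close>, and the variables \<open>x\<^sub>1, \<dots>, x\<^sub>n\<close> are those
  with index in \<open>{1..n}\<close>.
\<close>

type_synonym expo = "nat \<Rightarrow>\<^sub>0 nat"
type_synonym 'a mpol = "expo \<Rightarrow>\<^sub>0 'a"

definition Cst :: "'a::zero \<Rightarrow> 'a mpol" where
  "Cst c = Poly_Mapping.single 0 c"

definition Mon :: "expo \<Rightarrow> 'a::zero_neq_one mpol" where
  "Mon \<alpha> = Poly_Mapping.single \<alpha> 1"

definition X :: "nat \<Rightarrow> 'a::zero_neq_one mpol" where
  "X i = Mon (Poly_Mapping.single i 1)"

definition scale :: "'a::field \<Rightarrow> 'a mpol \<Rightarrow> 'a mpol" where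
  "scale c p = Cst c * p"

lemma vector_space_scale: "vector_space (scale :: 'a::field \<Rightarrow> _)"
proof
  fix a b :: 'a and p q :: "'a mpol"
  show "scale a (p + q) = scale a p + scale a q"
    by (simp add: scale_def distrib_left)
  show "scale (a + b) p = scale a p + scale b p"
    by (simp add: scale_def Cst_def single_add distrib_right)
  show "scale a (scale b p) = scale (a * b) p"
    by (simp add: scale_def Cst_def mult_single flip: mult.assoc)
  show "scale 1 p = p"
    by (simp add: scale_def Cst_def flip: single_one)
qed

abbreviation span_over_field :: "'a::field mpol set \<Rightarrow> 'a mpol set" where
  "span_over_field \<equiv> module.span scale"

abbreviation independent_over_field :: "'a::field mpol set \<Rightarrow> bool" where
  "independent_over_field B \<equiv> \<not> module.dependent scale B"

definition peval :: "'a::comm_semiring_1 mpol \<Rightarrow> (nat \<Rightarrow> 'a) \<Rightarrow> 'a" where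
  "peval p x = (\<Sum>\<alpha>\<in>Poly_Mapping.keys p. Poly_Mapping.lookup p \<alpha> *
     (\<Prod>i\<in>Poly_Mapping.keys \<alpha>. x i ^ Poly_Mapping.lookup \<alpha> i))"

text \<open>
  A permutation \<open>\<sigma>\<close> acts on exponents by \<open>\<alpha> \<mapsto> \<alpha> \<circ> \<sigma>\<close>, and on polynomials by letting the
  coefficient of the new polynomial at \<open>\<alpha>\<close> be the old one at \<open>\<alpha> \<circ> \<sigma>\<close>, that is, by the
  substitution \<open>x\<^sub>i \<mapsto> x\<^bsub>\<sigma> i\<^esub>\<close>.
\<close>

definition permute_vars :: "(nat \<Rightarrow> nat) \<Rightarrow> 'a::zero mpol \<Rightarrow> 'a mpol" where
  "permute_vars \<sigma> p = Poly_Mapping.map_key (Poly_Mapping.map_key \<sigma>) p"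

lemma lookup_permute_vars:
  assumes "bij \<sigma>"
  shows "Poly_Mapping.lookup (permute_vars \<sigma> p) \<alpha> =
    Poly_Mapping.lookup p (Poly_Mapping.map_key \<sigma> \<alpha>)"
proof -
  have "inj (Poly_Mapping.map_key \<sigma> :: expo \<Rightarrow> expo)"
  proof (rule injI, rule poly_mapping_eqI)
    fix \<alpha> \<gamma> :: expo and i
    assume "Poly_Mapping.map_key \<sigma> \<alpha> = Poly_Mapping.map_key \<sigma> \<gamma>"
    then have "Poly_Mapping.lookup \<alpha> (\<sigma> (inv \<sigma> i)) = Poly_Mapping.lookup \<gamma> (\<sigma> (inv \<sigma> i))"
      using map_key.rep_eq[OF bij_is_inj[OF assms], where ?'c = nat] by (metis comp_apply)
    then show "Poly_Mapping.lookup \<alpha> i = Poly_Mapping.lookup \<gamma> i"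
      using assms by (simp add: bij_is_surj surj_f_inv_f)
  qed
  then show ?thesis
    by (simp add: permute_vars_def map_key.rep_eq)
qed

definition sym_polys :: "nat \<Rightarrow> 'a::zero mpol set" where
  "sym_polys n = {p. (\<forall>\<alpha>\<in>Poly_Mapping.keys p. Poly_Mapping.keys \<alpha> \<subseteq> {1..n}) \<and>
     (\<forall>\<sigma>. \<sigma> permutes {1..n} \<longrightarrow> permute_vars \<sigma> p = p)}"

text \<open>A partition of length at most \<open>n\<close> is identified with its exponent.\<close>

definition partitions :: "nat \<Rightarrow> expo set" where
  "partitions n = {\<nu>. Poly_Mapping.keys \<nu> \<subseteq> {1..n} \<and>
     (\<forall>i j. 1 \<le> i \<and> i \<le> j \<and> j \<le> n \<longrightarrow> Poly_Mapping.lookup \<nu> j \<le> Poly_Mapping.lookup \<nu> i)}"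

definition dominated :: "nat \<Rightarrow> expo \<Rightarrow> expo \<Rightarrow> bool" where
  "dominated n \<mu> \<nu> \<longleftrightarrow>
     (\<Sum>i=1..n. Poly_Mapping.lookup \<mu> i) = (\<Sum>i=1..n. Poly_Mapping.lookup \<nu> i) \<and>
     (\<forall>i\<in>{1..n}. (\<Sum>j=1..i. Poly_Mapping.lookup \<mu> j) \<le> (\<Sum>j=1..i. Poly_Mapping.lookup \<nu> j))"

definition orbit_sum :: "nat \<Rightarrow> expo \<Rightarrow> 'a::{comm_monoid_add,zero_neq_one} mpol" where
  "orbit_sum n \<nu> = (\<Sum>\<alpha>\<in>{Poly_Mapping.map_key \<sigma> \<nu> |\<sigma>. \<sigma> permutes {1..n}}. Mon \<alpha>)"

type_synonym ratfun = "complex poly fract"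

definition \<beta> :: ratfun where
  "\<beta> = Fract [:0, 1:] 1"

text \<open>
  The exponent \<open>\<alpha> - e\<^sub>i\<close> is truncated when \<open>\<alpha>\<^sub>i = 0\<close>, but then the coefficient vanishes.
\<close>

definition pdiff :: "nat \<Rightarrow> 'a::semiring_1 mpol \<Rightarrow> 'a mpol" where
  "pdiff i p = (\<Sum>\<alpha>\<in>Poly_Mapping.keys p.
     Poly_Mapping.single (\<alpha> - Poly_Mapping.single i 1)
       (of_nat (Poly_Mapping.lookup \<alpha> i) * Poly_Mapping.lookup p \<alpha>))"

text \<open>
  The quotient \<open>(p - K\<^sub>i\<^sub>j p) / (x\<^sub>i - x\<^sub>j)\<close>, for \<open>i \<noteq> j\<close>: it is a polynomial, and it is unique
  because the polynomials form an integral domain.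
\<close>

definition divided_diff :: "nat \<Rightarrow> nat \<Rightarrow> 'a::field mpol \<Rightarrow> 'a mpol" where
  "divided_diff i j p = (THE q. (X i - X j) * q = p - permute_vars (transpose i j) p)"

definition Dhat :: "nat \<Rightarrow> nat \<Rightarrow> ratfun mpol \<Rightarrow> ratfun mpol" where
  "Dhat n i p = X i * pdiff i p
     + scale \<beta> (\<Sum>j\<in>{1..n} - {i}. X (max i j) * divided_diff i j p)
     + scale (\<beta> * of_nat (n - i)) p"

text \<open>The operator \<open>S(u,\<beta>) = (u + D\<^sub>1) (u + D\<^sub>2) \<cdots> (u + D\<^sub>n)\<close>.\<close>

definition Sop :: "nat \<Rightarrow> ratfun \<Rightarrow> ratfun mpol \<Rightarrow> ratfun mpol" where
  "Sop n u p = foldr (\<lambda>i q. scale u q + Dhat n i q) [1..<Suc n] p"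

text \<open>
  The indeterminate \<open>u\<close> is taken to range over the (infinite) field of rational functions
  in \<open>\<beta>\<close>.
\<close>

definition jack_basis :: "nat \<Rightarrow> (expo \<Rightarrow> ratfun mpol) \<Rightarrow> bool" where
  "jack_basis n P \<longleftrightarrow>
     inj_on P (partitions n) \<and>
     independent_over_field (P ` partitions n) \<and>
     span_over_field (P ` partitions n) = sym_polys n \<and>
     (\<forall>\<nu>\<in>partitions n.
        (\<forall>u. Sop n u (P \<nu>) =
           scale (\<Prod>i=1..n. u + of_nat (Poly_Mapping.lookup \<nu> i) + of_nat (n - i) * \<beta>) (P \<nu>)) \<and>
        (\<exists>c. P \<nu> = orbit_sum n \<nu> +
           (\<Sum>\<mu>\<in>{\<mu> \<in> partitions n. dominated n \<mu> \<nu> \<and> \<mu> \<noteq> \<nu>}. scale (c \<mu>) (orbit_sum n \<mu>))))"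

text \<open>
  The family of Jack polynomials, defined by its characterization; the restriction to
  \<^const>\<open>extensional\<close> functions only fixes the values outside \<^const>\<open>partitions\<close>.
\<close>

definition jack :: "nat \<Rightarrow> expo \<Rightarrow> ratfun mpol" where
  "jack n = (THE P. P \<in> extensional (partitions n) \<and> jack_basis n P)"

text \<open>
  Value of a rational function at a point, computed from any representation whose denominator
  does not vanish there; it is unspecified if the function has a pole at the point.
\<close>

definition ratfun_at :: "complex \<Rightarrow> ratfun \<Rightarrow> complex" where
  "ratfun_at c q = (THE z. \<exists>a b. q = Fract a b \<and> poly b c \<noteq> 0 \<and> z = poly a c / poly b c)"

lemma ratfun_at_Fract:
  assumes "poly b c \<noteq> 0"
  shows "ratfun_at c (Fract a b) = poly a c / poly b c"
  unfolding ratfun_at_def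
proof (rule the_equality)
  fix z assume "\<exists>a' b'. Fract a b = Fract a' b' \<and> poly b' c \<noteq> 0 \<and> z = poly a' c / poly b' c"
  then obtain a' b' where eq: "Fract a b = Fract a' b'" and nz: "poly b' c \<noteq> 0"
    and z: "z = poly a' c / poly b' c" by blast
  have "b \<noteq> 0" "b' \<noteq> 0" using assms nz by auto
  then have "a * b' = a' * b" using eq by (simp add: eq_fract)
  then have "poly a c * poly b' c = poly a' c * poly b c" by (metis poly_mult)
  then show "z = poly a c / poly b c" using assms nz z by (simp add: frac_eq_eq)
qed (use assms in blast)

definition specialize :: "complex \<Rightarrow> ratfun mpol \<Rightarrow> complex mpol" where
  "specialize c p = Poly_Mapping.map (ratfun_at c) p"

definition F_space :: "nat \<Rightarrow> nat \<Rightarrow> complex mpol set" where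
  "F_space k n = {P \<in> sym_polys n.
     k + 1 \<le> n \<longrightarrow> (\<forall>x. (\<forall>i\<in>{1..k+1}. x i = x 1) \<longrightarrow> peval P x = 0)}"

definition I_space :: "nat \<Rightarrow> nat \<Rightarrow> complex mpol set" where
  "I_space k n = span_over_field {specialize (- 1 / (of_nat k + 1)) (jack n \<nu>) | \<nu>.
     \<nu> \<in> partitions n \<and>
     (\<forall>i. 1 \<le> i \<and> i + k \<le> n \<longrightarrow>
        Poly_Mapping.lookup \<nu> i \<ge> Poly_Mapping.lookup \<nu> (i + k) + 2)}"

end

theory Submission
  imports Defs "HOL-Computational_Algebra.Polynomial_Factorial"
begin

text \<open>
  Write \<open>\<beta>\<^sub>0 = - 1 / (k + 1)\<close>. Two facts connect the ideal with the Jack polynomials. First, the polynomials that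
  vanish whenever \<open>k + 1\<close> of the variables coincide are preserved by the Cherednik operators at \<open>\<beta>\<^sub>0\<close>: on such a
  coincidence the divided differences become differences of derivatives, whose contribution cancels the
  derivative term exactly for this parameter. Second, for admissible \<open>\<nu>\<close> there is an explicit symmetric polynomial \<open>f\<close> in
  the ideal with leading exponent \<open>\<nu>\<close>, a symmetrized product of a monomial and an alternant.

  The operators \<open>S(u)\<close> commute and are triangular with respect to dominance, so a product of factors
  \<open>S(u\<^sub>\<mu>) - E\<^sub>\<mu>(u\<^sub>\<mu>)\<close> over the lower \<open>\<mu>\<close> maps any polynomial with leading exponent \<open>\<nu>\<close> to a joint eigenvector. Over
  \<open>\<complex>(\<beta>)\<close> this is a multiple of \<open>P\<^sub>\<nu>\<close>; at \<open>\<beta>\<^sub>0\<close> the multiple stays nonzero for admissible \<open>\<nu>\<close>, because the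
  eigenvalue \<open>E\<^sub>\<nu>\<close> is still separated from all others, and applying the product to \<open>f\<close> shows that \<open>P\<^sub>\<nu>\<close> lies in the ideal.
  Conversely the leading exponent of every element of the ideal is admissible, so that subtracting multiples
  of Jack polynomials reduces any element to zero.
\<close>

text \<open>The obstacle is the specialization: the Jack polynomial is known only through its
  characterization over \<open>ratfun\<close>, which says nothing about poles. All operators and the
  vector \<open>eigvec\<close> are therefore built without division over an arbitrary integral
  domain. One vector with coefficients in \<open>complex poly\<close> then maps to
  \<open>ratfun\<close> by inclusion and to \<open>complex\<close> by evaluation, and a pole can
  only come from the single scalar \<open>eigvec_lead\<close>.

  Two orders are in use. Triangularity of the operators is governed by dominance, but the explicit
  element of the ideal is compared with \<open>\<nu>\<close> only through the sum of squares of the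
  exponents. Hence the product of factors runs over all partitions of the same size with smaller
  square norm, a set that is closed downwards for dominance, and the leading exponent in the
  converse direction is also chosen by square norm.

  At \<open>\<beta>\<^sub>0\<close> eigenvalues of different partitions may coincide, so no
  eigenbasis is available there; it suffices that the eigenvalue of an admissible partition differs
  from every other one.\<close>

abbreviation lookup where "lookup \<equiv> Poly_Mapping.lookup"
abbreviation keys where "keys \<equiv> Poly_Mapping.keys"
abbreviation single where "single \<equiv> Poly_Mapping.single"
abbreviation map_key where "map_key \<equiv> Poly_Mapping.map_key"

section \<open>Polynomials\<close>

lemma poly_mapping_single_induct [case_names zero single add]:
  fixes p :: "'a \<Rightarrow>\<^sub>0 'b::comm_monoid_add"
  assumes "P 0" "\<And>\<alpha> c. P (single \<alpha> c)" "\<And>p q. P p \<Longrightarrow> P q \<Longrightarrow> P (p + q)"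
  shows "P p"
proof (induction p rule: update_induct)
  case const
  show ?case using assms(1) by simp
next
  case (update p \<alpha> c)
  have "Poly_Mapping.update \<alpha> c p = p + single \<alpha> c"
    using update by (intro poly_mapping_eqI) (auto simp: lookup_update lookup_add lookup_single in_keys_iff when_def)
  then show ?case using update assms by simp
qed

lemma expo_induct [case_names zero add]:
  fixes \<alpha> :: expo
  assumes zero: "P 0" and add: "\<And>\<alpha> i. P \<alpha> \<Longrightarrow> P (\<alpha> + single i 1)"
  shows "P \<alpha>"
proof (induction \<alpha> rule: update_induct)
  case const
  show ?case using zero by simp
next
  case (update \<alpha> i m)
  have "P (\<alpha> + single i m)" for m
  proof (induction m)
    case 0
    then show ?case using update by simp
  next
    case (Suc m)
    have "\<alpha> + single i (Suc m) = \<alpha> + single i m + single i 1"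
      by (simp add: add.assoc flip: single_add)
    then show ?case using add[OF Suc] by simp
  qed
  moreover have "Poly_Mapping.update i m \<alpha> = \<alpha> + single i m"
    using update by (intro poly_mapping_eqI) (auto simp: lookup_update lookup_add lookup_single in_keys_iff when_def)
  ultimately show ?case by simp
qed

text \<open>In this form an operator identity reduces to its value on constants and its commutator
  with one variable.\<close>

lemma mpol_induct [case_names const add var]:
  fixes p :: "'a::comm_semiring_1 mpol"
  assumes const: "\<And>c. P (Cst c)" and add: "\<And>p q. P p \<Longrightarrow> P q \<Longrightarrow> P (p + q)"
    and var: "\<And>i p. P p \<Longrightarrow> P (X i * p)"
  shows "P p"
proof (induction p rule: poly_mapping_single_induct)
  case zero
  show ?case using const[of 0] by (simp add: Cst_def)
next
  case (single \<alpha> c)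
  show ?case
  proof (induction \<alpha> rule: expo_induct)
    case zero
    show ?case using const[of c] by (simp add: Cst_def)
  next
    case (add \<alpha> i)
    have "single (\<alpha> + single i 1) c = X i * single \<alpha> c"
      by (simp add: X_def Mon_def mult_single add.commute)
    then show ?case using var[OF add] by simp
  qed
next
  case (add p q)
  then show ?case using assms(2) by simp
qed

lemma Cst_0 [simp]: "Cst 0 = 0"
  by (simp add: Cst_def)

lemma Cst_1 [simp]: "Cst 1 = 1"
  by (simp add: Cst_def)

lemma Cst_mult: "Cst (a * b) = Cst a * (Cst b :: 'a::semiring_0 mpol)"
  by (simp add: Cst_def mult_single)

lemma Cst_minus: "Cst (- a) = - (Cst a :: 'a::ab_group_add mpol)"
  by (simp add: Cst_def single_uminus)

lemma Cst_of_nat: "Cst (of_nat m) = (of_nat m :: 'a::semiring_1 mpol)"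
  by (simp add: Cst_def)

lemma lookup_Cst_mult: "lookup (Cst c * p) \<alpha> = c * lookup (p :: 'a::semiring_0 mpol) \<alpha>"
proof (induction p rule: poly_mapping_single_induct)
  case (single \<alpha> d)
  then show ?case by (simp add: Cst_def mult_single lookup_single when_def)
qed (simp_all add: distrib_left lookup_add)

lemma lookup_X_mult_add: "lookup (X i * p) (\<alpha> + single i 1) = lookup (p :: 'a::semiring_1 mpol) \<alpha>"
proof (induction p rule: poly_mapping_single_induct)
  case (single \<gamma> d)
  then show ?case
    by (simp add: X_def Mon_def mult_single lookup_single when_def add.commute[of "single i (Suc 0)"])
qed (simp_all add: distrib_left lookup_add)

lemma lookup_X_mult_0:
  assumes "lookup \<alpha> i = 0"
  shows "lookup (X i * p) \<alpha> = (0 :: 'a::semiring_1)"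
proof (induction p rule: poly_mapping_single_induct)
  case (single \<gamma> d)
  have "single i (Suc 0) + \<gamma> \<noteq> \<alpha>"
    using assms by (metis add_is_0 lookup_add lookup_single_eq nat.distinct(1))
  then show ?case
    by (simp add: X_def Mon_def mult_single lookup_single when_def)
qed (simp_all add: distrib_left lookup_add)

lemma X_neq:
  assumes "i \<noteq> j"
  shows "X i - X j \<noteq> (0 :: 'a::idom mpol)"
proof
  assume "X i - X j = (0 :: 'a mpol)"
  then have "lookup (X i - X j :: 'a mpol) (single i 1) = 0" by simp
  moreover have "single i (Suc 0) \<noteq> single j (Suc 0)"
    using assms by (metis lookup_single_eq lookup_single_not_eq nat.distinct(1))
  ultimately show False by (simp add: lookup_minus X_def Mon_def lookup_single when_def)
qed

lemma lookup_map_key: "inj \<sigma> \<Longrightarrow> lookup (map_key \<sigma> \<alpha>) i = lookup \<alpha> (\<sigma> i)"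
  by (simp add: map_key.rep_eq)

section \<open>Action of permutations on exponents and polynomials\<close>

lemma map_key_inv_cancel:
  assumes "bij \<sigma>"
  shows "map_key \<sigma> (map_key (inv \<sigma>) \<alpha>) = \<alpha>" "map_key (inv \<sigma>) (map_key \<sigma> \<alpha>) = \<alpha>"
proof -
  have b: "inj \<sigma>" "inj (inv \<sigma>)" using assms by (simp_all add: bij_is_inj bij_imp_bij_inv)
  show "map_key \<sigma> (map_key (inv \<sigma>) \<alpha>) = \<alpha>" "map_key (inv \<sigma>) (map_key \<sigma> \<alpha>) = \<alpha>"
    using assms b by (auto intro!: poly_mapping_eqI simp: lookup_map_key bij_is_surj surj_f_inv_f bij_is_inj)
qed

lemma permute_vars_add:
  "bij \<sigma> \<Longrightarrow> permute_vars \<sigma> (p + q) = permute_vars \<sigma> p + permute_vars \<sigma> (q :: 'a::monoid_add mpol)"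
  by (rule poly_mapping_eqI) (simp add: lookup_permute_vars lookup_add)

lemma permute_vars_diff:
  "bij \<sigma> \<Longrightarrow> permute_vars \<sigma> (p - q) = permute_vars \<sigma> p - permute_vars \<sigma> (q :: 'a::cancel_comm_monoid_add mpol)"
  by (rule poly_mapping_eqI) (simp add: lookup_permute_vars lookup_minus minus_poly_mapping.rep_eq)

lemma permute_vars_0 [simp]: "bij \<sigma> \<Longrightarrow> permute_vars \<sigma> 0 = 0"
  by (rule poly_mapping_eqI) (simp add: lookup_permute_vars)

lemma permute_vars_sum:
  "bij \<sigma> \<Longrightarrow> permute_vars \<sigma> (\<Sum>x\<in>A. f x) = (\<Sum>x\<in>A. permute_vars \<sigma> (f x :: 'a::comm_monoid_add mpol))"
  by (rule poly_mapping_eqI) (simp add: lookup_permute_vars lookup_sum)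

lemma permute_vars_single:
  assumes "bij \<sigma>"
  shows "permute_vars \<sigma> (single \<alpha> c) = single (map_key (inv \<sigma>) \<alpha>) c"
proof (rule poly_mapping_eqI)
  fix \<gamma>
  have "\<alpha> = map_key \<sigma> \<gamma> \<longleftrightarrow> map_key (inv \<sigma>) \<alpha> = \<gamma>"
    using map_key_inv_cancel[OF assms] by metis
  then show "lookup (permute_vars \<sigma> (single \<alpha> c)) \<gamma> = lookup (single (map_key (inv \<sigma>) \<alpha>) c) \<gamma>"
    using assms by (simp add: lookup_permute_vars lookup_single when_def)
qed

lemma permute_vars_mult:
  fixes p q :: "'a::semiring_0 mpol"
  assumes "bij \<sigma>"
  shows "permute_vars \<sigma> (p * q) = permute_vars \<sigma> p * permute_vars \<sigma> q"
proof (induction p rule: poly_mapping_single_induct)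
  case (single \<alpha> c)
  show ?case
  proof (induction q rule: poly_mapping_single_induct)
    case (single \<gamma> d)
    have "inj (inv \<sigma>)" using assms by (simp add: bij_imp_bij_inv bij_is_inj)
    then show ?case using assms by (simp add: mult_single permute_vars_single map_key_plus)
  qed (simp_all add: assms permute_vars_add distrib_left)
qed (simp_all add: assms permute_vars_add distrib_right)

lemma permute_vars_Cst [simp]:
  assumes "bij \<sigma>"
  shows "permute_vars \<sigma> (Cst c) = Cst c"
proof -
  have "inj (inv \<sigma>)" using assms by (simp add: bij_imp_bij_inv bij_is_inj)
  then show ?thesis using assms by (simp add: Cst_def permute_vars_single)
qed

lemma permute_vars_X [simp]:
  assumes "bij \<sigma>"
  shows "permute_vars \<sigma> (X i) = X (\<sigma> i)"
proof -
  have i: "inj (inv \<sigma>)" using assms by (simp add: bij_imp_bij_inv bij_is_inj)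
  have "map_key (inv \<sigma>) (single i (1::nat)) = single (\<sigma> i) 1"
    using assms i by (intro poly_mapping_eqI) (auto simp: lookup_map_key lookup_single when_def bij_is_inj bij_is_surj surj_f_inv_f)
  then show ?thesis using assms by (simp add: X_def Mon_def permute_vars_single)
qed

lemma permute_vars_comp:
  assumes "bij \<sigma>" "bij \<tau>"
  shows "permute_vars \<sigma> (permute_vars \<tau> p) = permute_vars (\<sigma> \<circ> \<tau>) p"
proof (rule poly_mapping_eqI)
  fix \<alpha> :: expo
  have "map_key \<tau> (map_key \<sigma> \<alpha>) = map_key (\<sigma> \<circ> \<tau>) \<alpha>"
    using assms by (intro poly_mapping_eqI) (simp add: lookup_map_key bij_is_inj bij_comp)
  then show "lookup (permute_vars \<sigma> (permute_vars \<tau> p)) \<alpha> = lookup (permute_vars (\<sigma> \<circ> \<tau>) p) \<alpha>"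
    using assms by (simp add: lookup_permute_vars bij_comp)
qed

lemma permute_vars_id [simp]: "permute_vars id p = p"
proof (rule poly_mapping_eqI)
  fix \<alpha> :: expo
  have "map_key id \<alpha> = \<alpha>" by (rule poly_mapping_eqI) (simp add: lookup_map_key)
  then show "lookup (permute_vars id p) \<alpha> = lookup p \<alpha>" by (simp add: lookup_permute_vars)
qed

abbreviation swap_vars :: "nat \<Rightarrow> nat \<Rightarrow> 'a::zero mpol \<Rightarrow> 'a mpol" where
  "swap_vars i j \<equiv> permute_vars (transpose i j)"

lemma swap_vars_swap [simp]: "swap_vars i j (swap_vars i j p) = p"
  by (simp add: permute_vars_comp)

section \<open>Partial derivatives\<close>

lemma lookup_pdiff:
  "lookup (pdiff i p) \<alpha> = of_nat (lookup \<alpha> i + 1) * lookup p (\<alpha> + single i 1)"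
proof -
  have eq: "lookup (single (\<gamma> - single i 1) (of_nat (lookup \<gamma> i) * lookup p \<gamma>)) \<alpha>
      = (if \<gamma> = \<alpha> + single i 1 then of_nat (lookup \<alpha> i + 1) * lookup p \<gamma> else 0)" for \<gamma>
  proof (cases "lookup \<gamma> i = 0")
    case True
    then have "\<gamma> \<noteq> \<alpha> + single i 1" by (metis One_nat_def add_eq_0_iff_both_eq_0 lookup_add lookup_single_eq one_neq_zero)
    then show ?thesis using True by simp
  next
    case False
    have "\<gamma> - single i 1 = \<alpha> \<longleftrightarrow> \<gamma> = \<alpha> + single i 1"
    proof
      assume a: "\<gamma> - single i 1 = \<alpha>"
      show "\<gamma> = \<alpha> + single i 1"
        unfolding a[symmetric] using False
        by (intro poly_mapping_eqI) (auto simp: lookup_add lookup_minus minus_poly_mapping.rep_eq lookup_single when_def)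
    next
      assume "\<gamma> = \<alpha> + single i 1"
      then show "\<gamma> - single i 1 = \<alpha>" by simp
    qed
    then show ?thesis by (auto simp: lookup_single when_def lookup_add)
  qed
  show ?thesis
    unfolding pdiff_def lookup_sum eq by (simp add: sum.delta in_keys_iff)
qed

lemma pdiff_add: "pdiff i (p + q) = pdiff i p + pdiff i (q :: 'a::semiring_1 mpol)"
  by (rule poly_mapping_eqI) (simp add: lookup_pdiff lookup_add distrib_left)

lemma pdiff_Cst [simp]: "pdiff i (Cst c) = 0"
proof (rule poly_mapping_eqI)
  fix \<alpha>
  have "\<alpha> + single i (Suc 0) \<noteq> 0"
    by (metis add_is_0 lookup_add lookup_single_eq lookup_zero nat.distinct(1))
  then show "lookup (pdiff i (Cst c)) \<alpha> = lookup 0 \<alpha>"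
    by (auto simp: lookup_pdiff Cst_def lookup_single when_def)
qed

lemma pdiff_0 [simp]: "pdiff i 0 = 0"
  using pdiff_Cst[of i 0] by simp

lemma pdiff_X_mult:
  "pdiff i (X j * p) = (if i = j then p else 0) + X j * pdiff i (p :: 'a::comm_semiring_1 mpol)"
proof (rule poly_mapping_eqI)
  fix \<alpha> :: expo
  show "lookup (pdiff i (X j * p)) \<alpha> = lookup ((if i = j then p else 0) + X j * pdiff i p) \<alpha>"
  proof (cases "lookup \<alpha> j = 0")
    case True
    then show ?thesis
      using lookup_X_mult_0[of "\<alpha> + single i (Suc 0)" j p] lookup_X_mult_0[of \<alpha> j "pdiff i p"] lookup_X_mult_add[of i p \<alpha>]
      by (auto simp: lookup_pdiff lookup_add lookup_single when_def)
  next
    case False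
    define \<gamma> where "\<gamma> = \<alpha> - single j (Suc 0)"
    have \<alpha>: "\<alpha> = \<gamma> + single j (Suc 0)"
      unfolding \<gamma>_def using False
      by (intro poly_mapping_eqI) (auto simp: lookup_add minus_poly_mapping.rep_eq lookup_single when_def)
    show ?thesis
      using lookup_X_mult_add[of j p "\<gamma> + single i (Suc 0)"] lookup_X_mult_add[of j "pdiff i p" \<gamma>]
      unfolding \<alpha> by (simp add: lookup_pdiff lookup_add add.assoc add.commute[of "single i (Suc 0)"])
        (auto simp: lookup_single when_def algebra_simps)
  qed
qed

lemma pdiff_X: "pdiff i (X j) = (if i = j then 1 else (0 :: 'a::comm_semiring_1 mpol))"
  using pdiff_X_mult[of i j "1 :: 'a mpol"] pdiff_Cst[of i "1 :: 'a"] by simp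

lemma pdiff_mult:
  "pdiff i (p * q) = pdiff i p * q + p * pdiff i (q :: 'a::comm_semiring_1 mpol)"
proof (induction p rule: mpol_induct)
  case (const c)
  have "pdiff i (Cst c * q) = Cst c * pdiff i q"
    by (rule poly_mapping_eqI) (simp add: lookup_pdiff lookup_Cst_mult mult.left_commute)
  then show ?case by simp
next
  case (add p q)
  then show ?case by (simp add: distrib_left distrib_right pdiff_add algebra_simps)
next
  case (var j p)
  then show ?case by (auto simp: mult.assoc pdiff_X_mult distrib_left distrib_right add.assoc)
qed

lemma pdiff_diff: "pdiff i (p - q) = pdiff i p - pdiff i (q :: 'a::ring_1 mpol)"
  by (rule poly_mapping_eqI) (simp add: lookup_pdiff lookup_minus right_diff_distrib)

lemma pdiff_Cst_mult: "pdiff i (Cst c * p) = Cst c * pdiff i (p :: 'a::comm_semiring_1 mpol)"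
  by (simp add: pdiff_mult)

lemma permute_vars_pdiff:
  assumes "bij \<sigma>"
  shows "permute_vars \<sigma> (pdiff i p) = pdiff (\<sigma> i) (permute_vars \<sigma> (p :: 'a::comm_semiring_1 mpol))"
proof (induction p rule: mpol_induct)
  case (var j p)
  then show ?case
    using assms by (simp add: pdiff_X_mult permute_vars_add permute_vars_mult bij_is_inj inj_eq)
qed (simp_all add: assms permute_vars_add pdiff_add)

section \<open>Divided differences\<close>

text \<open>Same description as \<open>divided_diff\<close>, but over an integral domain, because
  the operators are also needed over \<open>complex poly\<close>.\<close>

definition ddiff :: "nat \<Rightarrow> nat \<Rightarrow> 'a::idom mpol \<Rightarrow> 'a mpol" where
  "ddiff i j p = (THE q. (X i - X j) * q = p - swap_vars i j p)"

lemma divided_diff_eq_ddiff: "divided_diff = ddiff"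
  by (intro ext) (simp add: divided_diff_def ddiff_def)

lemma ddiff_exists: "\<exists>q. (X i - X j) * q = p - swap_vars i j (p :: 'a::idom mpol)"
proof (induction p rule: mpol_induct)
  case (const c)
  show ?case by (rule exI[of _ 0]) simp
next
  case (add p q)
  then obtain r s where "(X i - X j) * r = p - swap_vars i j p" "(X i - X j) * s = q - swap_vars i j q"
    by blast
  then have "(X i - X j) * (r + s) = p + q - swap_vars i j (p + q)"
    by (simp add: distrib_left permute_vars_add)
  then show ?case by blast
next
  case (var l p)
  then obtain r where r: "(X i - X j) * r = p - swap_vars i j p" by blast
  \<comment> \<open>\<open>c\<close> is the divided difference of the variable itself; the witness
    below is the twisted product rule for \<open>X l * p\<close>.\<close>
  define c :: "'a mpol" where "c = (if l = i then 1 else if l = j then -1 else 0)"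
  have c: "X (transpose i j l) = X l - (X i - X j) * c"
    by (simp add: c_def transpose_def)
  have "(X i - X j) * (c * p + X (transpose i j l) * r)
      = ((X i - X j) * c) * p + X (transpose i j l) * ((X i - X j) * r)"
    by (simp add: algebra_simps)
  also have "\<dots> = ((X i - X j) * c) * p + X (transpose i j l) * (p - swap_vars i j p)"
    by (simp only: r)
  also have "\<dots> = X l * p - X (transpose i j l) * swap_vars i j p"
    unfolding c by (simp add: algebra_simps)
  finally have "(X i - X j) * (c * p + X (transpose i j l) * r) = X l * p - swap_vars i j (X l * p)"
    by (simp add: permute_vars_mult)
  then show ?case by blast
qed

lemma ddiff_eqI:
  assumes "i \<noteq> j" "(X i - X j) * q = p - swap_vars i j (p :: 'a::idom mpol)"
  shows "ddiff i j p = q"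
  unfolding ddiff_def
proof (rule the_equality)
  fix r assume "(X i - X j) * r = p - swap_vars i j p"
  then have "(X i - X j) * r = (X i - X j) * q" using assms by simp
  then show "r = q" using X_neq[OF assms(1)] mult_cancel_left by blast
qed (use assms in simp)

lemma ddiff_mult_X:
  "i \<noteq> j \<Longrightarrow> (X i - X j) * ddiff i j p = p - swap_vars i j (p :: 'a::idom mpol)"
  using ddiff_exists[of i j p] ddiff_eqI[of i j _ p] by metis

lemma ddiff_add: "i \<noteq> j \<Longrightarrow> ddiff i j (p + q) = ddiff i j p + ddiff i j (q :: 'a::idom mpol)"
  by (intro ddiff_eqI) (simp_all add: distrib_left ddiff_mult_X permute_vars_add)

lemma ddiff_Cst [simp]: "i \<noteq> j \<Longrightarrow> ddiff i j (Cst c :: 'a::idom mpol) = 0"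
  by (intro ddiff_eqI) simp_all

lemma ddiff_0 [simp]: "i \<noteq> j \<Longrightarrow> ddiff i j (0 :: 'a::idom mpol) = 0"
  by (intro ddiff_eqI) simp_all

lemma ddiff_sum:
  "i \<noteq> j \<Longrightarrow> ddiff i j (\<Sum>x\<in>A. f x) = (\<Sum>x\<in>A. ddiff i j (f x :: 'a::idom mpol))"
  by (induction A rule: infinite_finite_induct) (simp_all add: ddiff_add)

text \<open>Twisted product rule: insert \<open>swap_vars i j p * q\<close> between
  \<open>p * q\<close> and its image under the exchange.\<close>

lemma ddiff_mult:
  assumes "i \<noteq> j"
  shows "ddiff i j (p * q) = ddiff i j p * q + swap_vars i j p * ddiff i j (q :: 'a::idom mpol)"
proof (intro ddiff_eqI assms)
  have "(X i - X j) * (ddiff i j p * q + swap_vars i j p * ddiff i j q)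
      = ((X i - X j) * ddiff i j p) * q + swap_vars i j p * ((X i - X j) * ddiff i j q)"
    by (simp add: algebra_simps)
  then show "(X i - X j) * (ddiff i j p * q + swap_vars i j p * ddiff i j q) = p * q - swap_vars i j (p * q)"
    unfolding ddiff_mult_X[OF assms] by (simp add: permute_vars_mult algebra_simps)
qed

lemma ddiff_Cst_mult: "i \<noteq> j \<Longrightarrow> ddiff i j (Cst c * p) = Cst c * ddiff i j (p :: 'a::idom mpol)"
  by (simp add: ddiff_mult)

lemma ddiff_X:
  assumes "i \<noteq> j"
  shows "ddiff i j (X l :: 'a::idom mpol) = (if l = i then 1 else if l = j then - 1 else 0)"
  using assms by (intro ddiff_eqI) (auto simp: transpose_def)

lemma permute_vars_ddiff:
  assumes "bij \<sigma>" "i \<noteq> j"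
  shows "permute_vars \<sigma> (ddiff i j p) = ddiff (\<sigma> i) (\<sigma> j) (permute_vars \<sigma> (p :: 'a::idom mpol))"
proof (rule ddiff_eqI[symmetric])
  show "\<sigma> i \<noteq> \<sigma> j" using assms by (simp add: bij_is_inj inj_eq)
  have "transpose (\<sigma> i) (\<sigma> j) \<circ> \<sigma> = \<sigma> \<circ> transpose i j"
    using assms by (auto simp: fun_eq_iff transpose_def bij_is_inj inj_eq)
  moreover have "permute_vars \<sigma> ((X i - X j) * ddiff i j p) = permute_vars \<sigma> (p - swap_vars i j p)"
    using ddiff_mult_X[OF assms(2), of p] by simp
  ultimately show "(X (\<sigma> i) - X (\<sigma> j)) * permute_vars \<sigma> (ddiff i j p)
      = permute_vars \<sigma> p - swap_vars (\<sigma> i) (\<sigma> j) (permute_vars \<sigma> p)"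
    using assms by (simp add: permute_vars_mult permute_vars_diff permute_vars_comp)
qed

section \<open>Dunkl and Cherednik operators\<close>

lemma permute_vars_ident [simp]: "permute_vars (\<lambda>i. i) p = p"
  using permute_vars_id[of p] by (simp add: id_def)

lemma swap_vars_commute: "swap_vars i j = swap_vars j i"
  by (simp add: transpose_commute)

lemma permute_vars_swap_vars:
  assumes "bij \<sigma>"
  shows "permute_vars \<sigma> (swap_vars i j p) = swap_vars (\<sigma> i) (\<sigma> j) (permute_vars \<sigma> p)"
proof -
  have "\<sigma> \<circ> transpose i j = transpose (\<sigma> i) (\<sigma> j) \<circ> \<sigma>"
    using assms by (auto simp: fun_eq_iff transpose_def bij_is_inj inj_eq)
  then show ?thesis using assms by (simp add: permute_vars_comp)
qed

lemma transpose_bij_betw: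
  assumes "a \<in> A \<longleftrightarrow> b \<in> A"
  shows "bij_betw (transpose a b) A A"
  using assms by (auto simp: bij_betw_def intro: inj_on_subset[OF bij_is_inj])

text \<open>The Dunkl operator of type A with parameter \<open>b\<close>. Unlike the Cherednik
  operators, these are permuted by the symmetric group, which makes their commutation
  accessible.\<close>

definition Dunkl :: "nat \<Rightarrow> 'a::idom \<Rightarrow> nat \<Rightarrow> 'a mpol \<Rightarrow> 'a mpol" where
  "Dunkl n b i p = pdiff i p + Cst b * (\<Sum>j\<in>{1..n} - {i}. ddiff i j p)"

lemma Dunkl_add: "Dunkl n b i (p + q) = Dunkl n b i p + Dunkl n b i q"
  by (simp add: Dunkl_def pdiff_add ddiff_add sum.distrib distrib_left)

lemma Dunkl_Cst [simp]: "Dunkl n b i (Cst c) = 0"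
  by (simp add: Dunkl_def)

lemma Dunkl_0 [simp]: "Dunkl n b i 0 = 0"
  using Dunkl_Cst[of n b i 0] by simp

lemma Dunkl_sum: "Dunkl n b i (\<Sum>x\<in>A. f x) = (\<Sum>x\<in>A. Dunkl n b i (f x))"
  by (induction A rule: infinite_finite_induct) (simp_all add: Dunkl_add)

lemma Dunkl_Cst_mult: "Dunkl n b i (Cst c * p) = Cst c * Dunkl n b i p"
  by (simp add: Dunkl_def pdiff_Cst_mult ddiff_Cst_mult distrib_left mult.left_commute flip: sum_distrib_left)

lemma permute_vars_Dunkl:
  assumes "\<sigma> permutes {1..n}" "i \<in> {1..n}"
  shows "permute_vars \<sigma> (Dunkl n b i p) = Dunkl n b (\<sigma> i) (permute_vars \<sigma> p)"
proof -
  have b: "bij \<sigma>" using assms(1) by (rule permutes_bij)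
  have "(\<Sum>j\<in>{1..n} - {i}. ddiff (\<sigma> i) (\<sigma> j) (permute_vars \<sigma> p))
      = (\<Sum>j\<in>{1..n} - {\<sigma> i}. ddiff (\<sigma> i) j (permute_vars \<sigma> p))"
  proof (rule sum.reindex_bij_betw)
    show "bij_betw \<sigma> ({1..n} - {i}) ({1..n} - {\<sigma> i})"
      using permutes_inj[OF assms(1)] permutes_image[OF assms(1)]
      by (auto simp: bij_betw_def image_set_diff intro: inj_on_subset)
  qed
  moreover have "(\<Sum>j\<in>{1..n} - {i}. permute_vars \<sigma> (ddiff i j p))
      = (\<Sum>j\<in>{1..n} - {i}. ddiff (\<sigma> i) (\<sigma> j) (permute_vars \<sigma> p))"
    using b by (intro sum.cong refl permute_vars_ddiff) auto
  ultimately show ?thesis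
    using b by (simp add: Dunkl_def permute_vars_add permute_vars_mult permute_vars_sum permute_vars_pdiff)
qed

lemma swap_vars_Dunkl:
  assumes "a \<in> {1..n}" "c \<in> {1..n}" "i \<in> {1..n}"
  shows "swap_vars a c (Dunkl n b i p) = Dunkl n b (transpose a c i) (swap_vars a c p)"
  using assms by (intro permute_vars_Dunkl permutes_swap_id) auto

text \<open>The commutator of the Dunkl operator with index \<open>i\<close> and multiplication by
  \<open>X k\<close>. Variables with index outside \<open>{1..n}\<close> behave as scalars, hence
  the final 0.\<close>

definition Dunkl_comm :: "nat \<Rightarrow> 'a::idom \<Rightarrow> nat \<Rightarrow> nat \<Rightarrow> 'a mpol \<Rightarrow> 'a mpol" where
  "Dunkl_comm n b i k p =
     (if k = i then p + Cst b * (\<Sum>j\<in>{1..n} - {i}. swap_vars i j p)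
      else if k \<in> {1..n} then - (Cst b * swap_vars i k p) else 0)"

lemma Dunkl_X_mult: "Dunkl n b i (X k * p) = X k * Dunkl n b i p + Dunkl_comm n b i k p"
proof -
  have dd: "ddiff i j (X k * p) = X k * ddiff i j p + (if k = i then swap_vars i j p else if k = j then - swap_vars i j p else 0)"
    if "i \<noteq> j" for j
    using ddiff_mult[OF that, of p "X k"] that by (simp add: mult.commute ddiff_X)
  have "(\<Sum>j\<in>{1..n} - {i}. ddiff i j (X k * p)) = (\<Sum>j\<in>{1..n} - {i}. X k * ddiff i j p +
      (if k = i then swap_vars i j p else if k = j then - swap_vars i j p else 0))"
    by (intro sum.cong refl dd) auto
  then have "(\<Sum>j\<in>{1..n} - {i}. ddiff i j (X k * p)) = X k * (\<Sum>j\<in>{1..n} - {i}. ddiff i j p)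
     + (\<Sum>j\<in>{1..n} - {i}. if k = i then swap_vars i j p else if k = j then - swap_vars i j p else 0)"
    by (simp add: sum.distrib sum_distrib_left)
  also have "(\<Sum>j\<in>{1..n} - {i}. if k = i then swap_vars i j p else if k = j then - swap_vars i j p else 0)
     = (if k = i then (\<Sum>j\<in>{1..n} - {i}. swap_vars i j p) else if k \<in> {1..n} then - swap_vars i k p else 0)"
    by (auto simp: sum.delta)
  finally show ?thesis
    unfolding Dunkl_def Dunkl_comm_def pdiff_X_mult by (simp add: distrib_left mult.left_commute)
qed

text \<open>By the Jacobi identity it suffices that the commutators of each Dunkl operator with
  \<open>X k\<close> cancel against the other operator. The remaining case \<open>k = j\<close>
  follows by interchanging \<open>i\<close> and \<open>j\<close>.\<close>

lemma Dunkl_commutator_X_mult: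
  assumes i: "i \<in> {1..n}" and j: "j \<in> {1..n}" and "i \<noteq> j" "k \<noteq> j"
  shows "Dunkl n b i (Dunkl n b j (X k * p)) - Dunkl n b j (Dunkl n b i (X k * p)) =
    X k * (Dunkl n b i (Dunkl n b j p) - Dunkl n b j (Dunkl n b i p))"
proof -
  let ?D = "Dunkl n b"
  have "?D i (?D j (X k * p)) - ?D j (?D i (X k * p)) = X k * (?D i (?D j p) - ?D j (?D i p))
      + (Dunkl_comm n b i k (?D j p) - ?D j (Dunkl_comm n b i k p)
      + (?D i (Dunkl_comm n b j k p) - Dunkl_comm n b j k (?D i p)))"
    by (simp add: Dunkl_X_mult Dunkl_add right_diff_distrib)
  moreover have "Dunkl_comm n b i k (?D j p) - ?D j (Dunkl_comm n b i k p)
      + (?D i (Dunkl_comm n b j k p) - Dunkl_comm n b j k (?D i p)) = 0"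
  proof -
    consider "k = i" | "k \<noteq> i" "k \<in> {1..n}" | "k \<noteq> i" "k \<notin> {1..n}" by blast
    then show ?thesis
    proof cases
      case 1
      \<comment> \<open>For \<open>l\<close> different from \<open>j\<close> the exchange of
        \<open>i\<close> and \<open>l\<close> fixes \<open>j\<close> and commutes with the operator
        of index \<open>j\<close>. Only \<open>l = j\<close> survives, and it is cancelled by the
        commutator of \<open>X i\<close> with that operator.\<close>
      have "swap_vars i l (?D j p) - ?D j (swap_vars i l p) =
          (if l = j then ?D i (swap_vars i j p) - ?D j (swap_vars i j p) else 0)"
        if "l \<in> {1..n} - {i}" for l
        using that i j \<open>i \<noteq> j\<close> by (auto simp: swap_vars_Dunkl)
      then have "(\<Sum>l\<in>{1..n} - {i}. swap_vars i l (?D j p) - ?D j (swap_vars i l p)) =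
          (\<Sum>l\<in>{1..n} - {i}. if l = j then ?D i (swap_vars i j p) - ?D j (swap_vars i j p) else 0)"
        by (rule sum.cong[OF refl])
      also have "\<dots> = ?D i (swap_vars i j p) - ?D j (swap_vars i j p)"
        using j \<open>i \<noteq> j\<close> by (simp add: sum.delta)
      finally have *: "(\<Sum>l\<in>{1..n} - {i}. swap_vars i l (?D j p)) - (\<Sum>l\<in>{1..n} - {i}. ?D j (swap_vars i l p))
        = ?D i (swap_vars i j p) - ?D j (swap_vars i j p)"
        by (simp add: sum_subtractf)
      have "Dunkl_comm n b i k (?D j p) - ?D j (Dunkl_comm n b i k p) =
          Cst b * ((\<Sum>l\<in>{1..n} - {i}. swap_vars i l (?D j p)) - (\<Sum>l\<in>{1..n} - {i}. ?D j (swap_vars i l p)))"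
        using 1 by (simp add: Dunkl_comm_def Dunkl_add Dunkl_Cst_mult Dunkl_sum right_diff_distrib)
      moreover have "?D i (Dunkl_comm n b j k p) - Dunkl_comm n b j k (?D i p) =
          Cst b * (?D j (swap_vars i j p) - ?D i (swap_vars i j p))"
        using 1 i j \<open>i \<noteq> j\<close> Dunkl_Cst_mult[of n b i "- b" "swap_vars j i p"]
        by (simp add: Dunkl_comm_def Cst_minus swap_vars_Dunkl swap_vars_commute[of j i] right_diff_distrib)
      ultimately show ?thesis unfolding * by (simp add: right_diff_distrib)
    next
      case 2
      then show ?thesis
        using i j assms(3,4) Dunkl_Cst_mult[of n b j "- b" "swap_vars i k p"] Dunkl_Cst_mult[of n b i "- b" "swap_vars j k p"]
        by (simp add: Dunkl_comm_def swap_vars_Dunkl Cst_minus)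
    next
      case 3
      then have "Dunkl_comm n b i k q = 0" "Dunkl_comm n b j k q = 0" for q
        using assms by (simp_all add: Dunkl_comm_def del: atLeastAtMost_iff)
      then show ?thesis by simp
    qed
  qed
  ultimately show ?thesis by simp
qed

text \<open>The commutator of two Dunkl operators commutes with multiplication by every variable and kills
  the constants.\<close>

lemma Dunkl_commute:
  assumes i: "i \<in> {1..n}" and j: "j \<in> {1..n}"
  shows "Dunkl n b i (Dunkl n b j p) = Dunkl n b j (Dunkl n b i p)"
proof (cases "i = j")
  case False
  have "Dunkl n b i (Dunkl n b j p) - Dunkl n b j (Dunkl n b i p) = 0"
  proof (induction p rule: mpol_induct)
    case (add p q)
    then show ?case by (simp add: Dunkl_add)
  next
    case (var k p)
    show ?case
    proof (cases "k = j")
      case True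
      then have "k \<noteq> i" using False by simp
      from Dunkl_commutator_X_mult[OF j i _ this, of b p] False var show ?thesis by simp
    next
      case k: False
      from Dunkl_commutator_X_mult[OF i j False this, of b p] var show ?thesis by simp
    qed
  qed simp
  then show ?thesis by simp
qed simp

section \<open>Cherednik operators and their commutation\<close>

text \<open>The operator of the problem in a form suited to commutators: an
  \<open>X\<close>-multiple of a Dunkl operator plus a sum of exchanges of Jucys-Murphy
  type.\<close>

definition Cherednik :: "nat \<Rightarrow> 'a::idom \<Rightarrow> nat \<Rightarrow> 'a mpol \<Rightarrow> 'a mpol" where
  "Cherednik n b i p = X i * Dunkl n b i p + Cst b * (\<Sum>j\<in>{i<..n}. swap_vars i j p)"

text \<open>For \<open>j > i\<close>, replacing \<open>X i\<close> by \<open>X j\<close> in front of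
  the divided difference costs \<open>p - swap_vars i j p\<close>; the \<open>n - i\<close> copies
  of \<open>p\<close> make up the constant term.\<close>

lemma Cherednik_eq:
  assumes "i \<in> {1..n}"
  shows "Cherednik n b i p = X i * pdiff i p
     + Cst b * (\<Sum>j\<in>{1..n} - {i}. X (max i j) * ddiff i j p) + Cst (b * of_nat (n - i)) * p"
proof -
  have s: "{1..n} - {i} = {1..<i} \<union> {i<..n}" using assms by auto
  have split: "(\<Sum>j\<in>{1..n} - {i}. f j) = (\<Sum>j\<in>{1..<i}. f j) + (\<Sum>j\<in>{i<..n}. f j)" for f :: "nat \<Rightarrow> 'a mpol"
    unfolding s by (rule sum.union_disjoint) auto
  have "X j * ddiff i j p = X i * ddiff i j p - p + swap_vars i j p" if "j \<in> {i<..n}" for j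
    using ddiff_mult_X[of i j p] that by (simp add: left_diff_distrib algebra_simps)
  then have "(\<Sum>j\<in>{i<..n}. X (max i j) * ddiff i j p) = (\<Sum>j\<in>{i<..n}. X i * ddiff i j p - p + swap_vars i j p)"
    by (intro sum.cong) (auto simp: max_def)
  also have "\<dots> = X i * (\<Sum>j\<in>{i<..n}. ddiff i j p) - of_nat (n - i) * p + (\<Sum>j\<in>{i<..n}. swap_vars i j p)"
    by (simp add: sum.distrib sum_subtractf sum_distrib_left)
  finally have gt: "(\<Sum>j\<in>{i<..n}. X (max i j) * ddiff i j p) = \<dots>" .
  have lt: "(\<Sum>j\<in>{1..<i}. X (max i j) * ddiff i j p) = X i * (\<Sum>j\<in>{1..<i}. ddiff i j p)"
    by (auto simp: sum_distrib_left max_def intro!: sum.cong)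
  show ?thesis
    unfolding Cherednik_def Dunkl_def split gt lt Cst_mult Cst_of_nat by (simp add: algebra_simps)
qed

lemma Cherednik_add: "Cherednik n b i (p + q) = Cherednik n b i p + Cherednik n b i q"
  by (simp add: Cherednik_def Dunkl_add permute_vars_add sum.distrib distrib_left)

lemma Cherednik_Cst_mult: "Cherednik n b i (Cst c * p) = Cst c * Cherednik n b i p"
  by (simp add: Cherednik_def Dunkl_Cst_mult permute_vars_mult distrib_left mult.left_commute flip: sum_distrib_left)

text \<open>The parts \<open>X i * D_i\<close> and \<open>X j * D_j\<close> do not commute: their
  commutator is a multiple of \<open>X i * D_i - X j * D_j\<close> applied after the exchange of
  \<open>i\<close> and \<open>j\<close>. The term \<open>l = j\<close> in the exchange sum of index
  \<open>i\<close> yields the opposite contribution, and everything else commutes.\<close>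

lemma Cherednik_commute_less:
  fixes b :: "'a::idom"
  assumes i: "i \<in> {1..n}" and j: "j \<in> {1..n}" and "i < j"
  shows "Cherednik n b i (Cherednik n b j p) = Cherednik n b j (Cherednik n b i p)"
proof -
  let ?D = "Dunkl n b" and ?b = "Cst b"
  let ?J = "\<lambda>i q. (\<Sum>l\<in>{i<..n}. swap_vars i l (q :: 'a mpol))"
  let ?s = "swap_vars i j p"
  have J_add: "?J i (q + r) = ?J i q + ?J i r" and J_Cst: "?J i (Cst c * q) = Cst c * ?J i q" for i c q r
    by (simp_all add: permute_vars_add sum.distrib permute_vars_mult sum_distrib_left)
  have JJ: "?J i (?J j p) = ?J j (?J i p)"
  proof -
    have "?J j (?J i p) = (\<Sum>m\<in>{j<..n}. \<Sum>l\<in>{i<..n}. swap_vars j m (swap_vars i l p))"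
      by (simp add: permute_vars_sum)
    also have "\<dots> = (\<Sum>m\<in>{j<..n}. \<Sum>l\<in>{i<..n}. swap_vars i l (swap_vars j m p))"
    proof (rule sum.cong[OF refl])
      fix m assume m: "m \<in> {j<..n}"
      have "(\<Sum>l\<in>{i<..n}. swap_vars j m (swap_vars i l p))
          = (\<Sum>l\<in>{i<..n}. swap_vars i (transpose j m l) (swap_vars j m p))"
        using m \<open>i < j\<close> by (intro sum.cong[OF refl], subst permute_vars_swap_vars) simp_all
      also have "\<dots> = (\<Sum>l\<in>{i<..n}. swap_vars i l (swap_vars j m p))"
        using m \<open>i < j\<close> by (intro sum.reindex_bij_betw transpose_bij_betw) auto
      finally show "(\<Sum>l\<in>{i<..n}. swap_vars j m (swap_vars i l p)) = \<dots>" .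
    qed
    also have "\<dots> = ?J i (?J j p)"
      by (subst sum.swap) (simp add: permute_vars_sum)
    finally show ?thesis by simp
  qed
  have XD: "X i * ?D i (X j * ?D j p) = X i * X j * ?D i (?D j p) - ?b * (X i * ?D i ?s)"
    using assms by (simp add: Dunkl_X_mult Dunkl_comm_def swap_vars_Dunkl algebra_simps)
  have XD': "X j * ?D j (X i * ?D i p) = X i * X j * ?D i (?D j p) - ?b * (X j * ?D j ?s)"
    using assms by (simp add: Dunkl_X_mult Dunkl_comm_def swap_vars_Dunkl swap_vars_commute[of j i] Dunkl_commute[OF i j] algebra_simps)
  have JD: "?J j (X i * ?D i p) = X i * ?D i (?J j p)"
    unfolding Dunkl_sum sum_distrib_left
    using assms by (intro sum.cong) (auto simp: permute_vars_mult swap_vars_Dunkl)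
  have split: "{i<..n} = insert j ({i<..n} - {j})" using assms by auto
  have "(\<Sum>l\<in>{i<..n} - {j}. swap_vars i l (X j * ?D j p)) = X j * ?D j (\<Sum>l\<in>{i<..n} - {j}. swap_vars i l p)"
    unfolding Dunkl_sum sum_distrib_left
    using assms by (intro sum.cong) (auto simp: permute_vars_mult swap_vars_Dunkl)
  moreover have "?J i (X j * ?D j p) = swap_vars i j (X j * ?D j p) + (\<Sum>l\<in>{i<..n} - {j}. swap_vars i l (X j * ?D j p))"
    by (subst split, subst sum.insert) auto
  moreover have "?J i p = ?s + (\<Sum>l\<in>{i<..n} - {j}. swap_vars i l p)"
    by (subst split, subst sum.insert) auto
  ultimately have JD': "?J i (X j * ?D j p) = X i * ?D i ?s - X j * ?D j ?s + X j * ?D j (?J i p)"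
    using assms by (simp add: permute_vars_mult swap_vars_Dunkl Dunkl_add algebra_simps)
  have 1: "Cherednik n b i (Cherednik n b j p) =
      X i * ?D i (X j * ?D j p) + ?b * (X i * ?D i (?J j p)) + ?b * ?J i (X j * ?D j p) + ?b * (?b * ?J i (?J j p))"
    unfolding Cherednik_def J_add J_Cst Dunkl_add Dunkl_Cst_mult by (simp add: algebra_simps)
  have 2: "Cherednik n b j (Cherednik n b i p) =
      X j * ?D j (X i * ?D i p) + ?b * (X j * ?D j (?J i p)) + ?b * ?J j (X i * ?D i p) + ?b * (?b * ?J j (?J i p))"
    unfolding Cherednik_def J_add J_Cst Dunkl_add Dunkl_Cst_mult by (simp add: algebra_simps)
  show ?thesis
    unfolding 1 2 XD XD' JD JD' JJ by (simp add: algebra_simps)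
qed

lemma Cherednik_commute:
  assumes "i \<in> {1..n}" "j \<in> {1..n}"
  shows "Cherednik n b i (Cherednik n b j p) = Cherednik n b j (Cherednik n b i p)"
  using Cherednik_commute_less[OF assms] Cherednik_commute_less[OF assms(2,1)]
  by (metis linorder_less_linear)

lemma swap_vars_Cherednik:
  assumes "i \<in> {1..n}" "Suc i \<in> {1..n}" "j \<in> {1..n}" "j \<noteq> i" "j \<noteq> Suc i"
  shows "swap_vars i (Suc i) (Cherednik n b j p) = Cherednik n b j (swap_vars i (Suc i) p)"
proof -
  have "(\<Sum>l\<in>{j<..n}. swap_vars i (Suc i) (swap_vars j l p))
      = (\<Sum>l\<in>{j<..n}. swap_vars j (transpose i (Suc i) l) (swap_vars i (Suc i) p))"
    using assms by (intro sum.cong[OF refl], subst permute_vars_swap_vars) simp_all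
  also have "\<dots> = (\<Sum>l\<in>{j<..n}. swap_vars j l (swap_vars i (Suc i) p))"
    using assms by (intro sum.reindex_bij_betw transpose_bij_betw) auto
  finally show ?thesis
    using assms by (simp add: Cherednik_def permute_vars_add permute_vars_mult permute_vars_sum swap_vars_Dunkl)
qed

text \<open>A relation of the degenerate affine Hecke algebra: conjugation carries the exchange
  terms with \<open>l > Suc i\<close> to those of index \<open>Suc i\<close>, while the term
  \<open>l = Suc i\<close> becomes \<open>Cst b * p\<close>.\<close>

lemma swap_vars_Cherednik_left:
  assumes "i \<in> {1..n}" "Suc i \<in> {1..n}"
  shows "swap_vars i (Suc i) (Cherednik n b i p) = Cherednik n b (Suc i) (swap_vars i (Suc i) p) + Cst b * p"
proof -
  let ?s = "swap_vars i (Suc i)"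
  have split: "{i<..n} = insert (Suc i) {Suc i<..n}" using assms by auto
  have "(\<Sum>l\<in>{i<..n}. ?s (swap_vars i l p)) = p + (\<Sum>l\<in>{Suc i<..n}. ?s (swap_vars i l p))"
    by (subst split) simp
  also have "(\<Sum>l\<in>{Suc i<..n}. ?s (swap_vars i l p)) = (\<Sum>l\<in>{Suc i<..n}. swap_vars (Suc i) l (?s p))"
    by (intro sum.cong[OF refl], subst permute_vars_swap_vars) simp_all
  finally show ?thesis
    using assms by (simp add: Cherednik_def permute_vars_add permute_vars_mult permute_vars_sum swap_vars_Dunkl algebra_simps)
qed

lemma swap_vars_Cherednik_right:
  assumes "i \<in> {1..n}" "Suc i \<in> {1..n}"
  shows "swap_vars i (Suc i) (Cherednik n b (Suc i) p) = Cherednik n b i (swap_vars i (Suc i) p) - Cst b * swap_vars i (Suc i) (swap_vars i (Suc i) p)"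
proof -
  let ?s = "swap_vars i (Suc i)"
  have "?s (?s (Cherednik n b i (?s p))) = ?s (Cherednik n b (Suc i) p + Cst b * ?s p)"
    unfolding swap_vars_Cherednik_left[OF assms] by simp
  then show ?thesis by (simp add: permute_vars_add permute_vars_mult algebra_simps)
qed

section \<open>The symmetric operators\<close>

definition Cher_shift :: "nat \<Rightarrow> 'a::idom \<Rightarrow> 'a \<Rightarrow> nat \<Rightarrow> 'a mpol \<Rightarrow> 'a mpol" where
  "Cher_shift n b u i p = Cst u * p + Cherednik n b i p"

text \<open>\<open>Sop\<close> over an arbitrary integral domain and with arbitrary parameter
  (Sekiguchi operator).\<close>

definition SekOp :: "nat \<Rightarrow> 'a::idom \<Rightarrow> 'a \<Rightarrow> 'a mpol \<Rightarrow> 'a mpol" where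
  "SekOp n b u p = foldr (Cher_shift n b u) [1..<Suc n] p"

lemma Dhat_eq_Cherednik: "i \<in> {1..n} \<Longrightarrow> Dhat n i p = Cherednik n \<beta> i p"
  by (simp add: Cherednik_eq Dhat_def scale_def divided_diff_eq_ddiff)

lemma Sop_eq_SekOp: "Sop n u p = SekOp n \<beta> u p"
  unfolding Sop_def SekOp_def
  by (intro foldr_cong refl) (auto simp: Cher_shift_def scale_def intro!: Dhat_eq_Cherednik)

lemma Cher_shift_add: "Cher_shift n b u i (p + q) = Cher_shift n b u i p + Cher_shift n b u i q"
  by (simp add: Cher_shift_def Cherednik_add algebra_simps)

lemma Cher_shift_Cst_mult: "Cher_shift n b u i (Cst c * p) = Cst c * Cher_shift n b u i p"
  by (simp add: Cher_shift_def Cherednik_Cst_mult distrib_left mult.left_commute)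

lemma SekOp_add: "SekOp n b u (p + q) = SekOp n b u p + SekOp n b u q"
proof -
  have "foldr (Cher_shift n b u) xs (p + q) = foldr (Cher_shift n b u) xs p + foldr (Cher_shift n b u) xs q" for xs
    by (induction xs) (simp_all add: Cher_shift_add)
  then show ?thesis by (simp add: SekOp_def)
qed

lemma SekOp_Cst_mult: "SekOp n b u (Cst c * p) = Cst c * SekOp n b u p"
proof -
  have "foldr (Cher_shift n b u) xs (Cst c * p) = Cst c * foldr (Cher_shift n b u) xs p" for xs
    by (induction xs) (simp_all add: Cher_shift_Cst_mult)
  then show ?thesis by (simp add: SekOp_def)
qed

lemma SekOp_0 [simp]: "SekOp n b u 0 = 0"
  using SekOp_Cst_mult[of n b u 0 0] by simp

lemma SekOp_sum: "SekOp n b u (\<Sum>x\<in>A. f x) = (\<Sum>x\<in>A. SekOp n b u (f x))"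
  by (induction A rule: infinite_finite_induct) (simp_all add: SekOp_add)

lemma SekOp_diff: "SekOp n b u (p - q) = SekOp n b u p - SekOp n b u q"
proof -
  have "p - q = p + Cst (-1) * q" by (simp add: Cst_minus)
  then show ?thesis by (simp only: SekOp_add SekOp_Cst_mult) (simp add: Cst_minus)
qed

lemma foldr_commute:
  assumes "\<And>x q. x \<in> set xs \<Longrightarrow> f x (g q) = g (f x q)"
  shows "foldr f xs (g p) = g (foldr f xs p)"
  using assms by (induction xs) auto

lemma Cher_shift_commute:
  assumes "i \<in> {1..n}" "j \<in> {1..n}"
  shows "Cher_shift n b u i (Cher_shift n b v j p) = Cher_shift n b v j (Cher_shift n b u i p)"
  by (simp add: Cher_shift_def Cherednik_add Cherednik_Cst_mult Cherednik_commute[OF assms] distrib_left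
      mult.left_commute add_ac)

lemma SekOp_commute: "SekOp n b u (SekOp n b v p) = SekOp n b v (SekOp n b u p)"
  unfolding SekOp_def
  by (intro foldr_commute foldr_commute[symmetric] Cher_shift_commute) auto

text \<open>The exchange passes through all factors except those with index \<open>i\<close> and
  \<open>Suc i\<close>; for these two the correction terms of the Hecke relations cancel in the
  product.\<close>

lemma swap_vars_SekOp_adjacent:
  assumes "i \<in> {1..n}" "Suc i \<in> {1..n}"
  shows "swap_vars i (Suc i) (SekOp n b u p) = SekOp n b u (swap_vars i (Suc i) p)"
proof -
  let ?s = "swap_vars i (Suc i)" and ?T = "Cher_shift n b u"
  obtain A B where l: "[1..<Suc n] = A @ [i, Suc i] @ B"
    and AB: "set A \<subseteq> {1..n} - {i, Suc i}" "set B \<subseteq> {1..n} - {i, Suc i}"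
  proof
    show "[1..<Suc n] = [1..<i] @ [i, Suc i] @ [Suc (Suc i)..<Suc n]"
      using assms upt_add_eq_append[of 1 i "Suc n - i"] by (simp add: upt_conv_Cons)
  qed (use assms in auto)
  have far: "foldr ?T xs (?s q) = ?s (foldr ?T xs q)" if "set xs \<subseteq> {1..n} - {i, Suc i}" for xs q
  proof (rule foldr_commute)
    fix j q assume "j \<in> set xs"
    then have "j \<in> {1..n}" "j \<noteq> i" "j \<noteq> Suc i" using that by auto
    from swap_vars_Cherednik[OF assms this, of b q] show "?T j (?s q) = ?s (?T j q)"
      by (simp add: Cher_shift_def permute_vars_add permute_vars_mult)
  qed
  have s1: "?s (?T i q) = ?T (Suc i) (?s q) + Cst b * q" for q
    using swap_vars_Cherednik_left[OF assms, of b q] by (simp add: Cher_shift_def permute_vars_add permute_vars_mult)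
  have s2: "?s (?T (Suc i) q) + Cst b * q = ?T i (?s q)" for q
    using swap_vars_Cherednik_right[OF assms, of b q] by (simp add: Cher_shift_def permute_vars_add permute_vars_mult)
  have near: "?s (?T i (?T (Suc i) q)) = ?T i (?T (Suc i) (?s q))" for q
  proof -
    have "?s (?T i (?T (Suc i) q)) = ?T (Suc i) (?s (?T (Suc i) q) + Cst b * q)"
      unfolding s1 Cher_shift_add Cher_shift_Cst_mult ..
    also have "\<dots> = ?T (Suc i) (?T i (?s q))" unfolding s2 ..
    finally show ?thesis using Cher_shift_commute[OF assms] by metis
  qed
  show ?thesis
    unfolding SekOp_def l foldr_append far[OF AB(1), symmetric] far[OF AB(2)] by (simp add: near)
qed

lemma swap_vars_SekOp:
  assumes "i \<in> {1..n}" "j \<in> {1..n}"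
  shows "swap_vars i j (SekOp n b u p) = SekOp n b u (swap_vars i j p)"
proof -
  have less: "swap_vars i (i + d) (SekOp n b u p) = SekOp n b u (swap_vars i (i + d) p)"
    if "1 \<le> i" "i + d \<le> n" for i d p
    using that
  proof (induction d arbitrary: p)
    case 0
    then show ?case by simp
  next
    case (Suc d)
    show ?case
    proof (cases "d = 0")
      case True
      then show ?thesis using swap_vars_SekOp_adjacent[of i n] Suc.prems by simp
    next
      case False
      \<comment> \<open>Conjugation by an adjacent transposition shortens the distance; for
        \<open>d = 0\<close> the right-hand side would be the identity, so that case is
        separate.\<close>
      have "transpose i (i + Suc d) = transpose (i + d) (Suc (i + d)) \<circ> transpose i (i + d) \<circ> transpose (i + d) (Suc (i + d))"
        using False by (auto simp: fun_eq_iff transpose_def)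
      then have "swap_vars i (i + Suc d) q
          = swap_vars (i + d) (Suc (i + d)) (swap_vars i (i + d) (swap_vars (i + d) (Suc (i + d)) q))" for q :: "'a mpol"
        by (simp add: permute_vars_comp bij_comp comp_assoc)
      then show ?thesis
        using Suc swap_vars_SekOp_adjacent[of "i + d" n b u] by simp
    qed
  qed
  show ?thesis
    using less[of i "j - i"] less[of j "i - j"] assms by (cases "i \<le> j") (auto simp: swap_vars_commute[of i j])
qed

lemma permute_vars_SekOp:
  assumes "\<sigma> permutes {1..n}"
  shows "permute_vars \<sigma> (SekOp n b u p) = SekOp n b u (permute_vars \<sigma> p)"
  using assms finite_atLeastAtMost
proof (induction arbitrary: p rule: permutes_induct)
  case id
  then show ?case by simp
next
  case (swap i j \<sigma>)
  have "bij \<sigma>" using swap by (simp add: permutes_bij)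
  then show ?case using swap by (simp add: swap_vars_SekOp permute_vars_comp[symmetric] del: o_apply)
qed

section \<open>Triangularity\<close>

lemma sum_singles: "(\<Sum>\<alpha>\<in>keys p. single \<alpha> (lookup p \<alpha>)) = p"
  by (rule poly_mapping_eqI) (simp add: lookup_sum lookup_single when_def sum.delta in_keys_iff)

lemma single_eq_Cst_Mon: "single \<alpha> c = Cst c * Mon \<alpha>"
  for c :: "'a::semiring_1"
  by (simp add: Cst_def Mon_def mult_single)

lemma lookup_Mon: "lookup (Mon \<alpha>) \<gamma> = (if \<alpha> = \<gamma> then 1 else 0)"
  by (simp add: Mon_def lookup_single when_def)

lemma Mon_add: "Mon (\<alpha> + \<gamma>) = Mon \<alpha> * (Mon \<gamma> :: 'a::semiring_1 mpol)"
  by (simp add: Mon_def mult_single)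

lemma Mon_single: "Mon (single i m) = (X i ^ m :: 'a::comm_semiring_1 mpol)"
proof (induction m)
  case 0
  then show ?case by (simp add: Mon_def)
next
  case (Suc m)
  have "single i (Suc m) = single i 1 + single i m" by (simp flip: single_add)
  then show ?case using Suc by (simp add: Mon_add X_def)
qed

lemma swap_vars_Mon: "swap_vars i j (Mon \<alpha>) = Mon (map_key (transpose i j) \<alpha>)"
  by (simp add: Mon_def permute_vars_single)

lemma ddiff_commute:
  assumes "i \<noteq> j"
  shows "ddiff i j p = - ddiff j i (p :: 'a::idom mpol)"
proof (rule ddiff_eqI[OF assms])
  have "(X i - X j) * - ddiff j i p = (X j - X i) * ddiff j i p" by (simp add: algebra_simps)
  then show "(X i - X j) * - ddiff j i p = p - swap_vars i j p"
    using assms by (simp add: ddiff_mult_X swap_vars_commute[of i j])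
qed

text \<open>A geometric sum: after removing \<open>d\<close> from entry \<open>i\<close>, the
  monomial is a common factor times \<open>X i ^ d\<close>, and its image under the exchange is the
  same factor times \<open>X j ^ d\<close>.\<close>

lemma ddiff_Mon:
  assumes "i \<noteq> j" and le: "lookup \<alpha> j \<le> lookup \<alpha> i"
  defines "d \<equiv> lookup \<alpha> i - lookup \<alpha> j"
  shows "ddiff i j (Mon \<alpha>) =
    (\<Sum>t<d. Mon (\<alpha> - single i d + single i t + single j (d - Suc t)) :: 'a::idom mpol)"
proof (rule ddiff_eqI[OF assms(1)])
  let ?\<rho> = "\<alpha> - single i d"
  have 1: "?\<rho> + single i d = \<alpha>"
    using le by (intro poly_mapping_eqI) (auto simp: d_def lookup_add minus_poly_mapping.rep_eq lookup_single when_def)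
  have 2: "?\<rho> + single j d = map_key (transpose i j) \<alpha>"
    using le assms(1) by (intro poly_mapping_eqI)
      (auto simp: d_def lookup_add minus_poly_mapping.rep_eq lookup_single when_def lookup_map_key transpose_def)
  have "(\<Sum>t<d. Mon (?\<rho> + single i t + single j (d - Suc t)))
      = Mon ?\<rho> * (\<Sum>t<d. X j ^ (d - Suc t) * X i ^ t :: 'a mpol)"
    by (simp add: Mon_add Mon_single sum_distrib_left mult_ac)
  then have "(X i - X j) * (\<Sum>t<d. Mon (?\<rho> + single i t + single j (d - Suc t)))
      = Mon ?\<rho> * ((X i - X j) * (\<Sum>t<d. X j ^ (d - Suc t) * X i ^ t :: 'a mpol))"
    by (simp only: mult.left_commute)
  also have "\<dots> = Mon ?\<rho> * (X i ^ d - X j ^ d)"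
    by (simp only: power_diff_sumr2)
  also have "\<dots> = Mon (?\<rho> + single i d) - Mon (?\<rho> + single j d)"
    by (simp add: Mon_add Mon_single right_diff_distrib)
  finally show "(X i - X j) * (\<Sum>t<d. Mon (?\<rho> + single i t + single j (d - Suc t)))
      = Mon \<alpha> - swap_vars i j (Mon \<alpha> :: 'a mpol)"
    unfolding 1 2 swap_vars_Mon .
qed

text \<open>Each monomial of the geometric sum has lost one unit and is strictly less extreme than
  the original in both entries; the case with the smaller entry at \<open>i\<close> follows by
  antisymmetry.\<close>

lemma lookup_ddiff_Mon:
  assumes "i \<noteq> j" and nz: "lookup (ddiff i j (Mon \<alpha>) :: 'a::idom mpol) \<gamma> \<noteq> 0"
  shows "(\<forall>l. l \<noteq> i \<longrightarrow> l \<noteq> j \<longrightarrow> lookup \<gamma> l = lookup \<alpha> l) \<and>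
    Suc (lookup \<gamma> i + lookup \<gamma> j) = lookup \<alpha> i + lookup \<alpha> j \<and>
    lookup \<gamma> i < max (lookup \<alpha> i) (lookup \<alpha> j) \<and> lookup \<gamma> j < max (lookup \<alpha> i) (lookup \<alpha> j)"
proof -
  have *: "(\<forall>l. l \<noteq> i \<longrightarrow> l \<noteq> j \<longrightarrow> lookup \<gamma> l = lookup \<alpha> l) \<and>
    Suc (lookup \<gamma> i + lookup \<gamma> j) = lookup \<alpha> i + lookup \<alpha> j \<and>
    lookup \<gamma> i < max (lookup \<alpha> i) (lookup \<alpha> j) \<and> lookup \<gamma> j < max (lookup \<alpha> i) (lookup \<alpha> j)"
    if ij: "i \<noteq> j" and le: "lookup \<alpha> j \<le> lookup \<alpha> i" and nz: "lookup (ddiff i j (Mon \<alpha>) :: 'a mpol) \<gamma> \<noteq> 0" for i j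
  proof -
    define d where "d = lookup \<alpha> i - lookup \<alpha> j"
    have "(\<Sum>t<d. if \<alpha> - single i d + single i t + single j (d - Suc t) = \<gamma> then 1 else 0 :: 'a) \<noteq> 0"
      using nz unfolding ddiff_Mon[OF ij le] d_def[symmetric] lookup_sum lookup_Mon .
    then obtain t where "t \<in> {..<d}" "(if \<alpha> - single i d + single i t + single j (d - Suc t) = \<gamma> then 1 else 0 :: 'a) \<noteq> 0"
      by (rule sum.not_neutral_contains_not_neutral)
    then have "t < d" and \<gamma>: "\<gamma> = \<alpha> - single i d + single i t + single j (d - Suc t)"
      by (auto split: if_splits)
    then show ?thesis
      using le \<open>i \<noteq> j\<close> unfolding \<gamma> d_def
      by (auto simp: lookup_add minus_poly_mapping.rep_eq lookup_single when_def)
  qed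
  show ?thesis
  proof (cases "lookup \<alpha> j \<le> lookup \<alpha> i")
    case True
    then show ?thesis using *[OF assms(1) True nz] by simp
  next
    case False
    have "lookup (ddiff j i (Mon \<alpha>) :: 'a mpol) \<gamma> \<noteq> 0" using nz ddiff_commute[OF assms(1), of "Mon \<alpha> :: 'a mpol"] by simp
    with *[of j i] False assms(1) show ?thesis by (auto simp: max.commute add.commute)
  qed
qed

text \<open>The factor \<open>X (max i j)\<close> restores the lost unit at the larger index, so
  only that entry can reach the old maximum. Strictness at the smaller index is what makes the
  operators triangular.\<close>

lemma lookup_X_max_ddiff:
  assumes "i \<noteq> j" and nz: "lookup (X (max i j) * ddiff i j p :: 'a::idom mpol) \<gamma> \<noteq> 0"
  shows "\<exists>\<alpha>\<in>keys p. (\<forall>l. l \<noteq> i \<longrightarrow> l \<noteq> j \<longrightarrow> lookup \<gamma> l = lookup \<alpha> l) \<and>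
    lookup \<gamma> i + lookup \<gamma> j = lookup \<alpha> i + lookup \<alpha> j \<and>
    lookup \<gamma> (max i j) \<le> max (lookup \<alpha> i) (lookup \<alpha> j) \<and>
    lookup \<gamma> (min i j) < max (lookup \<alpha> i) (lookup \<alpha> j)"
proof -
  have "lookup \<gamma> (max i j) \<noteq> 0" using nz lookup_X_mult_0 by metis
  define \<gamma>' where "\<gamma>' = \<gamma> - single (max i j) 1"
  have \<gamma>: "\<gamma> = \<gamma>' + single (max i j) 1"
    using \<open>lookup \<gamma> (max i j) \<noteq> 0\<close> unfolding \<gamma>'_def
    by (intro poly_mapping_eqI) (auto simp: lookup_add minus_poly_mapping.rep_eq lookup_single when_def)
  have "lookup (ddiff i j p) \<gamma>' \<noteq> 0"
    using nz unfolding \<gamma> lookup_X_mult_add .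
  moreover have "ddiff i j p = (\<Sum>\<alpha>\<in>keys p. Cst (lookup p \<alpha>) * ddiff i j (Mon \<alpha>))"
    by (subst sum_singles[of p, symmetric]) (simp only: ddiff_sum[OF assms(1)] single_eq_Cst_Mon ddiff_Cst_mult[OF assms(1)])
  ultimately have "(\<Sum>\<alpha>\<in>keys p. lookup p \<alpha> * lookup (ddiff i j (Mon \<alpha>)) \<gamma>') \<noteq> 0"
    by (simp add: lookup_sum lookup_Cst_mult)
  then obtain \<alpha> where "\<alpha> \<in> keys p" "lookup (ddiff i j (Mon \<alpha>) :: 'a mpol) \<gamma>' \<noteq> 0"
    by (auto elim!: sum.not_neutral_contains_not_neutral)
  note \<alpha> = lookup_ddiff_Mon[OF assms(1) this(2)]
  have *: "lookup \<gamma> l = lookup \<gamma>' l + (if l = max i j then 1 else 0)" for l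
    by (simp add: \<gamma> lookup_add lookup_single when_def)
  show ?thesis
  proof (intro bexI[OF _ \<open>\<alpha> \<in> keys p\<close>] conjI allI impI)
    show "lookup \<gamma> l = lookup \<alpha> l" if "l \<noteq> i" "l \<noteq> j" for l
      using \<alpha> that by (simp add: * max_def)
    show "lookup \<gamma> i + lookup \<gamma> j = lookup \<alpha> i + lookup \<alpha> j"
      "lookup \<gamma> (max i j) \<le> max (lookup \<alpha> i) (lookup \<alpha> j)"
      "lookup \<gamma> (min i j) < max (lookup \<alpha> i) (lookup \<alpha> j)"
      using \<alpha> assms(1) unfolding * by (cases "i < j"; simp add: Suc_le_eq)+
  qed
qed

text \<open>Dominance by \<open>\<nu>\<close>, stated without sorting the smaller exponent.\<close>

definition below :: "nat \<Rightarrow> expo \<Rightarrow> expo set" where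
  "below n \<nu> = {\<alpha>. keys \<alpha> \<subseteq> {1..n} \<and> (\<Sum>i=1..n. lookup \<alpha> i) = (\<Sum>i=1..n. lookup \<nu> i) \<and>
     (\<forall>A\<subseteq>{1..n}. (\<Sum>i\<in>A. lookup \<alpha> i) \<le> (\<Sum>i=1..card A. lookup \<nu> i))}"

lemma belowD: "\<alpha> \<in> below n \<nu> \<Longrightarrow> A \<subseteq> {1..n} \<Longrightarrow> (\<Sum>i\<in>A. lookup \<alpha> i) \<le> (\<Sum>i=1..card A. lookup \<nu> i)"
  by (simp add: below_def)

text \<open>For a set containing only one of \<open>i\<close>, \<open>j\<close>, the new sum is at
  most the larger of two sums of \<open>\<alpha>\<close>: over that set, and over the set with this
  index replaced by the other one. Both have the same cardinality.\<close>

lemma below_transfer: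
  assumes \<alpha>: "\<alpha> \<in> below n \<nu>" and ij: "i \<in> {1..n}" "j \<in> {1..n}" "i \<noteq> j"
    and off: "\<And>l. l \<noteq> i \<Longrightarrow> l \<noteq> j \<Longrightarrow> lookup \<gamma> l = lookup \<alpha> l"
    and s: "lookup \<gamma> i + lookup \<gamma> j = lookup \<alpha> i + lookup \<alpha> j"
    and m: "lookup \<gamma> i \<le> max (lookup \<alpha> i) (lookup \<alpha> j)" "lookup \<gamma> j \<le> max (lookup \<alpha> i) (lookup \<alpha> j)"
  shows "\<gamma> \<in> below n \<nu>"
proof -
  have sum2: "(\<Sum>l\<in>A. lookup \<gamma> l) = (\<Sum>l\<in>A. lookup \<alpha> l)" if "i \<in> A" "j \<in> A" "finite A" for A
  proof -
    have A: "A = insert i (insert j (A - {i, j}))" using that by auto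
    have "(\<Sum>l\<in>A - {i, j}. lookup \<gamma> l) = (\<Sum>l\<in>A - {i, j}. lookup \<alpha> l)"
      using off by (intro sum.cong) auto
    then show ?thesis using that ij s by (subst (1 2) A) simp
  qed
  have one: "(\<Sum>l\<in>A. lookup \<gamma> l) \<le> (\<Sum>l=1..card A. lookup \<nu> l)"
    if A: "A \<subseteq> {1..n}" "a \<in> A" "c \<notin> A" and ac: "{a, c} = {i, j}" for A a c
  proof -
    have fin: "finite A" using A finite_subset by blast
    have off': "(\<Sum>l\<in>A - {a}. lookup \<gamma> l) = (\<Sum>l\<in>A - {a}. lookup \<alpha> l)"
      using A ac off by (intro sum.cong) auto
    have A1: "(\<Sum>l\<in>A. lookup \<gamma> l) = lookup \<gamma> a + (\<Sum>l\<in>A - {a}. lookup \<alpha> l)"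
      using off' A fin by (simp add: sum.remove)
    have A2: "(\<Sum>l\<in>A. lookup \<alpha> l) = lookup \<alpha> a + (\<Sum>l\<in>A - {a}. lookup \<alpha> l)"
      using A fin by (simp add: sum.remove)
    have A3: "(\<Sum>l\<in>insert c (A - {a}). lookup \<alpha> l) = lookup \<alpha> c + (\<Sum>l\<in>A - {a}. lookup \<alpha> l)"
      using A fin by simp
    have "card (insert c (A - {a})) = card A"
      using A fin card.remove[OF fin A(2)] by simp
    moreover have "insert c (A - {a}) \<subseteq> {1..n}" using A ac ij by auto
    ultimately have "lookup \<alpha> c + (\<Sum>l\<in>A - {a}. lookup \<alpha> l) \<le> (\<Sum>l=1..card A. lookup \<nu> l)"
      using belowD[OF \<alpha>, of "insert c (A - {a})"] A3 by simp
    moreover have "lookup \<alpha> a + (\<Sum>l\<in>A - {a}. lookup \<alpha> l) \<le> (\<Sum>l=1..card A. lookup \<nu> l)"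
      using belowD[OF \<alpha> A(1)] A2 by simp
    moreover have "lookup \<gamma> a \<le> max (lookup \<alpha> a) (lookup \<alpha> c)"
      using ac m by (auto simp: doubleton_eq_iff max.commute)
    ultimately show ?thesis using A1 by linarith
  qed
  have "(\<Sum>l\<in>A. lookup \<gamma> l) \<le> (\<Sum>l=1..card A. lookup \<nu> l)" if A: "A \<subseteq> {1..n}" for A
  proof -
    have fin: "finite A" using A finite_subset by blast
    consider "i \<in> A" "j \<in> A" | "i \<in> A" "j \<notin> A" | "i \<notin> A" "j \<in> A" | "i \<notin> A" "j \<notin> A" by blast
    then show ?thesis
    proof cases
      case 1
      then show ?thesis using sum2[OF 1 fin] \<alpha> A by (simp add: below_def)
    next
      case 4
      then have "(\<Sum>l\<in>A. lookup \<gamma> l) = (\<Sum>l\<in>A. lookup \<alpha> l)" by (intro sum.cong refl off) auto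
      then show ?thesis using \<alpha> A by (simp add: below_def)
    qed (use one[OF A] in auto)
  qed
  moreover have "keys \<gamma> \<subseteq> {1..n}"
  proof
    fix l assume "l \<in> keys \<gamma>"
    then have "l = i \<or> l = j \<or> l \<in> keys \<alpha>" using off[of l] by (metis in_keys_iff)
    moreover have "keys \<alpha> \<subseteq> {1..n}" using \<alpha> by (simp add: below_def)
    ultimately show "l \<in> {1..n}" using ij by blast
  qed
  moreover have "(\<Sum>l=1..n. lookup \<gamma> l) = (\<Sum>l=1..n. lookup \<nu> l)"
    using sum2[OF ij(1,2)] \<alpha> by (simp add: below_def)
  ultimately show ?thesis by (simp add: below_def)
qed

text \<open>Test \<open>below\<close> on the indices before \<open>min i j\<close> together with
  \<open>i\<close> or \<open>j\<close>: the common initial part cancels.\<close>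

lemma below_max:
  assumes \<alpha>: "\<alpha> \<in> below n \<nu>" and ij: "i \<in> {1..n}" "j \<in> {1..n}" "i \<noteq> j"
    and off: "\<And>l. l \<noteq> i \<Longrightarrow> l \<noteq> j \<Longrightarrow> lookup \<nu> l = lookup \<alpha> l"
  shows "max (lookup \<alpha> i) (lookup \<alpha> j) \<le> lookup \<nu> (min i j)"
proof -
  have "lookup \<alpha> a \<le> lookup \<nu> (min i j)" if "a = i \<or> a = j" for a
  proof -
    let ?m = "min i j"
    have a: "a \<notin> {1..<?m}" and sub: "insert a {1..<?m} \<subseteq> {1..n}" and "1 \<le> ?m" using that ij by auto
    then have "card (insert a {1..<?m}) = ?m" by simp
    then have "lookup \<alpha> a + (\<Sum>l=1..<?m. lookup \<alpha> l) \<le> (\<Sum>l=1..?m. lookup \<nu> l)"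
      using belowD[OF \<alpha> sub] a by simp
    also have "(\<Sum>l=1..?m. lookup \<nu> l) = lookup \<nu> ?m + (\<Sum>l=1..<?m. lookup \<nu> l)"
    proof -
      have "{1..?m} = insert ?m {1..<?m}" using \<open>1 \<le> ?m\<close> by auto
      then show ?thesis by simp
    qed
    also have "(\<Sum>l=1..<?m. lookup \<nu> l) = (\<Sum>l=1..<?m. lookup \<alpha> l)"
      using off by (intro sum.cong) auto
    finally show ?thesis by simp
  qed
  then show ?thesis by simp
qed

lemma lookup_X_pdiff: "lookup (X i * pdiff i p) \<gamma> = of_nat (lookup \<gamma> i) * lookup (p :: 'a::comm_semiring_1 mpol) \<gamma>"
proof (cases "lookup \<gamma> i = 0")
  case True
  then show ?thesis by (simp add: lookup_X_mult_0)
next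
  case False
  define \<gamma>' where "\<gamma>' = \<gamma> - single i 1"
  have \<gamma>: "\<gamma> = \<gamma>' + single i 1"
    using False unfolding \<gamma>'_def
    by (intro poly_mapping_eqI) (auto simp: lookup_add minus_poly_mapping.rep_eq lookup_single when_def)
  show ?thesis unfolding \<gamma> lookup_X_mult_add lookup_pdiff by (simp add: lookup_add)
qed

text \<open>An exchange term reaching \<open>\<nu>\<close> would have to be strict at
  \<open>min i j\<close>, which \<open>below_max\<close> excludes. Thus the diagonal entry consists
  only of the Euler term and the constant term.\<close>

lemma keys_Cherednik:
  fixes p :: "'a::idom mpol"
  assumes i: "i \<in> {1..n}" and p: "keys p \<subseteq> below n \<nu>"
  shows "keys (Cherednik n b i p) \<subseteq> below n \<nu>"
    and "lookup (Cherednik n b i p) \<nu> = (of_nat (lookup \<nu> i) + of_nat (n - i) * b) * lookup p \<nu>"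
proof -
  have lk: "lookup (Cherednik n b i p) \<gamma> = (of_nat (lookup \<gamma> i) + of_nat (n - i) * b) * lookup p \<gamma>
      + b * (\<Sum>j\<in>{1..n} - {i}. lookup (X (max i j) * ddiff i j p) \<gamma>)" for \<gamma>
    unfolding Cherednik_eq[OF i] lookup_add lookup_X_pdiff lookup_Cst_mult lookup_sum by (simp add: algebra_simps)
  show "keys (Cherednik n b i p) \<subseteq> below n \<nu>"
  proof
    fix \<gamma> assume \<gamma>: "\<gamma> \<in> keys (Cherednik n b i p)"
    show "\<gamma> \<in> below n \<nu>"
    proof (cases "\<gamma> \<in> keys p")
      case True
      then show ?thesis using p by auto
    next
      case False
      then have "(\<Sum>j\<in>{1..n} - {i}. lookup (X (max i j) * ddiff i j p) \<gamma>) \<noteq> 0"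
        using \<gamma> unfolding in_keys_iff lk by auto
      then obtain j where j: "j \<in> {1..n} - {i}" "lookup (X (max i j) * ddiff i j p) \<gamma> \<noteq> 0"
        by (rule sum.not_neutral_contains_not_neutral)
      then obtain \<alpha> where "\<alpha> \<in> keys p" "\<forall>l. l \<noteq> i \<longrightarrow> l \<noteq> j \<longrightarrow> lookup \<gamma> l = lookup \<alpha> l"
        "lookup \<gamma> i + lookup \<gamma> j = lookup \<alpha> i + lookup \<alpha> j"
        "lookup \<gamma> (max i j) \<le> max (lookup \<alpha> i) (lookup \<alpha> j)"
        "lookup \<gamma> (min i j) < max (lookup \<alpha> i) (lookup \<alpha> j)"
        using lookup_X_max_ddiff[of i j p \<gamma>] by auto
      note \<alpha> = this
      show ?thesis
      proof (rule below_transfer)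
        show "\<alpha> \<in> below n \<nu>" "i \<in> {1..n}" "j \<in> {1..n}" "i \<noteq> j"
          using \<alpha> p i j by auto
        show "lookup \<gamma> i \<le> max (lookup \<alpha> i) (lookup \<alpha> j)" "lookup \<gamma> j \<le> max (lookup \<alpha> i) (lookup \<alpha> j)"
          using \<alpha>(4,5) by (cases "i < j"; simp)+
      qed (use \<alpha> in auto)
    qed
  qed
  have "lookup (X (max i j) * ddiff i j p) \<nu> = 0" if j: "j \<in> {1..n} - {i}" for j
  proof (rule ccontr)
    assume "lookup (X (max i j) * ddiff i j p) \<nu> \<noteq> 0"
    then obtain \<alpha> where "\<alpha> \<in> keys p" "\<forall>l. l \<noteq> i \<longrightarrow> l \<noteq> j \<longrightarrow> lookup \<nu> l = lookup \<alpha> l"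
      "lookup \<nu> (min i j) < max (lookup \<alpha> i) (lookup \<alpha> j)"
      using lookup_X_max_ddiff[of i j p \<nu>] j by auto
    with below_max[of \<alpha> n \<nu> i j] i j p show False by force
  qed
  then show "lookup (Cherednik n b i p) \<nu> = (of_nat (lookup \<nu> i) + of_nat (n - i) * b) * lookup p \<nu>"
    by (simp add: lk)
qed

definition eigval :: "nat \<Rightarrow> 'a::idom \<Rightarrow> 'a \<Rightarrow> expo \<Rightarrow> 'a" where
  "eigval n b u \<nu> = (\<Prod>i=1..n. u + of_nat (lookup \<nu> i) + of_nat (n - i) * b)"

lemma keys_SekOp:
  fixes p :: "'a::idom mpol"
  assumes p: "keys p \<subseteq> below n \<nu>"
  shows "keys (SekOp n b u p) \<subseteq> below n \<nu>"
    and "lookup (SekOp n b u p) \<nu> = eigval n b u \<nu> * lookup p \<nu>"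
proof -
  have "keys (foldr (Cher_shift n b u) xs p) \<subseteq> below n \<nu> \<and>
      lookup (foldr (Cher_shift n b u) xs p) \<nu> =
        (\<Prod>i\<leftarrow>xs. u + of_nat (lookup \<nu> i) + of_nat (n - i) * b) * lookup p \<nu>"
    if "set xs \<subseteq> {1..n}" for xs
    using that
  proof (induction xs)
    case Nil
    then show ?case using p by simp
  next
    case (Cons i xs)
    let ?q = "foldr (Cher_shift n b u) xs p"
    have q: "keys ?q \<subseteq> below n \<nu>" and i: "i \<in> {1..n}" using Cons by auto
    have "keys (Cst u * ?q) \<subseteq> keys ?q" by (auto simp: in_keys_iff lookup_Cst_mult)
    moreover have "Cher_shift n b u i ?q = Cst u * ?q + Cherednik n b i ?q" by (simp add: Cher_shift_def)
    ultimately have "keys (Cher_shift n b u i ?q) \<subseteq> below n \<nu>"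
      using q keys_Cherednik(1)[OF i q, of b] keys_add[of "Cst u * ?q" "Cherednik n b i ?q"] by auto
    moreover have "lookup (Cher_shift n b u i ?q) \<nu> = (u + of_nat (lookup \<nu> i) + of_nat (n - i) * b) * lookup ?q \<nu>"
      by (simp add: Cher_shift_def lookup_add lookup_Cst_mult keys_Cherednik(2)[OF i q] algebra_simps)
    ultimately show ?case using Cons by (simp add: mult.assoc)
  qed
  from this[of "[1..<Suc n]"] show "keys (SekOp n b u p) \<subseteq> below n \<nu>"
    and "lookup (SekOp n b u p) \<nu> = eigval n b u \<nu> * lookup p \<nu>"
    by (auto simp: SekOp_def eigval_def prod.distinct_set_conv_list[symmetric] atLeastLessThanSuc_atLeastAtMost simp del: upt_Suc)
qed

section \<open>Dominance\<close>

lemma partitionsD: "\<nu> \<in> partitions n \<Longrightarrow> 1 \<le> i \<Longrightarrow> i \<le> j \<Longrightarrow> j \<le> n \<Longrightarrow> lookup \<nu> j \<le> lookup \<nu> i"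
  by (auto simp: partitions_def)

lemma partitions_keys: "\<nu> \<in> partitions n \<Longrightarrow> keys \<nu> \<subseteq> {1..n}"
  by (auto simp: partitions_def)

lemma lookup_outside: "keys \<alpha> \<subseteq> A \<Longrightarrow> i \<notin> A \<Longrightarrow> lookup \<alpha> i = 0"
  by (metis in_keys_iff subsetD)

lemma partitions_eqI:
  assumes "\<mu> \<in> partitions n" "\<nu> \<in> partitions n" "\<And>i. i \<in> {1..n} \<Longrightarrow> lookup \<mu> i = lookup \<nu> i"
  shows "\<mu> = \<nu>"
proof (rule poly_mapping_eqI)
  fix i
  show "lookup \<mu> i = lookup \<nu> i"
    using assms(3) lookup_outside[OF partitions_keys[OF assms(1)]] lookup_outside[OF partitions_keys[OF assms(2)]]
    by (cases "i \<in> {1..n}") simp_all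
qed

text \<open>Removing the largest index \<open>b\<close>: at most \<open>b - 1\<close> indices
  remain, so the entry at \<open>b\<close> is bounded by the next entry of the initial
  segment.\<close>

lemma sum_le_sum_initial:
  assumes "\<nu> \<in> partitions n" "A \<subseteq> {1..n}"
  shows "(\<Sum>i\<in>A. lookup \<nu> i) \<le> (\<Sum>i=1..card A. lookup \<nu> i)"
proof -
  have "finite A" using assms(2) finite_subset by blast
  then show ?thesis using assms(2)
  proof (induction A rule: finite_linorder_max_induct)
    case (insert b A)
    have "A \<subseteq> {1..<b}" using insert by auto
    then have "card A \<le> b - 1" using card_mono[of "{1..<b}" A] by simp
    then have "lookup \<nu> b \<le> lookup \<nu> (Suc (card A))"
      using insert.prems by (intro partitionsD[OF assms(1)]) auto
    moreover have "b \<notin> A" using insert by auto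
    ultimately show ?case using insert by simp
  qed simp
qed

lemma dominated_iff_below:
  assumes \<nu>: "\<nu> \<in> partitions n" and \<mu>: "\<mu> \<in> partitions n"
  shows "dominated n \<mu> \<nu> \<longleftrightarrow> \<mu> \<in> below n \<nu>"
proof
  assume d: "dominated n \<mu> \<nu>"
  have "(\<Sum>i\<in>A. lookup \<mu> i) \<le> (\<Sum>i=1..card A. lookup \<nu> i)" if A: "A \<subseteq> {1..n}" for A
  proof (cases "card A = 0")
    case True
    then have "A = {}" using A finite_subset by fastforce
    then show ?thesis by simp
  next
    case False
    moreover have "card A \<le> n" using card_mono[OF _ A] by simp
    ultimately have "(\<Sum>i=1..card A. lookup \<mu> i) \<le> (\<Sum>i=1..card A. lookup \<nu> i)"
      using d by (simp add: dominated_def)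
    then show ?thesis using sum_le_sum_initial[OF \<mu> A] by linarith
  qed
  then show "\<mu> \<in> below n \<nu>" using d partitions_keys[OF \<mu>] by (simp add: below_def dominated_def)
next
  assume b: "\<mu> \<in> below n \<nu>"
  have "(\<Sum>j=1..i. lookup \<mu> j) \<le> (\<Sum>j=1..i. lookup \<nu> j)" if "i \<in> {1..n}" for i
    using belowD[OF b, of "{1..i}"] that by auto
  then show "dominated n \<mu> \<nu>" using b by (simp add: dominated_def below_def)
qed

text \<open>A numerical function that strictly increases with dominance among partitions; it is used
  to pick maximal exponents.\<close>

definition sqnorm :: "nat \<Rightarrow> expo \<Rightarrow> nat" where
  "sqnorm n \<alpha> = (\<Sum>i=1..n. (lookup \<alpha> i)\<^sup>2)"

text \<open>With \<open>m\<close> and \<open>l\<close> the entries of \<open>\<mu>\<close> and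
  \<open>\<nu>\<close>, expand the square of \<open>l = m + (l - m)\<close>. The mixed term is
  nonnegative by Abel summation, since \<open>m\<close> decreases and the partial sums of
  \<open>l - m\<close> are nonnegative.\<close>

lemma sqnorm_less:
  assumes \<mu>: "\<mu> \<in> partitions n" and \<nu>: "\<nu> \<in> partitions n" and d: "dominated n \<mu> \<nu>" and "\<mu> \<noteq> \<nu>"
  shows "sqnorm n \<mu> < sqnorm n \<nu>"
proof -
  define m l where "m i = int (lookup \<mu> i)" and "l i = int (lookup \<nu> i)" for i
  have ps: "(\<Sum>i=1..j. l i - m i) \<ge> 0" if "j \<le> n" for j
  proof (cases "j = 0")
    case False
    then have "(\<Sum>i=1..j. lookup \<mu> i) \<le> (\<Sum>i=1..j. lookup \<nu> i)"
      using d that by (auto simp: dominated_def)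
    then show ?thesis by (simp add: m_def l_def sum_subtractf flip: of_nat_sum)
  qed simp
  \<comment> \<open>Abel summation as an induction: the factor of the accumulated partial sum may be
    lowered from \<open>m j\<close> to \<open>m (Suc j)\<close>.\<close>
  have "(\<Sum>i=1..j. m i * (l i - m i)) \<ge> m j * (\<Sum>i=1..j. l i - m i)" if "1 \<le> j" "j \<le> n" for j
    using that
  proof (induction j rule: nat_induct_at_least)
    case (Suc j)
    have "m (Suc j) \<le> m j" using partitionsD[OF \<mu>, of j "Suc j"] Suc by (simp add: m_def)
    then have "m (Suc j) * (\<Sum>i=1..j. l i - m i) \<le> m j * (\<Sum>i=1..j. l i - m i)"
      using ps[of j] Suc.prems by (intro mult_right_mono) auto
    then show ?case using Suc by (simp add: distrib_left)
  qed simp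
  from this[of n] have "(\<Sum>i=1..n. m i * (l i - m i)) \<ge> m n * (\<Sum>i=1..n. l i - m i)"
    by (cases "n = 0") auto
  also have "(\<Sum>i=1..n. l i - m i) = 0"
    using d by (simp add: dominated_def m_def l_def sum_subtractf flip: of_nat_sum)
  finally have 1: "(\<Sum>i=1..n. m i * (l i - m i)) \<ge> 0" by simp
  obtain j where j: "j \<in> {1..n}" "m j \<noteq> l j"
    using partitions_eqI[OF \<mu> \<nu>] \<open>\<mu> \<noteq> \<nu>\<close> by (auto simp: m_def l_def)
  have "0 < (l j - m j)\<^sup>2" using j by simp
  also have "\<dots> \<le> (\<Sum>i=1..n. (l i - m i)\<^sup>2)"
    using j by (intro member_le_sum) auto
  finally have 2: "0 < (\<Sum>i=1..n. (l i - m i)\<^sup>2)" .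
  have "(\<Sum>i=1..n. (l i)\<^sup>2) = (\<Sum>i=1..n. (m i)\<^sup>2 + 2 * (m i * (l i - m i)) + (l i - m i)\<^sup>2)"
    by (intro sum.cong refl) (simp add: power2_eq_square algebra_simps)
  also have "\<dots> = (\<Sum>i=1..n. (m i)\<^sup>2) + 2 * (\<Sum>i=1..n. m i * (l i - m i)) + (\<Sum>i=1..n. (l i - m i)\<^sup>2)"
    by (simp add: sum.distrib sum_distrib_left)
  finally have "(\<Sum>i=1..n. (m i)\<^sup>2) < (\<Sum>i=1..n. (l i)\<^sup>2)" using 1 2 by linarith
  then have "int (sqnorm n \<mu>) < int (sqnorm n \<nu>)" by (simp add: sqnorm_def m_def l_def)
  then show ?thesis by simp
qed

lemma dominated_refl [simp]: "dominated n \<nu> \<nu>"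
  by (simp add: dominated_def)

lemma dominated_trans: "dominated n \<kappa> \<mu> \<Longrightarrow> dominated n \<mu> \<nu> \<Longrightarrow> dominated n \<kappa> \<nu>"
  unfolding dominated_def by (metis order.trans)

lemma finite_expos: "finite {\<alpha> :: expo. keys \<alpha> \<subseteq> {1..n} \<and> (\<forall>i. lookup \<alpha> i \<le> N)}" (is "finite ?E")
proof (rule finite_imageD)
  show "finite ((\<lambda>\<alpha>. restrict (lookup \<alpha>) {1..n}) ` ?E)"
    by (rule finite_subset[of _ "PiE {1..n} (\<lambda>_. {..N})"]) (auto intro: finite_PiE)
  show "inj_on (\<lambda>\<alpha>. restrict (lookup \<alpha>) {1..n}) ?E"
  proof (rule inj_onI, rule poly_mapping_eqI)
    fix \<alpha> \<gamma> :: expo and i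
    assume "\<alpha> \<in> ?E" "\<gamma> \<in> ?E" and eq: "restrict (lookup \<alpha>) {1..n} = restrict (lookup \<gamma>) {1..n}"
    then have "keys \<alpha> \<subseteq> {1..n}" "keys \<gamma> \<subseteq> {1..n}" by auto
    then show "lookup \<alpha> i = lookup \<gamma> i"
      using fun_cong[OF eq, of i] lookup_outside[of \<alpha> "{1..n}" i] lookup_outside[of \<gamma> "{1..n}" i]
      by (cases "i \<in> {1..n}") simp_all
  qed
qed

lemma finite_partitions_size: "finite {\<mu> \<in> partitions n. (\<Sum>i=1..n. lookup \<mu> i) = s}"
proof (rule finite_subset[OF _ finite_expos[of n s]], safe)
  fix \<mu> i assume \<mu>: "\<mu> \<in> partitions n" and s: "s = (\<Sum>i=1..n. lookup \<mu> i)"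
  show "lookup \<mu> i \<le> (\<Sum>i=1..n. lookup \<mu> i)"
    using lookup_outside[OF partitions_keys[OF \<mu>], of i] member_le_sum[of i "{1..n}" "lookup \<mu>"]
    by (cases "i \<in> {1..n}") simp_all
qed (blast dest: partitions_keys[THEN subsetD])

lemma finite_dominated: "finite {\<mu> \<in> partitions n. dominated n \<mu> \<nu> \<and> Q \<mu>}"
  by (rule finite_subset[OF _ finite_partitions_size[of n "\<Sum>i=1..n. lookup \<nu> i"]]) (auto simp: dominated_def)

section \<open>Symmetric polynomials\<close>

definition orbit :: "nat \<Rightarrow> expo \<Rightarrow> expo set" where
  "orbit n \<nu> = {map_key \<sigma> \<nu> |\<sigma>. \<sigma> permutes {1..n}}"

lemma orbit_sum_eq: "orbit_sum n \<nu> = (\<Sum>\<alpha>\<in>orbit n \<nu>. Mon \<alpha>)"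
  by (simp add: orbit_sum_def orbit_def)

lemma finite_orbit: "finite (orbit n \<nu>)"
proof -
  have "orbit n \<nu> = (\<lambda>\<sigma>. map_key \<sigma> \<nu>) ` {\<sigma>. \<sigma> permutes {1..n}}" by (auto simp: orbit_def)
  then show ?thesis by (simp add: finite_permutations)
qed

lemma lookup_orbit_sum: "lookup (orbit_sum n \<nu>) \<alpha> = (if \<alpha> \<in> orbit n \<nu> then 1 else (0 :: 'a::comm_semiring_1))"
  by (simp add: orbit_sum_eq lookup_sum lookup_Mon sum.delta finite_orbit)

lemma map_key_comp:
  assumes "inj \<sigma>" "inj \<tau>"
  shows "map_key \<sigma> (map_key \<tau> \<alpha>) = map_key (\<tau> \<circ> \<sigma>) \<alpha>"
  using assms by (intro poly_mapping_eqI) (simp add: lookup_map_key inj_compose del: o_apply, simp)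

lemma orbit_map_key:
  assumes "\<sigma> permutes {1..n}"
  shows "map_key \<sigma> \<alpha> \<in> orbit n \<nu> \<longleftrightarrow> \<alpha> \<in> orbit n \<nu>"
proof -
  have step: "map_key \<sigma> \<alpha> \<in> orbit n \<nu>" if \<alpha>: "\<alpha> \<in> orbit n \<nu>" and \<sigma>: "\<sigma> permutes {1..n}" for \<sigma> \<alpha>
  proof -
    obtain \<tau> where "\<tau> permutes {1..n}" "\<alpha> = map_key \<tau> \<nu>" using \<alpha> by (auto simp: orbit_def)
    then show ?thesis
      using \<sigma> permutes_compose[OF \<sigma>, of \<tau>] by (auto simp: orbit_def map_key_comp permutes_inj)
  qed
  have "map_key (inv \<sigma>) (map_key \<sigma> \<alpha>) = \<alpha>"
    using assms by (simp add: map_key_inv_cancel permutes_bij)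
  then show ?thesis using step[of \<alpha> \<sigma>] step[of "map_key \<sigma> \<alpha>" "inv \<sigma>"] assms permutes_inv by auto
qed

lemma orbit_self: "\<nu> \<in> orbit n \<nu>"
proof -
  have "map_key id \<nu> = \<nu>" by (rule poly_mapping_eqI) (simp add: lookup_map_key)
  then show ?thesis unfolding orbit_def using permutes_id[of "{1..n}"] by (metis (mono_tags, lifting) mem_Collect_eq)
qed

lemma orbit_subset_below:
  assumes "\<nu> \<in> partitions n"
  shows "orbit n \<nu> \<subseteq> below n \<nu>"
proof
  fix \<alpha> assume "\<alpha> \<in> orbit n \<nu>"
  then obtain \<sigma> where \<sigma>: "\<sigma> permutes {1..n}" and \<alpha>: "\<alpha> = map_key \<sigma> \<nu>" by (auto simp: orbit_def)
  have lk: "lookup \<alpha> i = lookup \<nu> (\<sigma> i)" for i using \<sigma> by (simp add: \<alpha> lookup_map_key permutes_inj)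
  have "keys \<alpha> \<subseteq> {1..n}"
  proof
    fix i assume "i \<in> keys \<alpha>"
    then have "\<sigma> i \<in> keys \<nu>" by (simp add: in_keys_iff lk)
    then have "\<sigma> i \<in> {1..n}" using partitions_keys[OF assms] by blast
    then show "i \<in> {1..n}" using \<sigma> by (metis permutes_in_image)
  qed
  moreover have "(\<Sum>i\<in>A. lookup \<alpha> i) \<le> (\<Sum>i=1..card A. lookup \<nu> i)" if A: "A \<subseteq> {1..n}" for A
  proof -
    have inj: "inj_on \<sigma> A" using \<sigma> by (meson inj_on_subset permutes_inj subset_UNIV)
    then have "(\<Sum>i\<in>A. lookup \<alpha> i) = (\<Sum>i\<in>\<sigma> ` A. lookup \<nu> i)" by (simp add: lk sum.reindex)
    moreover have "\<sigma> ` A \<subseteq> {1..n}" using A \<sigma> permutes_image by blast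
    ultimately show ?thesis using sum_le_sum_initial[OF assms, of "\<sigma> ` A"] card_image[OF inj] by simp
  qed
  moreover have "(\<Sum>i=1..n. lookup \<alpha> i) = (\<Sum>i=1..n. lookup \<nu> i)"
    unfolding lk using sum.permute[OF \<sigma>, of "lookup \<nu>"] by simp
  ultimately show "\<alpha> \<in> below n \<nu>" by (simp add: below_def)
qed

text \<open>Each of two partitions in one orbit dominates the other, so strict growth of the square
  norm forces equality.\<close>

lemma orbit_partition:
  assumes \<mu>: "\<mu> \<in> partitions n" and \<nu>: "\<nu> \<in> partitions n" and "\<mu> \<in> orbit n \<nu>"
  shows "\<mu> = \<nu>"
proof (rule ccontr)
  assume "\<mu> \<noteq> \<nu>"
  obtain \<sigma> where \<sigma>: "\<sigma> permutes {1..n}" and "\<mu> = map_key \<sigma> \<nu>" using assms(3) by (auto simp: orbit_def)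
  then have "map_key (inv \<sigma>) \<mu> = \<nu>" by (simp add: map_key_inv_cancel permutes_bij)
  then have "\<nu> \<in> orbit n \<mu>" using permutes_inv[OF \<sigma>] by (auto simp: orbit_def)
  then have "dominated n \<nu> \<mu>" "dominated n \<mu> \<nu>"
    using assms orbit_subset_below[OF \<mu>] orbit_subset_below[OF \<nu>]
    by (auto simp: dominated_iff_below)
  then show False using sqnorm_less[OF \<mu> \<nu>] sqnorm_less[OF \<nu> \<mu>] \<open>\<mu> \<noteq> \<nu>\<close> by simp
qed

lemma lookup_orbit_sum_partition:
  assumes "\<mu> \<in> partitions n" "\<nu> \<in> partitions n"
  shows "lookup (orbit_sum n \<nu>) \<mu> = (if \<mu> = \<nu> then 1 else (0 :: 'a::comm_semiring_1))"
  using orbit_partition[OF assms] orbit_self by (auto simp: lookup_orbit_sum)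

lemma keys_orbit_sum:
  assumes "\<nu> \<in> partitions n"
  shows "keys (orbit_sum n \<nu> :: 'a::comm_semiring_1 mpol) \<subseteq> below n \<nu>"
proof
  fix \<alpha> assume "\<alpha> \<in> keys (orbit_sum n \<nu> :: 'a mpol)"
  then have "\<alpha> \<in> orbit n \<nu>" by (simp add: in_keys_iff lookup_orbit_sum split: if_splits)
  then show "\<alpha> \<in> below n \<nu>" using orbit_subset_below[OF assms] by blast
qed

lemma sym_polysI:
  assumes "\<And>\<alpha>. lookup p \<alpha> \<noteq> 0 \<Longrightarrow> keys \<alpha> \<subseteq> {1..n}"
    and "\<And>\<sigma> \<alpha>. \<sigma> permutes {1..n} \<Longrightarrow> lookup p (map_key \<sigma> \<alpha>) = lookup p \<alpha>"
  shows "p \<in> sym_polys n"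
  using assms by (auto simp: sym_polys_def in_keys_iff lookup_permute_vars permutes_bij intro!: poly_mapping_eqI)

lemma sym_polys_lookup:
  assumes "p \<in> sym_polys n" "\<sigma> permutes {1..n}"
  shows "lookup p (map_key \<sigma> \<alpha>) = lookup p \<alpha>"
  using assms lookup_permute_vars[of \<sigma> p \<alpha>] by (simp add: sym_polys_def permutes_bij)

lemma sym_polys_keys: "p \<in> sym_polys n \<Longrightarrow> lookup p \<alpha> \<noteq> 0 \<Longrightarrow> keys \<alpha> \<subseteq> {1..n}"
  by (auto simp: sym_polys_def in_keys_iff subset_iff)

lemma sym_polys_0 [simp]: "0 \<in> sym_polys n"
  by (intro sym_polysI) simp_all

lemma sym_polys_add:
  fixes p q :: "'a::monoid_add mpol"
  assumes "p \<in> sym_polys n" "q \<in> sym_polys n"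
  shows "p + q \<in> sym_polys n"
proof (rule sym_polysI)
  fix \<alpha> assume "lookup (p + q) \<alpha> \<noteq> 0"
  then have "lookup p \<alpha> \<noteq> 0 \<or> lookup q \<alpha> \<noteq> 0" by (auto simp: lookup_add)
  then show "keys \<alpha> \<subseteq> {1..n}" using assms sym_polys_keys by blast
qed (simp add: lookup_add sym_polys_lookup[OF assms(1)] sym_polys_lookup[OF assms(2)])

lemma sym_polys_Cst_mult:
  fixes p :: "'a::semiring_0 mpol"
  assumes "p \<in> sym_polys n"
  shows "Cst c * p \<in> sym_polys n"
proof (rule sym_polysI)
  fix \<alpha> assume "lookup (Cst c * p) \<alpha> \<noteq> 0"
  then have "lookup p \<alpha> \<noteq> 0" by (auto simp: lookup_Cst_mult)
  then show "keys \<alpha> \<subseteq> {1..n}" using assms sym_polys_keys by blast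
qed (simp add: lookup_Cst_mult sym_polys_lookup[OF assms])

lemma sym_polys_diff:
  fixes p q :: "'a::ring_1 mpol"
  assumes "p \<in> sym_polys n" "q \<in> sym_polys n"
  shows "p - q \<in> sym_polys n"
  using sym_polys_add[OF assms(1) sym_polys_Cst_mult[OF assms(2), of "- 1"]] by (simp add: Cst_minus)

lemma sym_polys_sum: "(\<And>x. x \<in> A \<Longrightarrow> f x \<in> sym_polys n) \<Longrightarrow> (\<Sum>x\<in>A. f x) \<in> sym_polys n"
  for f :: "_ \<Rightarrow> 'a::comm_monoid_add mpol"
  by (induction A rule: infinite_finite_induct) (auto intro: sym_polys_add)

lemma orbit_sum_sym:
  assumes "\<nu> \<in> partitions n"
  shows "(orbit_sum n \<nu> :: 'a::comm_semiring_1 mpol) \<in> sym_polys n"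
proof (rule sym_polysI)
  fix \<alpha> assume "lookup (orbit_sum n \<nu> :: 'a mpol) \<alpha> \<noteq> 0"
  then show "keys \<alpha> \<subseteq> {1..n}" using keys_orbit_sum[OF assms, where ?'a = 'a] by (auto simp: in_keys_iff below_def)
qed (simp add: lookup_orbit_sum orbit_map_key)

lemma expo_sort:
  assumes "keys \<alpha> \<subseteq> {1..n}"
  shows "\<exists>\<sigma>. \<sigma> permutes {1..n} \<and> map_key \<sigma> \<alpha> \<in> partitions n"
proof -
  define xs where "xs = rev (sort (map (lookup \<alpha>) [1..<Suc n]))"
  have len: "length xs = n" by (simp add: xs_def)
  have xs: "xs ! j \<le> xs ! i" if "i \<le> j" "j < n" for i j
  proof -
    have "sorted (rev xs)" by (simp add: xs_def)
    then show ?thesis using sorted_rev_nth_mono[of xs i j] that len by simp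
  qed
  have "image_mset (\<lambda>i. xs ! (i - 1)) (mset_set {1..n}) = mset (map (\<lambda>i. xs ! (i - 1)) [1..<Suc n])"
    by (simp only: mset_map mset_upt atLeastLessThanSuc_atLeastAtMost)
  also have "map (\<lambda>i. xs ! (i - 1)) [1..<Suc n] = xs"
    by (rule nth_equalityI) (auto simp: len simp del: upt_Suc)
  also have "mset xs = image_mset (lookup \<alpha>) (mset_set {1..n})"
    unfolding xs_def mset_rev mset_sort mset_map mset_upt atLeastLessThanSuc_atLeastAtMost ..
  finally obtain \<sigma> where \<sigma>: "\<sigma> permutes {1..n}" "\<forall>i\<in>{1..n}. xs ! (i - 1) = lookup \<alpha> (\<sigma> i)"
    using image_mset_eq_implies_permutes[of "{1..n}" "\<lambda>i. xs ! (i - 1)" "lookup \<alpha>"] by auto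
  have lk: "lookup (map_key \<sigma> \<alpha>) i = lookup \<alpha> (\<sigma> i)" for i using \<sigma> by (simp add: lookup_map_key permutes_inj)
  have "keys (map_key \<sigma> \<alpha>) \<subseteq> {1..n}"
  proof
    fix i assume "i \<in> keys (map_key \<sigma> \<alpha>)"
    then have "\<sigma> i \<in> keys \<alpha>" by (simp add: in_keys_iff lk)
    then have "\<sigma> i \<in> {1..n}" using assms by blast
    then show "i \<in> {1..n}" using \<sigma> by (metis permutes_in_image)
  qed
  moreover have "lookup \<alpha> (\<sigma> j) \<le> lookup \<alpha> (\<sigma> i)" if "1 \<le> i" "i \<le> j" "j \<le> n" for i j
    using \<sigma>(2) xs[of "i - 1" "j - 1"] that by simp
  ultimately have "map_key \<sigma> \<alpha> \<in> partitions n" by (simp add: partitions_def lk)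
  then show ?thesis using \<sigma> by blast
qed

lemma sym_polys_eqI:
  assumes p: "p \<in> sym_polys n" and q: "q \<in> sym_polys n"
    and eq: "\<And>\<nu>. \<nu> \<in> partitions n \<Longrightarrow> lookup p \<nu> = lookup q \<nu>"
  shows "p = q"
proof (rule poly_mapping_eqI)
  fix \<alpha>
  show "lookup p \<alpha> = lookup q \<alpha>"
  proof (cases "keys \<alpha> \<subseteq> {1..n}")
    case True
    then obtain \<sigma> where "\<sigma> permutes {1..n}" "map_key \<sigma> \<alpha> \<in> partitions n" using expo_sort by blast
    then show ?thesis using eq sym_polys_lookup[OF p] sym_polys_lookup[OF q] by metis
  next
    case False
    then show ?thesis using sym_polys_keys[OF p] sym_polys_keys[OF q] by metis
  qed
qed

lemma sym_polys_expand:
  fixes p :: "'a::comm_semiring_1 mpol"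
  assumes p: "p \<in> sym_polys n"
  shows "p = (\<Sum>\<nu>\<in>keys p \<inter> partitions n. Cst (lookup p \<nu>) * orbit_sum n \<nu>)"
proof (rule sym_polys_eqI[OF p])
  show "(\<Sum>\<nu>\<in>keys p \<inter> partitions n. Cst (lookup p \<nu>) * orbit_sum n \<nu>) \<in> sym_polys n"
    by (auto intro!: sym_polys_sum sym_polys_Cst_mult orbit_sum_sym)
  fix \<mu> assume \<mu>: "\<mu> \<in> partitions n"
  have "(\<Sum>\<nu>\<in>keys p \<inter> partitions n. lookup p \<nu> * lookup (orbit_sum n \<nu>) \<mu>)
      = (\<Sum>\<nu>\<in>keys p \<inter> partitions n. if \<mu> = \<nu> then lookup p \<nu> else 0)"
    using \<mu> by (intro sum.cong refl) (auto simp: lookup_orbit_sum_partition)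
  then show "lookup p \<mu> = lookup (\<Sum>\<nu>\<in>keys p \<inter> partitions n. Cst (lookup p \<nu>) * orbit_sum n \<nu>) \<mu>"
    using \<mu> by (simp add: lookup_sum lookup_Cst_mult sum.delta in_keys_iff)
qed

lemma SekOp_expand:
  fixes p :: "'a::idom mpol"
  assumes p: "p \<in> sym_polys n"
  shows "SekOp n b u p = (\<Sum>\<nu>\<in>keys p \<inter> partitions n. Cst (lookup p \<nu>) * SekOp n b u (orbit_sum n \<nu>))"
  by (subst sym_polys_expand[OF p]) (simp only: SekOp_sum SekOp_Cst_mult)

lemma lookup_SekOp_dominated:
  fixes p :: "'a::idom mpol"
  assumes p: "p \<in> sym_polys n" and "lookup (SekOp n b u p) \<alpha> \<noteq> 0"
  shows "\<exists>\<nu>\<in>keys p \<inter> partitions n. \<alpha> \<in> below n \<nu>"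
proof -
  have "(\<Sum>\<nu>\<in>keys p \<inter> partitions n. lookup p \<nu> * lookup (SekOp n b u (orbit_sum n \<nu>)) \<alpha>) \<noteq> 0"
    using assms(2) unfolding SekOp_expand[OF p] by (simp add: lookup_sum lookup_Cst_mult)
  then obtain \<nu> where \<nu>: "\<nu> \<in> keys p \<inter> partitions n" "lookup p \<nu> * lookup (SekOp n b u (orbit_sum n \<nu>)) \<alpha> \<noteq> 0"
    by (rule sum.not_neutral_contains_not_neutral)
  then have "\<alpha> \<in> keys (SekOp n b u (orbit_sum n \<nu> :: 'a mpol))" by (simp add: in_keys_iff)
  then show ?thesis using \<nu> keys_SekOp(1)[OF keys_orbit_sum] by blast
qed

lemma SekOp_sym:
  fixes p :: "'a::idom mpol"
  assumes p: "p \<in> sym_polys n"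
  shows "SekOp n b u p \<in> sym_polys n"
  unfolding sym_polys_def
proof (intro CollectI conjI ballI allI impI)
  fix \<alpha> assume "\<alpha> \<in> keys (SekOp n b u p)"
  then show "keys \<alpha> \<subseteq> {1..n}" using lookup_SekOp_dominated[OF p] by (auto simp: in_keys_iff below_def)
next
  fix \<sigma> assume "\<sigma> permutes {1..n}"
  then show "permute_vars \<sigma> (SekOp n b u p) = SekOp n b u p"
    using p by (simp add: permute_vars_SekOp sym_polys_def)
qed

text \<open>In the expansion by orbit sums, only exponents dominating \<open>\<mu>\<close> can
  contribute at \<open>\<mu>\<close>; by maximality just \<open>\<mu>\<close> itself is
  left.\<close>

lemma lookup_SekOp_maximal:
  fixes p :: "'a::idom mpol"
  assumes p: "p \<in> sym_polys n" and \<mu>: "\<mu> \<in> partitions n"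
    and max: "\<And>\<nu>. \<nu> \<in> partitions n \<Longrightarrow> lookup p \<nu> \<noteq> 0 \<Longrightarrow> dominated n \<mu> \<nu> \<Longrightarrow> \<nu> = \<mu>"
  shows "lookup (SekOp n b u p) \<mu> = eigval n b u \<mu> * lookup p \<mu>"
proof -
  have "lookup (SekOp n b u p) \<mu>
      = (\<Sum>\<nu>\<in>keys p \<inter> partitions n. lookup p \<nu> * lookup (SekOp n b u (orbit_sum n \<nu>)) \<mu>)"
    unfolding SekOp_expand[OF p] by (simp add: lookup_sum lookup_Cst_mult)
  also have "\<dots> = (\<Sum>\<nu>\<in>keys p \<inter> partitions n. if \<nu> = \<mu> then eigval n b u \<mu> * lookup p \<mu> else 0)"
  proof (rule sum.cong[OF refl])
    fix \<nu> assume \<nu>: "\<nu> \<in> keys p \<inter> partitions n"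
    then have k: "keys (orbit_sum n \<nu> :: 'a mpol) \<subseteq> below n \<nu>" by (simp add: keys_orbit_sum)
    show "lookup p \<nu> * lookup (SekOp n b u (orbit_sum n \<nu>)) \<mu> = (if \<nu> = \<mu> then eigval n b u \<mu> * lookup p \<mu> else 0)"
    proof (cases "\<nu> = \<mu>")
      case True
      then show ?thesis using keys_SekOp(2)[OF k, of b u] \<mu> by (simp add: lookup_orbit_sum_partition)
    next
      case False
      then have "\<mu> \<notin> below n \<nu>" using max[of \<nu>] \<nu> \<mu> by (auto simp: dominated_iff_below in_keys_iff)
      then have "lookup (SekOp n b u (orbit_sum n \<nu> :: 'a mpol)) \<mu> = 0"
        using keys_SekOp(1)[OF k, of b u] by (auto simp: in_keys_iff)
      then show ?thesis using False by simp
    qed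
  qed
  also have "\<dots> = eigval n b u \<mu> * lookup p \<mu>"
    using \<mu> by (auto simp: sum.delta in_keys_iff)
  finally show ?thesis .
qed

section \<open>Joint eigenvectors\<close>

text \<open>The spectral parameter is a function of \<open>\<mu>\<close>, so that it can be chosen
  separately for each \<open>\<mu>\<close> to distinguish its eigenvalue from that of the target
  partition.\<close>

definition kill_eig :: "nat \<Rightarrow> 'a::idom \<Rightarrow> (expo \<Rightarrow> 'a) \<Rightarrow> expo \<Rightarrow> 'a mpol \<Rightarrow> 'a mpol" where
  "kill_eig n b u \<mu> p = SekOp n b (u \<mu>) p - Cst (eigval n b (u \<mu>) \<mu>) * p"

definition kill_eigs :: "nat \<Rightarrow> 'a::idom \<Rightarrow> (expo \<Rightarrow> 'a) \<Rightarrow> expo list \<Rightarrow> 'a mpol \<Rightarrow> 'a mpol" where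
  "kill_eigs n b u \<mu>s p = foldr (kill_eig n b u) \<mu>s p"

lemma kill_eigs_add: "kill_eigs n b u \<mu>s (p + q) = kill_eigs n b u \<mu>s p + kill_eigs n b u \<mu>s q"
  by (induction \<mu>s) (simp_all add: kill_eigs_def kill_eig_def SekOp_add algebra_simps)

lemma kill_eigs_Cst_mult: "kill_eigs n b u \<mu>s (Cst c * p) = Cst c * kill_eigs n b u \<mu>s p"
  by (induction \<mu>s) (simp_all add: kill_eigs_def kill_eig_def SekOp_Cst_mult right_diff_distrib mult.left_commute)

lemma kill_eigs_diff: "kill_eigs n b u \<mu>s (p - q) = kill_eigs n b u \<mu>s p - kill_eigs n b u \<mu>s q"
proof -
  have "p - q = p + Cst (-1) * q" by (simp add: Cst_minus)
  then show ?thesis by (simp only: kill_eigs_add kill_eigs_Cst_mult) (simp add: Cst_minus)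
qed

lemma kill_eigs_SekOp: "kill_eigs n b u \<mu>s (SekOp n b v p) = SekOp n b v (kill_eigs n b u \<mu>s p)"
  unfolding kill_eigs_def
  by (intro foldr_commute) (simp add: kill_eig_def SekOp_diff SekOp_Cst_mult SekOp_commute[of n b v])

lemma kill_eig_sym: "p \<in> sym_polys n \<Longrightarrow> kill_eig n b u \<mu> p \<in> sym_polys n"
  by (simp add: kill_eig_def sym_polys_diff sym_polys_Cst_mult SekOp_sym)

lemma kill_eigs_sym: "p \<in> sym_polys n \<Longrightarrow> kill_eigs n b u \<mu>s p \<in> sym_polys n"
  by (induction \<mu>s) (simp_all add: kill_eigs_def kill_eig_sym)

lemma keys_kill_eigs:
  assumes p: "keys p \<subseteq> below n \<nu>"
  shows "keys (kill_eigs n b u \<mu>s p) \<subseteq> below n \<nu> \<and>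
    lookup (kill_eigs n b u \<mu>s p) \<nu> = (\<Prod>\<mu>\<leftarrow>\<mu>s. eigval n b (u \<mu>) \<nu> - eigval n b (u \<mu>) \<mu>) * lookup p \<nu>"
proof (induction \<mu>s)
  case Nil
  then show ?case using p by (simp add: kill_eigs_def)
next
  case (Cons \<mu> \<mu>s)
  let ?q = "kill_eigs n b u \<mu>s p"
  have q: "keys ?q \<subseteq> below n \<nu>" using Cons by simp
  have eq: "kill_eigs n b u (\<mu> # \<mu>s) p = SekOp n b (u \<mu>) ?q - Cst (eigval n b (u \<mu>) \<mu>) * ?q"
    by (simp add: kill_eigs_def kill_eig_def)
  have "\<alpha> \<in> below n \<nu>" if "lookup (kill_eigs n b u (\<mu> # \<mu>s) p) \<alpha> \<noteq> 0" for \<alpha>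
    using that keys_SekOp(1)[OF q, of b "u \<mu>"] q unfolding eq
    by (cases "lookup ?q \<alpha> = 0") (auto simp: lookup_minus lookup_Cst_mult in_keys_iff subset_iff)
  then have "keys (kill_eigs n b u (\<mu> # \<mu>s) p) \<subseteq> below n \<nu>" by (auto simp: in_keys_iff)
  moreover have "lookup (kill_eigs n b u (\<mu> # \<mu>s) p) \<nu> = (eigval n b (u \<mu>) \<nu> - eigval n b (u \<mu>) \<mu>) * lookup ?q \<nu>"
    unfolding eq lookup_minus lookup_Cst_mult keys_SekOp(2)[OF q] by (simp add: algebra_simps)
  ultimately show ?case using Cons by (simp add: mult.assoc)
qed

text \<open>Each factor removes the largest exponent that is still present, as in the theorem of Cayley and Hamilton
  for a triangular operator.\<close>

lemma kill_eigs_eq_0: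
  assumes "sorted (map (sqnorm n) \<mu>s)" "set \<mu>s \<subseteq> partitions n"
    and "\<And>\<mu> \<nu>. \<nu> \<in> set \<mu>s \<Longrightarrow> \<mu> \<in> partitions n \<Longrightarrow> dominated n \<mu> \<nu> \<Longrightarrow> \<mu> \<in> set \<mu>s"
    and "p \<in> sym_polys n" "\<And>\<mu>. \<mu> \<in> partitions n \<Longrightarrow> lookup p \<mu> \<noteq> 0 \<Longrightarrow> \<mu> \<in> set \<mu>s"
  shows "kill_eigs n b u \<mu>s p = 0"
  using assms
\<comment> \<open>\<open>foldr\<close> applies the last list element first, and by sortedness this
  is an element of largest square norm.\<close>
proof (induction \<mu>s arbitrary: p rule: rev_induct)
  case Nil
  then have "p = 0" by (intro sym_polys_eqI[of p n 0]) auto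
  then show ?case by (simp add: kill_eigs_def)
next
  case (snoc \<mu> \<mu>s)
  have le: "sqnorm n \<nu> \<le> sqnorm n \<mu>" if "\<nu> \<in> set \<mu>s" for \<nu>
    using snoc.prems(1) that by (auto simp: sorted_append)
  have \<mu>: "\<mu> \<in> partitions n" using snoc.prems(2) by simp
  have max: "\<nu> = \<mu>" if "\<nu> \<in> partitions n" "\<nu> \<in> set (\<mu>s @ [\<mu>])" "dominated n \<mu> \<nu>" for \<nu>
    using sqnorm_less[OF \<mu> that(1,3)] le[of \<nu>] that(2) by (cases "\<nu> = \<mu>") auto
  let ?q = "kill_eig n b u \<mu> p"
  have "lookup ?q \<mu> = 0"
    using lookup_SekOp_maximal[OF snoc.prems(4) \<mu>, of b "u \<mu>"] max snoc.prems(5)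
    by (simp add: kill_eig_def lookup_minus lookup_Cst_mult)
  moreover have "\<nu> \<in> set (\<mu>s @ [\<mu>])" if \<nu>: "\<nu> \<in> partitions n" "lookup ?q \<nu> \<noteq> 0" for \<nu>
  proof (cases "lookup p \<nu> = 0")
    case False
    then show ?thesis using snoc.prems(5) \<nu> by simp
  next
    case True
    then have "lookup (SekOp n b (u \<mu>) p) \<nu> \<noteq> 0"
      using \<nu> by (simp add: kill_eig_def lookup_minus lookup_Cst_mult)
    then obtain \<kappa> where "\<kappa> \<in> keys p" "\<kappa> \<in> partitions n" "\<nu> \<in> below n \<kappa>"
      using lookup_SekOp_dominated[OF snoc.prems(4)] by blast
    then show ?thesis using snoc.prems(3)[of \<kappa> \<nu>] snoc.prems(5)[of \<kappa>] \<nu> by (simp add: dominated_iff_below in_keys_iff)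
  qed
  ultimately have q: "\<nu> \<in> set \<mu>s" if "\<nu> \<in> partitions n" "lookup ?q \<nu> \<noteq> 0" for \<nu> using that by force
  have "kill_eigs n b u \<mu>s ?q = 0"
  proof (rule snoc.IH)
    fix \<kappa> \<nu> assume k: "\<nu> \<in> set \<mu>s" "\<kappa> \<in> partitions n" "dominated n \<kappa> \<nu>"
    then have "\<kappa> = \<mu> \<or> \<kappa> \<in> set \<mu>s" using snoc.prems(3)[of \<nu> \<kappa>] by auto
    \<comment> \<open>The list may contain repetitions: then \<open>\<mu>\<close> can still occur in
      \<open>\<mu>s\<close> and the set stays closed downwards.\<close>
    moreover have "\<nu> = \<mu>" if "\<kappa> = \<mu>" using max[of \<nu>] k that snoc.prems(2) by auto
    ultimately show "\<kappa> \<in> set \<mu>s" using k by auto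
  qed (use snoc.prems q kill_eig_sym in \<open>auto simp: sorted_append\<close>)
  then show ?case by (simp add: kill_eigs_def)
qed

text \<open>Square norm replaces dominance here because the explicit vanishing polynomial is
  controlled only in this weaker sense. By \<open>sqnorm_less\<close> the set still contains every
  partition dominated by one of its members.\<close>

definition lower_parts :: "nat \<Rightarrow> expo \<Rightarrow> expo set" where
  "lower_parts n \<nu> = {\<mu> \<in> partitions n. (\<Sum>i=1..n. lookup \<mu> i) = (\<Sum>i=1..n. lookup \<nu> i) \<and> sqnorm n \<mu> < sqnorm n \<nu>}"

text \<open>Increasing order makes \<open>foldr\<close> treat the largest square norm first, as the
  elimination requires.\<close>

definition lower_list :: "nat \<Rightarrow> expo \<Rightarrow> expo list" where
  "lower_list n \<nu> = sort_key (sqnorm n) (SOME xs. set xs = lower_parts n \<nu>)"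

lemma set_lower_list: "set (lower_list n \<nu>) = lower_parts n \<nu>"
proof -
  have "finite (lower_parts n \<nu>)"
    by (rule finite_subset[OF _ finite_partitions_size[of n "\<Sum>i=1..n. lookup \<nu> i"]]) (auto simp: lower_parts_def)
  then have "\<exists>xs. set xs = lower_parts n \<nu>" by (rule finite_list)
  then show ?thesis unfolding lower_list_def by (metis (mono_tags, lifting) set_sort someI_ex)
qed

lemma dominated_lower_parts:
  assumes "\<mu> \<in> partitions n" "\<nu> \<in> partitions n" "dominated n \<mu> \<nu>" "\<mu> \<noteq> \<nu>"
  shows "\<mu> \<in> lower_parts n \<nu>"
  using assms sqnorm_less[OF assms] by (simp add: lower_parts_def dominated_def)

lemma kill_lower_eq_0:
  assumes "p \<in> sym_polys n" "\<And>\<mu>. \<mu> \<in> partitions n \<Longrightarrow> lookup p \<mu> \<noteq> 0 \<Longrightarrow> \<mu> \<in> lower_parts n \<nu>"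
  shows "kill_eigs n b u (lower_list n \<nu>) p = 0"
proof (rule kill_eigs_eq_0)
  show "sorted (map (sqnorm n) (lower_list n \<nu>))" by (simp add: lower_list_def)
  show "set (lower_list n \<nu>) \<subseteq> partitions n" by (auto simp: set_lower_list lower_parts_def)
  fix \<mu> \<kappa> assume "\<kappa> \<in> set (lower_list n \<nu>)" and \<mu>: "\<mu> \<in> partitions n" "dominated n \<mu> \<kappa>"
  then have k: "\<kappa> \<in> partitions n" "(\<Sum>i=1..n. lookup \<kappa> i) = (\<Sum>i=1..n. lookup \<nu> i)" "sqnorm n \<kappa> < sqnorm n \<nu>"
    by (auto simp: set_lower_list lower_parts_def)
  moreover have "sqnorm n \<mu> \<le> sqnorm n \<kappa>" using sqnorm_less[OF \<mu>(1) k(1) \<mu>(2)] by (cases "\<mu> = \<kappa>") auto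
  ultimately show "\<mu> \<in> set (lower_list n \<nu>)" using \<mu> by (auto simp: set_lower_list lower_parts_def dominated_def)
qed (use assms in \<open>simp_all add: set_lower_list\<close>)

text \<open>The unnormalized joint eigenvector; free of division, it is compatible with ring
  homomorphisms. Its coefficient at \<open>\<nu>\<close> is \<open>eigvec_lead\<close>.\<close>

definition eigvec :: "nat \<Rightarrow> 'a::idom \<Rightarrow> (expo \<Rightarrow> 'a) \<Rightarrow> expo \<Rightarrow> 'a mpol" where
  "eigvec n b u \<nu> = kill_eigs n b u (lower_list n \<nu>) (orbit_sum n \<nu>)"

definition eigvec_lead :: "nat \<Rightarrow> 'a::idom \<Rightarrow> (expo \<Rightarrow> 'a) \<Rightarrow> expo \<Rightarrow> 'a" where
  "eigvec_lead n b u \<nu> = (\<Prod>\<mu>\<leftarrow>lower_list n \<nu>. eigval n b (u \<mu>) \<nu> - eigval n b (u \<mu>) \<mu>)"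

lemma eigvec_sym: "\<nu> \<in> partitions n \<Longrightarrow> eigvec n b u \<nu> \<in> sym_polys n"
  by (simp add: eigvec_def kill_eigs_sym orbit_sum_sym)

lemma lookup_eigvec:
  assumes "\<nu> \<in> partitions n"
  shows "lookup (eigvec n b u \<nu>) \<nu> = eigvec_lead n b u \<nu>"
    and "keys (eigvec n b u \<nu>) \<subseteq> below n \<nu>"
  using keys_kill_eigs[OF keys_orbit_sum[OF assms], of b u "lower_list n \<nu>"] assms
  by (simp_all add: eigvec_def eigvec_lead_def lookup_orbit_sum_partition)

text \<open>Subtracting the eigenvalue leaves only lower exponents in the image of the orbit sum.
  The product of factors annihilates these and commutes with \<open>SekOp\<close>.\<close>

lemma SekOp_eigvec:
  assumes "\<nu> \<in> partitions n"
  shows "SekOp n b v (eigvec n b u \<nu>) = Cst (eigval n b v \<nu>) * eigvec n b u \<nu>"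
proof -
  let ?m = "orbit_sum n \<nu> :: 'a mpol"
  let ?p = "SekOp n b v ?m - Cst (eigval n b v \<nu>) * ?m"
  have m: "?m \<in> sym_polys n" and k: "keys ?m \<subseteq> below n \<nu>" using assms by (simp_all add: orbit_sum_sym keys_orbit_sum)
  have "kill_eigs n b u (lower_list n \<nu>) ?p = 0"
  proof (rule kill_lower_eq_0)
    show "?p \<in> sym_polys n" using m by (simp add: sym_polys_diff sym_polys_Cst_mult SekOp_sym)
    fix \<mu> assume \<mu>: "\<mu> \<in> partitions n" and nz: "lookup ?p \<mu> \<noteq> 0"
    have "\<mu> \<noteq> \<nu>"
      using nz keys_SekOp(2)[OF k, of b v] assms by (auto simp: lookup_minus lookup_Cst_mult lookup_orbit_sum_partition)
    then have "lookup (SekOp n b v ?m) \<mu> \<noteq> 0"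
      using nz \<mu> assms by (simp add: lookup_minus lookup_Cst_mult lookup_orbit_sum_partition)
    then have "\<mu> \<in> below n \<nu>" using keys_SekOp(1)[OF k, of b v] by (auto simp: in_keys_iff)
    then show "\<mu> \<in> lower_parts n \<nu>"
      using \<open>\<mu> \<noteq> \<nu>\<close> \<mu> assms by (simp add: dominated_lower_parts dominated_iff_below)
  qed
  then show ?thesis by (simp add: eigvec_def kill_eigs_diff kill_eigs_SekOp kill_eigs_Cst_mult)
qed

text \<open>Any symmetric polynomial whose other exponents are lower produces the same eigenvector
  up to a scalar; this allows the orbit sum to be replaced by an element of the ideal.\<close>

lemma kill_eigs_leading:
  assumes f: "f \<in> sym_polys n" and \<nu>: "\<nu> \<in> partitions n"
    and lower: "\<And>\<mu>. \<mu> \<in> partitions n \<Longrightarrow> \<mu> \<noteq> \<nu> \<Longrightarrow> lookup f \<mu> \<noteq> 0 \<Longrightarrow> \<mu> \<in> lower_parts n \<nu>"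
  shows "kill_eigs n b u (lower_list n \<nu>) f = Cst (lookup f \<nu>) * eigvec n b u \<nu>"
proof -
  have "kill_eigs n b u (lower_list n \<nu>) (f - Cst (lookup f \<nu>) * orbit_sum n \<nu>) = 0"
  proof (rule kill_lower_eq_0)
    fix \<mu> assume \<mu>: "\<mu> \<in> partitions n" "lookup (f - Cst (lookup f \<nu>) * orbit_sum n \<nu>) \<mu> \<noteq> 0"
    then show "\<mu> \<in> lower_parts n \<nu>"
      using lower[OF \<mu>(1)] \<nu> by (cases "\<mu> = \<nu>") (auto simp: lookup_minus lookup_Cst_mult lookup_orbit_sum_partition)
  qed (use f \<nu> in \<open>simp add: sym_polys_diff sym_polys_Cst_mult orbit_sum_sym\<close>)
  then show ?thesis by (simp add: eigvec_def kill_eigs_diff kill_eigs_Cst_mult)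
qed

section \<open>Jack polynomials\<close>

interpretation mpol: vector_space "scale :: 'a::field \<Rightarrow> 'a mpol \<Rightarrow> 'a mpol"
  by (rule vector_space_scale)

lemma dominated_antisym:
  assumes "\<mu> \<in> partitions n" "\<nu> \<in> partitions n" "dominated n \<mu> \<nu>" "dominated n \<nu> \<mu>"
  shows "\<mu> = \<nu>"
  using sqnorm_less[of \<mu> n \<nu>] sqnorm_less[of \<nu> n \<mu>] assms by fastforce

lemma finite_arg_max:
  fixes f :: "'a \<Rightarrow> nat"
  assumes "finite A" "A \<noteq> {}"
  obtains x where "x \<in> A" "\<And>y. y \<in> A \<Longrightarrow> f y \<le> f x"
proof -
  have "Max (f ` A) \<in> f ` A" using assms by simp
  then obtain x where "x \<in> A" "f x = Max (f ` A)" by auto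
  then show ?thesis using assms that[of x] by simp
qed

lemma lookup_scale [simp]: "lookup (scale c p) \<alpha> = c * lookup p \<alpha>"
  by (simp add: scale_def lookup_Cst_mult)

definition unitriangular :: "nat \<Rightarrow> expo \<Rightarrow> 'a::comm_semiring_1 mpol \<Rightarrow> bool" where
  "unitriangular n \<nu> p \<longleftrightarrow> p \<in> sym_polys n \<and> lookup p \<nu> = 1 \<and>
     (\<forall>\<mu>\<in>partitions n. lookup p \<mu> \<noteq> 0 \<longrightarrow> dominated n \<mu> \<nu>)"

lemma unitriangular_iff:
  fixes p :: "'a::field mpol"
  assumes \<nu>: "\<nu> \<in> partitions n"
  shows "unitriangular n \<nu> p \<longleftrightarrow> (\<exists>c. p = orbit_sum n \<nu> +
    (\<Sum>\<mu>\<in>{\<mu> \<in> partitions n. dominated n \<mu> \<nu> \<and> \<mu> \<noteq> \<nu>}. scale (c \<mu>) (orbit_sum n \<mu>)))"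
    (is "_ \<longleftrightarrow> (\<exists>c. p = ?t c)")
proof -
  let ?D = "{\<mu> \<in> partitions n. dominated n \<mu> \<nu> \<and> \<mu> \<noteq> \<nu>}"
  have fin: "finite ?D" by (rule finite_dominated)
  have sym: "?t c \<in> sym_polys n" for c
    using \<nu> by (auto simp: scale_def intro!: sym_polys_add sym_polys_sum sym_polys_Cst_mult orbit_sum_sym)
  have lk: "lookup (?t c) \<kappa> = (if \<kappa> = \<nu> then 1 else if dominated n \<kappa> \<nu> then c \<kappa> else 0)"
    if \<kappa>: "\<kappa> \<in> partitions n" for c \<kappa>
  proof -
    have "lookup (?t c) \<kappa> = (if \<kappa> = \<nu> then 1 else 0) + (\<Sum>\<mu>\<in>?D. if \<kappa> = \<mu> then c \<mu> else 0)"
      using \<kappa> \<nu> by (auto simp: lookup_add lookup_sum lookup_orbit_sum_partition intro!: sum.cong)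
    then show ?thesis using \<kappa> fin by (auto simp: sum.delta)
  qed
  show ?thesis
  proof
    assume u: "unitriangular n \<nu> p"
    have "p = ?t (lookup p)"
    proof (rule sym_polys_eqI)
      show "p \<in> sym_polys n" using u by (simp add: unitriangular_def)
      show "?t (lookup p) \<in> sym_polys n" by (rule sym)
      fix \<kappa> assume "\<kappa> \<in> partitions n"
      then show "lookup p \<kappa> = lookup (?t (lookup p)) \<kappa>"
        unfolding lk[OF \<open>\<kappa> \<in> partitions n\<close>] using u by (auto simp: unitriangular_def)
    qed
    then show "\<exists>c. p = ?t c" by blast
  next
    assume "\<exists>c. p = ?t c"
    then obtain c where p: "p = ?t c" by blast
    show "unitriangular n \<nu> p"
      unfolding unitriangular_def
    proof (intro conjI ballI impI)
      show "p \<in> sym_polys n" unfolding p by (rule sym)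
      show "lookup p \<nu> = 1" unfolding p lk[OF \<nu>] by simp
      fix \<mu> assume "\<mu> \<in> partitions n" "lookup p \<mu> \<noteq> 0"
      then show "dominated n \<mu> \<nu>" unfolding p lk[OF \<open>\<mu> \<in> partitions n\<close>] by (auto split: if_splits)
    qed
  qed
qed

text \<open>Induction on a finite set of partitions that is closed under dominance and contains the
  exponents of \<open>p\<close>: subtraction at an element of largest square norm removes it. A
  witness is demanded only at exponents that lead an element of \<open>Q\<close>, since for the
  ideal it is available only at admissible ones.\<close>

lemma span_unitriangular:
  fixes Q :: "'a::field mpol set"
  assumes sym: "Q \<subseteq> sym_polys n"
    and peel: "\<And>p \<mu>. p \<in> Q \<Longrightarrow> \<mu> \<in> partitions n \<Longrightarrow> lookup p \<mu> \<noteq> 0 \<Longrightarrow>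
      (\<And>\<nu>. \<nu> \<in> partitions n \<Longrightarrow> lookup p \<nu> \<noteq> 0 \<Longrightarrow> sqnorm n \<nu> \<le> sqnorm n \<mu>) \<Longrightarrow>
      \<exists>q\<in>S. unitriangular n \<mu> q \<and> (\<forall>c. p - scale c q \<in> Q)"
    and p: "p \<in> Q"
  shows "p \<in> span_over_field S"
proof -
  have main: "p \<in> span_over_field S"
    if "finite W" "W \<subseteq> partitions n" "\<And>\<mu> \<nu>. \<nu> \<in> W \<Longrightarrow> \<mu> \<in> partitions n \<Longrightarrow> dominated n \<mu> \<nu> \<Longrightarrow> \<mu> \<in> W"
      "p \<in> Q" "\<And>\<mu>. \<mu> \<in> partitions n \<Longrightarrow> lookup p \<mu> \<noteq> 0 \<Longrightarrow> \<mu> \<in> W" for W p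
    using that
  proof (induction "card W" arbitrary: W p rule: less_induct)
    case less
    show ?case
    proof (cases "W = {}")
      case True
      then have "p = 0" using less.prems(4,5) sym by (intro sym_polys_eqI[of p n 0]) auto
      then show ?thesis using mpol.span_zero by simp
    next
      case False
      then obtain \<mu> where \<mu>: "\<mu> \<in> W" and max: "\<And>\<nu>. \<nu> \<in> W \<Longrightarrow> sqnorm n \<nu> \<le> sqnorm n \<mu>"
        using finite_arg_max[OF less.prems(1)] by blast
      have \<mu>': "\<mu> \<in> partitions n" using \<mu> less.prems(2) by blast
      have card: "card (W - {\<mu>}) < card W" using \<mu> less.prems(1) by (meson card_Diff1_less)
      have down: "\<kappa> \<in> W - {\<mu>}" if "\<nu> \<in> W - {\<mu>}" "\<kappa> \<in> partitions n" "dominated n \<kappa> \<nu>" for \<kappa> \<nu>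
      proof -
        have "\<kappa> \<in> W" using less.prems(3)[of \<nu> \<kappa>] that by blast
        moreover have "\<kappa> \<noteq> \<mu>"
        proof
          assume "\<kappa> = \<mu>"
          then have "sqnorm n \<mu> < sqnorm n \<nu>" using that less.prems(2) by (intro sqnorm_less) auto
          then show False using max[of \<nu>] that by simp
        qed
        ultimately show ?thesis by simp
      qed
      show ?thesis
      proof (cases "lookup p \<mu> = 0")
        case True
        show ?thesis
        proof (rule less.hyps[OF card _ _ down])
          fix \<nu> assume "\<nu> \<in> partitions n" "lookup p \<nu> \<noteq> 0"
          then show "\<nu> \<in> W - {\<mu>}" using less.prems(5)[of \<nu>] True by blast
        qed (use less.prems(1,2,4) in blast)+
      next
        case nz: False
        then obtain q where q: "q \<in> S" "unitriangular n \<mu> q" and Q: "\<And>c. p - scale c q \<in> Q"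
          using peel[OF less.prems(4) \<mu>' nz] max less.prems(5) by blast
        let ?r = "p - scale (lookup p \<mu>) q"
        have "?r \<in> span_over_field S"
        proof (rule less.hyps[OF card _ _ down])
          fix \<nu> assume \<nu>: "\<nu> \<in> partitions n" "lookup ?r \<nu> \<noteq> 0"
          have "\<nu> \<noteq> \<mu>" using \<nu> q by (auto simp: lookup_minus unitriangular_def)
          moreover have "lookup p \<nu> \<noteq> 0 \<or> lookup q \<nu> \<noteq> 0" using \<nu> by (auto simp: lookup_minus)
          then have "\<nu> \<in> W"
            using less.prems(5)[OF \<nu>(1)] less.prems(3)[OF \<mu> \<nu>(1)] q \<nu> by (auto simp: unitriangular_def)
          ultimately show "\<nu> \<in> W - {\<mu>}" by simp
        qed (use less.prems(1,2) Q in blast)+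
        then have "?r + scale (lookup p \<mu>) q \<in> span_over_field S"
          by (rule mpol.span_add[OF _ mpol.span_scale[OF mpol.span_base[OF q(1)]]])
        then show ?thesis by simp
      qed
    qed
  qed
  \<comment> \<open>The downward closure of the exponents of \<open>p\<close>, finite because
    dominance fixes the size. \<open>True\<close> instantiates the free predicate of
    \<open>finite_dominated\<close>.\<close>
  let ?W = "\<Union>\<nu>\<in>keys p \<inter> partitions n. {\<mu> \<in> partitions n. dominated n \<mu> \<nu> \<and> True}"
  show ?thesis
  proof (rule main[of ?W])
    show "finite ?W" by (intro finite_UN_I finite_Int finite_dominated) simp
    show "?W \<subseteq> partitions n" by blast
    show "\<mu> \<in> ?W" if "\<nu> \<in> ?W" "\<mu> \<in> partitions n" "dominated n \<mu> \<nu>" for \<mu> \<nu>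
      using that dominated_trans[of n \<mu> \<nu>] by blast
    show "\<mu> \<in> ?W" if "\<mu> \<in> partitions n" "lookup p \<mu> \<noteq> 0" for \<mu>
      using that dominated_refl[of n \<mu>] by (blast intro: in_keys_iff[THEN iffD2])
  qed (rule p)
qed

lemma span_unitriangular_basis:
  fixes P :: "expo \<Rightarrow> 'a::field mpol"
  assumes P: "\<And>\<nu>. \<nu> \<in> partitions n \<Longrightarrow> unitriangular n \<nu> (P \<nu>)"
  shows "span_over_field (P ` partitions n) = sym_polys n"
proof
  show "span_over_field (P ` partitions n) \<subseteq> sym_polys n"
  proof (rule mpol.span_minimal)
    show "P ` partitions n \<subseteq> sym_polys n" using P by (auto simp: unitriangular_def)
    show "mpol.subspace (sym_polys n)"
      by (auto simp: mpol.subspace_def scale_def intro: sym_polys_add sym_polys_Cst_mult)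
  qed
  show "sym_polys n \<subseteq> span_over_field (P ` partitions n)"
  proof
    fix p assume "p \<in> (sym_polys n :: 'a mpol set)"
    then show "p \<in> span_over_field (P ` partitions n)"
    proof (rule span_unitriangular[where n = n, rotated 2])
      fix p :: "'a mpol" and \<mu> assume "p \<in> sym_polys n" and \<mu>: "\<mu> \<in> partitions n"
      then have "p - scale c (P \<mu>) \<in> sym_polys n" for c
        using P[OF \<mu>] by (auto simp: unitriangular_def scale_def intro!: sym_polys_diff sym_polys_Cst_mult)
      then show "\<exists>q\<in>P ` partitions n. unitriangular n \<mu> q \<and> (\<forall>c. p - scale c q \<in> sym_polys n)"
        using P \<mu> by blast
    qed simp
  qed
qed

text \<open>In a linear relation, look at the coefficient of a partition of largest square norm
  among those that occur: only its own basis vector contributes.\<close>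

lemma independent_unitriangular:
  fixes P :: "expo \<Rightarrow> 'a::field mpol"
  assumes P: "\<And>\<nu>. \<nu> \<in> partitions n \<Longrightarrow> unitriangular n \<nu> (P \<nu>)"
  shows "inj_on P (partitions n)" and "independent_over_field (P ` partitions n)"
proof -
  show inj: "inj_on P (partitions n)"
  proof (rule inj_onI)
    fix \<mu> \<nu> assume m: "\<mu> \<in> partitions n" "\<nu> \<in> partitions n" and eq: "P \<mu> = P \<nu>"
    have "lookup (P \<nu>) \<mu> = 1" "lookup (P \<mu>) \<nu> = 1"
      using P[OF m(1)] P[OF m(2)] eq by (auto simp: unitriangular_def)
    then have "dominated n \<mu> \<nu>" "dominated n \<nu> \<mu>"
      using P[OF m(1)] P[OF m(2)] m by (auto simp: unitriangular_def)
    then show "\<mu> = \<nu>" using dominated_antisym m by blast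
  qed
  show "independent_over_field (P ` partitions n)"
  proof
    assume "mpol.dependent (P ` partitions n)"
    then obtain T u where T: "finite T" "T \<subseteq> P ` partitions n" and s: "(\<Sum>v\<in>T. scale (u v) v) = 0"
      and nz: "\<exists>v\<in>T. u v \<noteq> 0"
      unfolding mpol.dependent_explicit by blast
    define W where "W = {\<nu> \<in> partitions n. P \<nu> \<in> T \<and> u (P \<nu>) \<noteq> 0}"
    have "finite W"
      by (rule inj_on_finite[of P W T]) (use inj T in \<open>auto simp: W_def inj_on_def\<close>)
    moreover have "W \<noteq> {}" using nz T by (auto simp: W_def)
    ultimately obtain \<nu> where \<nu>: "\<nu> \<in> W" and max: "\<And>\<mu>. \<mu> \<in> W \<Longrightarrow> sqnorm n \<mu> \<le> sqnorm n \<nu>"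
      using finite_arg_max by blast
    have zero: "u v * lookup v \<nu> = 0" if v: "v \<in> T" "v \<noteq> P \<nu>" for v
    proof (rule ccontr)
      assume nz: "u v * lookup v \<nu> \<noteq> 0"
      obtain \<mu> where \<mu>: "\<mu> \<in> partitions n" "v = P \<mu>" using T v by blast
      then have "\<mu> \<in> W" using nz v by (auto simp: W_def)
      moreover have "dominated n \<nu> \<mu>" using nz \<mu> P[OF \<mu>(1)] \<nu> by (auto simp: W_def unitriangular_def)
      then have "sqnorm n \<nu> < sqnorm n \<mu>" using \<mu> \<nu> v by (intro sqnorm_less) (auto simp: W_def)
      ultimately show False using max[of \<mu>] by simp
    qed
    have rest: "(\<Sum>v\<in>T - {P \<nu>}. u v * lookup v \<nu>) = 0" by (intro sum.neutral ballI zero) auto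
    have "0 = (\<Sum>v\<in>T. u v * lookup v \<nu>)"
      using arg_cong[OF s, of "\<lambda>p. lookup p \<nu>"] by (simp add: lookup_sum)
    also have "\<dots> = u (P \<nu>) * lookup (P \<nu>) \<nu>"
      using \<nu> T(1) rest by (simp add: W_def sum.remove[of T "P \<nu>"])
    also have "\<dots> \<noteq> 0" using \<nu> P[of \<nu>] by (simp add: W_def unitriangular_def)
    finally show False by simp
  qed
qed

lemma of_nat_to_fract: "of_nat m = to_fract (of_nat m)"
  by (induction m) simp_all

lemma \<beta>_eq: "\<beta> = to_fract [:0, 1:]"
  by (simp add: \<beta>_def to_fract_def)

text \<open>Choose \<open>u\<close> to annihilate one factor for \<open>\<nu>\<close> at an index
  where the partitions differ. As \<open>\<beta>\<close> is an indeterminate, a factor for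
  \<open>\<mu>\<close> can vanish only if both its index and its entry agree.\<close>

lemma eigval_separates:
  assumes "\<mu> \<in> partitions n" "\<nu> \<in> partitions n" "\<mu> \<noteq> \<nu>"
  shows "\<exists>u. eigval n \<beta> u \<nu> \<noteq> eigval n \<beta> u \<mu>"
proof -
  obtain i where i: "i \<in> {1..n}" "lookup \<mu> i \<noteq> lookup \<nu> i"
    using partitions_eqI[OF assms(1,2)] assms(3) by blast
  define u where "u = - (of_nat (lookup \<nu> i) + of_nat (n - i) * \<beta>)"
  have "eigval n \<beta> u \<nu> = 0"
    unfolding eigval_def by (rule prod_zero) (use i in \<open>auto simp: u_def intro!: bexI[of _ i]\<close>)
  moreover have "u + of_nat (lookup \<mu> j) + of_nat (n - j) * \<beta> \<noteq> 0" if j: "j \<in> {1..n}" for j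
  proof
    assume "u + of_nat (lookup \<mu> j) + of_nat (n - j) * \<beta> = 0"
    then have "of_nat (lookup \<mu> j) + of_nat (n - j) * \<beta> = of_nat (lookup \<nu> i) + of_nat (n - i) * \<beta>"
      by (simp add: u_def algebra_simps eq_neg_iff_add_eq_0)
    then have "of_nat (lookup \<mu> j) + of_nat (n - j) * [:0, 1:] = of_nat (lookup \<nu> i) + of_nat (n - i) * [:0, 1 :: complex:]"
      unfolding \<beta>_eq of_nat_to_fract to_fract_mult[symmetric] to_fract_add[symmetric] to_fract_eq_iff .
    then have "[:of_nat (lookup \<mu> j), of_nat (n - j) :: complex:] = [:of_nat (lookup \<nu> i), of_nat (n - i):]"
      by (simp add: of_nat_poly)
    then have "lookup \<mu> j = lookup \<nu> i" "n - j = n - i" by simp_all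
    moreover from this i j have "j = i" by auto
    ultimately show False using i by simp
  qed
  then have "eigval n \<beta> u \<mu> \<noteq> 0" by (simp add: eigval_def)
  ultimately show ?thesis by metis
qed

definition jack_char :: "nat \<Rightarrow> expo \<Rightarrow> ratfun mpol \<Rightarrow> bool" where
  "jack_char n \<nu> p \<longleftrightarrow> unitriangular n \<nu> p \<and> (\<forall>u. SekOp n \<beta> u p = Cst (eigval n \<beta> u \<nu>) * p)"

text \<open>The clauses on injectivity, independence and span follow from unitriangularity, so the
  family can be characterized one partition at a time.\<close>

lemma jack_basis_iff:
  "jack_basis n P \<longleftrightarrow> (\<forall>\<nu>\<in>partitions n. jack_char n \<nu> (P \<nu>))"
proof
  assume "jack_basis n P"
  then show "\<forall>\<nu>\<in>partitions n. jack_char n \<nu> (P \<nu>)"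
    by (simp add: jack_basis_def jack_char_def unitriangular_iff Sop_eq_SekOp eigval_def scale_def)
next
  assume P: "\<forall>\<nu>\<in>partitions n. jack_char n \<nu> (P \<nu>)"
  then have "unitriangular n \<nu> (P \<nu>)" if "\<nu> \<in> partitions n" for \<nu> using that by (simp add: jack_char_def)
  from independent_unitriangular[of n P, OF this] span_unitriangular_basis[of n P, OF this] P
  show "jack_basis n P"
    by (simp add: jack_basis_def jack_char_def unitriangular_iff Sop_eq_SekOp eigval_def scale_def)
qed

text \<open>The normalizations cancel at \<open>\<nu>\<close>, so a maximal exponent
  \<open>\<mu>\<close> of the difference is not \<open>\<nu>\<close>. Its coefficient would be
  multiplied by the eigenvalues of both partitions.\<close>

lemma jack_char_unique:
  assumes \<nu>: "\<nu> \<in> partitions n" and p: "jack_char n \<nu> p" and q: "jack_char n \<nu> q"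
  shows "p = q"
proof (rule ccontr)
  assume "p \<noteq> q"
  let ?r = "p - q"
  have sym: "?r \<in> sym_polys n" using p q by (auto simp: jack_char_def unitriangular_def intro: sym_polys_diff)
  have eig: "SekOp n \<beta> u ?r = Cst (eigval n \<beta> u \<nu>) * ?r" for u
    using p q by (simp add: jack_char_def SekOp_diff right_diff_distrib)
  have "keys ?r \<inter> partitions n \<noteq> {}"
  proof
    assume "keys ?r \<inter> partitions n = {}"
    then have "?r = 0" by (intro sym_polys_eqI[OF sym]) (auto simp: in_keys_iff)
    then show False using \<open>p \<noteq> q\<close> by simp
  qed
  then obtain \<mu> where \<mu>: "\<mu> \<in> keys ?r \<inter> partitions n"
    and max: "\<And>\<kappa>. \<kappa> \<in> keys ?r \<inter> partitions n \<Longrightarrow> sqnorm n \<kappa> \<le> sqnorm n \<mu>"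
    using finite_arg_max[of "keys ?r \<inter> partitions n" "sqnorm n"] by auto
  have "\<mu> \<noteq> \<nu>" using \<mu> p q by (auto simp: in_keys_iff lookup_minus jack_char_def unitriangular_def)
  then obtain u where u: "eigval n \<beta> u \<nu> \<noteq> eigval n \<beta> u \<mu>" using eigval_separates \<mu> \<nu> by blast
  have "lookup (SekOp n \<beta> u ?r) \<mu> = eigval n \<beta> u \<mu> * lookup ?r \<mu>"
  proof (rule lookup_SekOp_maximal[OF sym])
    fix \<kappa> assume \<kappa>: "\<kappa> \<in> partitions n" "lookup ?r \<kappa> \<noteq> 0" "dominated n \<mu> \<kappa>"
    then show "\<kappa> = \<mu>" using sqnorm_less[of \<mu> n \<kappa>] max[of \<kappa>] \<mu> by (fastforce simp: in_keys_iff)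
  qed (use \<mu> in simp)
  then have "eigval n \<beta> u \<nu> * lookup ?r \<mu> = eigval n \<beta> u \<mu> * lookup ?r \<mu>"
    unfolding eig by (simp add: lookup_Cst_mult)
  then show False using u \<mu> by (simp add: in_keys_iff)
qed

lemma unitriangular_eigvec:
  fixes b :: "'a::field"
  assumes \<nu>: "\<nu> \<in> partitions n" and "eigvec_lead n b u \<nu> \<noteq> 0"
  shows "unitriangular n \<nu> (Cst (inverse (eigvec_lead n b u \<nu>)) * eigvec n b u \<nu>)"
  unfolding unitriangular_def
proof (intro conjI ballI impI)
  show "Cst (inverse (eigvec_lead n b u \<nu>)) * eigvec n b u \<nu> \<in> sym_polys n"
    using \<nu> by (intro sym_polys_Cst_mult eigvec_sym)
  show "lookup (Cst (inverse (eigvec_lead n b u \<nu>)) * eigvec n b u \<nu>) \<nu> = 1"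
    using assms by (simp add: lookup_Cst_mult lookup_eigvec)
  fix \<mu> assume "\<mu> \<in> partitions n" "lookup (Cst (inverse (eigvec_lead n b u \<nu>)) * eigvec n b u \<nu>) \<mu> \<noteq> 0"
  then show "dominated n \<mu> \<nu>"
    using lookup_eigvec(2)[OF \<nu>, of b u] \<nu> by (auto simp: lookup_Cst_mult in_keys_iff dominated_iff_below)
qed

lemma jack_char_eigvec:
  assumes "\<nu> \<in> partitions n" "eigvec_lead n \<beta> u \<nu> \<noteq> 0"
  shows "jack_char n \<nu> (Cst (inverse (eigvec_lead n \<beta> u \<nu>)) * eigvec n \<beta> u \<nu>)"
  using assms by (simp add: jack_char_def unitriangular_eigvec SekOp_Cst_mult SekOp_eigvec mult.left_commute)

lemma eigvec_lead_nonzero: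
  assumes "\<And>\<mu>. \<mu> \<in> lower_parts n \<nu> \<Longrightarrow> eigval n b (u \<mu>) \<nu> \<noteq> eigval n b (u \<mu>) \<mu>"
  shows "eigvec_lead n b u \<nu> \<noteq> 0"
  using assms by (auto simp: eigvec_lead_def prod_list_zero_iff set_lower_list)

lemma jack_char_exists:
  assumes \<nu>: "\<nu> \<in> partitions n"
  shows "\<exists>p. jack_char n \<nu> p"
proof -
  have "\<exists>u. eigval n \<beta> u \<nu> \<noteq> eigval n \<beta> u \<mu>" if "\<mu> \<in> lower_parts n \<nu>" for \<mu>
    using that \<nu> by (intro eigval_separates) (auto simp: lower_parts_def)
  then obtain u where "\<And>\<mu>. \<mu> \<in> lower_parts n \<nu> \<Longrightarrow> eigval n \<beta> (u \<mu>) \<nu> \<noteq> eigval n \<beta> (u \<mu>) \<mu>" by metis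
  then show ?thesis using jack_char_eigvec[OF \<nu> eigvec_lead_nonzero] by blast
qed

lemma jack_char_jack:
  assumes "\<nu> \<in> partitions n"
  shows "jack_char n \<nu> (jack n \<nu>)"
proof -
  let ?P = "restrict (\<lambda>\<nu>. SOME p. jack_char n \<nu> p) (partitions n)"
  have ex: "jack_char n \<nu> (?P \<nu>)" if "\<nu> \<in> partitions n" for \<nu>
    using that someI_ex[OF jack_char_exists[OF that]] by simp
  have "jack n = ?P"
    unfolding jack_def
  proof (rule the_equality)
    show "?P \<in> extensional (partitions n) \<and> jack_basis n ?P"
      using ex by (simp add: jack_basis_iff)
    fix P assume P: "P \<in> extensional (partitions n) \<and> jack_basis n P"
    show "P = ?P"
    proof (rule extensionalityI[of _ "partitions n"])
      fix \<nu> assume "\<nu> \<in> partitions n"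
      then show "P \<nu> = ?P \<nu>" using P ex jack_char_unique by (auto simp: jack_basis_iff)
    qed (use P in auto)
  qed
  then show ?thesis using ex[OF assms] by simp
qed

lemma jack_eq:
  assumes "\<nu> \<in> partitions n" "eigvec_lead n \<beta> u \<nu> \<noteq> 0"
  shows "jack n \<nu> = Cst (inverse (eigvec_lead n \<beta> u \<nu>)) * eigvec n \<beta> u \<nu>"
  using jack_char_unique[OF assms(1) jack_char_jack[OF assms(1)] jack_char_eigvec[OF assms]] .

section \<open>Specialization\<close>

text \<open>Instantiated by the inclusion of \<open>complex poly\<close> into \<open>ratfun\<close>
  and by evaluation at a point, so that both images of one polynomial construction are
  known.\<close>

locale coeff_hom =
  fixes h :: "'a::idom \<Rightarrow> 'b::idom"
  assumes h_1: "h 1 = 1" and h_add: "h (a + b) = h a + h b" and h_mult: "h (a * b) = h a * h b"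
begin

definition hmap :: "'a mpol \<Rightarrow> 'b mpol" where
  "hmap = Poly_Mapping.map h"

lemma h_0: "h 0 = 0"
proof -
  have "h 0 + h 0 = h 0 + 0" using h_add[of 0 0] by simp
  then show ?thesis by (simp only: add_left_cancel)
qed

lemma h_diff: "h (a - b) = h a - h b"
  using h_add[of "a - b" b] by simp

lemma h_of_nat: "h (of_nat m) = of_nat m"
  by (induction m) (simp_all add: h_0 h_1 h_add)

lemma h_prod: "h (\<Prod>x\<in>A. f x) = (\<Prod>x\<in>A. h (f x))"
  by (induction A rule: infinite_finite_induct) (simp_all add: h_1 h_mult)

lemma h_prod_list: "h (\<Prod>x\<leftarrow>xs. f x) = (\<Prod>x\<leftarrow>xs. h (f x))"
  by (induction xs) (simp_all add: h_1 h_mult)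

lemma lookup_hmap: "lookup (hmap p) \<alpha> = h (lookup p \<alpha>)"
  by (simp add: hmap_def Poly_Mapping.map.rep_eq when_def h_0)

lemma hmap_0: "hmap 0 = 0"
  by (rule poly_mapping_eqI) (simp add: lookup_hmap h_0)

lemma hmap_add: "hmap (p + q) = hmap p + hmap q"
  by (rule poly_mapping_eqI) (simp add: lookup_hmap lookup_add h_add)

lemma hmap_diff: "hmap (p - q) = hmap p - hmap q"
  by (rule poly_mapping_eqI) (simp add: lookup_hmap lookup_minus h_diff)

lemma hmap_sum: "hmap (\<Sum>x\<in>A. f x) = (\<Sum>x\<in>A. hmap (f x))"
  by (induction A rule: infinite_finite_induct) (simp_all add: hmap_0 hmap_add)

lemma hmap_single: "hmap (single \<alpha> c) = single \<alpha> (h c)"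
  by (rule poly_mapping_eqI) (simp add: lookup_hmap lookup_single when_def h_0)

lemma hmap_mult: "hmap (p * q) = hmap p * hmap q"
proof (induction p rule: poly_mapping_single_induct)
  case (single \<alpha> c)
  show ?case
  proof (induction q rule: poly_mapping_single_induct)
    case (single \<gamma> d)
    then show ?case by (simp add: mult_single hmap_single h_mult)
  qed (simp_all add: hmap_0 hmap_add distrib_left)
qed (simp_all add: hmap_0 hmap_add distrib_right)

lemma hmap_Cst: "hmap (Cst c) = Cst (h c)"
  by (simp add: Cst_def hmap_single)

lemma hmap_Mon: "hmap (Mon \<alpha>) = Mon \<alpha>"
  by (simp add: Mon_def hmap_single h_1)

lemma hmap_X: "hmap (X i) = X i"
  by (simp add: X_def hmap_Mon)

lemma hmap_permute_vars: "bij \<sigma> \<Longrightarrow> hmap (permute_vars \<sigma> p) = permute_vars \<sigma> (hmap p)"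
  by (rule poly_mapping_eqI) (simp add: lookup_hmap lookup_permute_vars)

lemma hmap_pdiff: "hmap (pdiff i p) = pdiff i (hmap p)"
  by (rule poly_mapping_eqI) (simp add: lookup_hmap lookup_pdiff h_mult h_of_nat h_add h_1)

lemma hmap_ddiff:
  assumes "i \<noteq> j"
  shows "hmap (ddiff i j p) = ddiff i j (hmap p)"
proof (rule ddiff_eqI[OF assms, symmetric])
  have "hmap ((X i - X j) * ddiff i j p) = hmap (p - swap_vars i j p)" using assms by (simp add: ddiff_mult_X)
  then show "(X i - X j) * hmap (ddiff i j p) = hmap p - swap_vars i j (hmap p)"
    by (simp add: hmap_mult hmap_diff hmap_X hmap_permute_vars)
qed

lemma hmap_Cherednik: "hmap (Cherednik n b i p) = Cherednik n (h b) i (hmap p)"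
  by (simp add: Cherednik_def Dunkl_def hmap_mult hmap_add hmap_sum hmap_Cst hmap_X hmap_permute_vars hmap_pdiff hmap_ddiff)

lemma hmap_SekOp: "hmap (SekOp n b u p) = SekOp n (h b) (h u) (hmap p)"
proof -
  have "hmap (foldr (Cher_shift n b u) xs p) = foldr (Cher_shift n (h b) (h u)) xs (hmap p)" for xs
    by (induction xs) (simp_all add: Cher_shift_def hmap_mult hmap_add hmap_Cst hmap_Cherednik)
  then show ?thesis by (simp add: SekOp_def)
qed

lemma h_eigval: "h (eigval n b u \<nu>) = eigval n (h b) (h u) \<nu>"
  by (simp add: eigval_def h_prod h_add h_mult h_of_nat h_diff)

lemma hmap_eigvec: "hmap (eigvec n b u \<nu>) = eigvec n (h b) (\<lambda>\<mu>. h (u \<mu>)) \<nu>"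
proof -
  have "hmap (kill_eigs n b u \<mu>s p) = kill_eigs n (h b) (\<lambda>\<mu>. h (u \<mu>)) \<mu>s (hmap p)" for \<mu>s p
    by (induction \<mu>s) (simp_all add: kill_eigs_def kill_eig_def hmap_diff hmap_mult hmap_Cst hmap_SekOp h_eigval)
  then show ?thesis by (simp add: eigvec_def orbit_sum_eq hmap_sum hmap_Mon)
qed

lemma h_eigvec_lead: "h (eigvec_lead n b u \<nu>) = eigvec_lead n (h b) (\<lambda>\<mu>. h (u \<mu>)) \<nu>"
  by (simp add: eigvec_lead_def h_prod_list h_diff h_eigval)

end

text \<open>Over \<open>complex poly\<close> every coefficient of the Jack polynomial is a fraction
  with the same denominator \<open>D\<close>, whose value at \<open>c\<close> is the nonzero leading
  coefficient; hence there is no pole.\<close>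

lemma specialize_jack:
  assumes \<nu>: "\<nu> \<in> partitions n" and lead: "eigvec_lead n c u \<nu> \<noteq> 0"
  shows "specialize c (jack n \<nu>) = Cst (inverse (eigvec_lead n c u \<nu>)) * eigvec n c u \<nu>"
proof -
  interpret fr: coeff_hom "to_fract :: complex poly \<Rightarrow> ratfun" by unfold_locales simp_all
  interpret ev: coeff_hom "\<lambda>p. poly p c" by unfold_locales simp_all
  \<comment> \<open>The parameters chosen at the point \<open>c\<close> are lifted to constant
    polynomials, so evaluation returns them unchanged.\<close>
  define v where "v \<mu> = [:u \<mu>:]" for \<mu>
  define D where "D = eigvec_lead n [:0, 1:] v \<nu>"
  define E where "E = eigvec n [:0, 1:] v \<nu>"
  have D: "poly D c = eigvec_lead n c u \<nu>"
    using ev.h_eigvec_lead[of n "[:0, 1:]" v \<nu>] by (simp add: D_def v_def)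
  have E: "poly (lookup E \<alpha>) c = lookup (eigvec n c u \<nu>) \<alpha>" for \<alpha>
    using ev.hmap_eigvec[of n "[:0, 1:]" v \<nu>] ev.lookup_hmap[of E \<alpha>] by (simp add: E_def v_def)
  have frD: "to_fract D = eigvec_lead n \<beta> (\<lambda>\<mu>. to_fract (v \<mu>)) \<nu>"
    unfolding D_def \<beta>_eq by (rule fr.h_eigvec_lead)
  have frE: "fr.hmap E = eigvec n \<beta> (\<lambda>\<mu>. to_fract (v \<mu>)) \<nu>"
    unfolding E_def \<beta>_eq by (rule fr.hmap_eigvec)
  have "D \<noteq> 0" using D lead by auto
  then have jack: "jack n \<nu> = Cst (inverse (to_fract D)) * fr.hmap E"
    unfolding frE frD by (intro jack_eq[OF \<nu>]) (simp flip: frD)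
  show ?thesis
  proof (rule poly_mapping_eqI)
    fix \<alpha>
    have lj: "lookup (jack n \<nu>) \<alpha> = Fract (lookup E \<alpha>) D"
      unfolding jack lookup_Cst_mult fr.lookup_hmap Fract_conv_to_fract divide_inverse by (rule mult.commute)
    \<comment> \<open>\<open>Poly_Mapping.map\<close> assigns 0 to zero coefficients without
      applying the function, hence the case distinction.\<close>
    have "lookup (specialize c (jack n \<nu>)) \<alpha> = poly (lookup E \<alpha>) c / poly D c"
    proof (cases "lookup (jack n \<nu>) \<alpha> = 0")
      case True
      then have "lookup E \<alpha> = 0" using lj \<open>D \<noteq> 0\<close> by (simp add: Fract_conv_to_fract)
      then show ?thesis using True by (simp add: specialize_def Poly_Mapping.map.rep_eq)
    next
      case False
      then show ?thesis
        using ratfun_at_Fract[of D c "lookup E \<alpha>"] D lead by (simp add: specialize_def Poly_Mapping.map.rep_eq lj)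
    qed
    then show "lookup (specialize c (jack n \<nu>)) \<alpha> = lookup (Cst (inverse (eigvec_lead n c u \<nu>)) * eigvec n c u \<nu>) \<alpha>"
      by (simp only: D E lookup_Cst_mult divide_inverse_commute)
  qed
qed

section \<open>Admissible partitions\<close>

definition admissible :: "nat \<Rightarrow> nat \<Rightarrow> expo \<Rightarrow> bool" where
  "admissible k n \<nu> \<longleftrightarrow> (\<forall>i. 1 \<le> i \<and> i + k \<le> n \<longrightarrow> lookup \<nu> i \<ge> lookup \<nu> (i + k) + 2)"

lemma admissible_gap:
  assumes "admissible k n \<nu>" "\<nu> \<in> partitions n" "1 \<le> p" "p + m * k \<le> p'" "p' \<le> n"
  shows "lookup \<nu> p' + 2 * m \<le> lookup \<nu> p"
proof -
  have *: "lookup \<nu> (p + m * k) + 2 * m \<le> lookup \<nu> p" if "p + m * k \<le> n" for m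
    using that
  proof (induction m)
    case (Suc m)
    have "lookup \<nu> (p + m * k + k) + 2 \<le> lookup \<nu> (p + m * k)"
      using assms(1)[unfolded admissible_def, rule_format, of "p + m * k"] assms(3) Suc.prems
      by (simp add: add.commute add.left_commute)
    then show ?case using Suc by (simp add: algebra_simps)
  qed simp
  have "lookup \<nu> p' \<le> lookup \<nu> (p + m * k)"
    using assms by (intro partitionsD) auto
  then show ?thesis using *[of m] assms(4,5) by linarith
qed

text \<open>Take the least point \<open>i\<close> that is moved and its preimage \<open>j\<close>:
  both \<open>\<sigma> i\<close> and \<open>j\<close> must lie above \<open>i\<close>.\<close>

lemma residue_preserving_inversion:
  fixes n m :: nat
  assumes \<sigma>: "\<sigma> permutes {1..n}" and "\<sigma> \<noteq> id"
    and res: "\<And>i. i \<in> {1..n} \<Longrightarrow> \<sigma> i mod m = i mod m"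
  obtains i j where "i \<in> {1..n}" "j \<in> {1..n}" "i < j" "i mod m = j mod m" "\<sigma> j < \<sigma> i"
proof -
  have ex: "\<exists>i. \<sigma> i \<noteq> i" using \<open>\<sigma> \<noteq> id\<close> by auto
  define i where "i = (LEAST i. \<sigma> i \<noteq> i)"
  have i: "\<sigma> i \<noteq> i" unfolding i_def by (rule LeastI_ex[OF ex])
  have less: "\<sigma> j = j" if "j < i" for j using that not_less_Least unfolding i_def by blast
  have i_in: "i \<in> {1..n}" using i \<sigma> permutes_not_in by metis
  define j where "j = inv \<sigma> i"
  have j: "\<sigma> j = i" using \<sigma> by (simp add: j_def permutes_inverses)
  have "i < \<sigma> i"
  proof (rule ccontr)
    assume "\<not> i < \<sigma> i"
    then have "\<sigma> (\<sigma> i) = \<sigma> i" using i less[of "\<sigma> i"] by simp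
    then show False using i permutes_inj[OF \<sigma>] by (simp add: inj_eq)
  qed
  moreover have "i < j" using less[of j] j i by (metis linorder_neqE_nat)
  moreover have "j \<in> {1..n}" using j i_in \<sigma> by (metis permutes_in_image)
  ultimately show ?thesis using that[of i j] i_in j res[of j] by simp
qed

lemma sum_single_mset: "finite A \<Longrightarrow> (\<Sum>x\<in>A. {#f x#}) = image_mset f (mset_set A)"
  by (induction A rule: finite_induct) simp_all

text \<open>The two monic polynomials in \<open>u\<close> agree everywhere, so their multisets of
  roots coincide.\<close>

lemma permutes_of_prod_eq:
  fixes a b :: "'i \<Rightarrow> complex"
  assumes "finite A" and eq: "\<And>u. (\<Prod>i\<in>A. u + a i) = (\<Prod>i\<in>A. u + b i)"
  obtains w where "w permutes A" "\<And>i. i \<in> A \<Longrightarrow> b i = a (w i)"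
proof -
  have "poly (\<Prod>i\<in>A. [:a i, 1:]) = poly (\<Prod>i\<in>A. [:b i, 1:])"
    using eq by (auto simp: poly_prod add.commute)
  then have "(\<Prod>i\<in>A. [:a i, 1:]) = (\<Prod>i\<in>A. [:b i, 1:])" by (simp add: poly_eq_poly_eq_iff)
  then have "proots (\<Prod>i\<in>A. [:a i, 1:]) = proots (\<Prod>i\<in>A. [:b i, 1:])" by simp
  moreover have "proots (\<Prod>i\<in>A. [:f i, 1:]) = image_mset (\<lambda>i. - f i) (mset_set A)" for f :: "'i \<Rightarrow> complex"
    using assms(1) by (subst proots_prod) (auto simp: sum_single_mset)
  ultimately have "image_mset (\<lambda>i. - b i) (mset_set A) = image_mset (\<lambda>i. - a i) (mset_set A)" by simp
  then obtain w where "w permutes A" "\<forall>i\<in>A. - b i = - a (w i)"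
    using image_mset_eq_implies_permutes[OF assms(1)] by metis
  then show ?thesis using that by auto
qed

text \<open>For admissible \<open>\<nu>\<close> the numbers \<open>(k + 1) \<nu>\<^sub>i + i\<close> strictly decrease along each residue class of \<open>i\<close> modulo
  \<open>k + 1\<close> and contain no run of \<open>k + 2\<close> consecutive integers. For another partition with the same
  numbers, an increase along a residue class would produce such a run.\<close>

lemma admissible_eqI:
  assumes k: "k \<ge> 1" and \<nu>: "\<nu> \<in> partitions n" "admissible k n \<nu>" and \<mu>: "\<mu> \<in> partitions n"
    and w: "w permutes {1..n}"
    and eq: "\<And>i. i \<in> {1..n} \<Longrightarrow> (k + 1) * lookup \<mu> i + i = (k + 1) * lookup \<nu> (w i) + w i"
  shows "\<mu> = \<nu>"
proof -
  define A B where "A i = (k + 1) * lookup \<nu> i + i" and "B i = (k + 1) * lookup \<mu> i + i" for i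
  have BA: "B i = A (w i)" if "i \<in> {1..n}" for i using eq[OF that] by (simp add: A_def B_def)
  have w_in: "w i \<in> {1..n}" if "i \<in> {1..n}" for i using that permutes_in_image[OF w] by blast
  have res: "w i mod (k + 1) = i mod (k + 1)" if "i \<in> {1..n}" for i
  proof -
    have "((k + 1) * lookup \<mu> i + i) mod (k + 1) = ((k + 1) * lookup \<nu> (w i) + w i) mod (k + 1)"
      using eq[OF that] by (rule arg_cong)
    then show ?thesis by (simp only: mod_mult_self4)
  qed
  \<comment> \<open>Otherwise the entry at \<open>p'\<close> exceeds that at \<open>p\<close> by
    some \<open>m >= 1\<close>, and \<open>p - p' = (k + 1) * m - 1\<close> is at least
    \<open>m * k\<close>, so admissibility forces a difference of at least
    \<open>2 * m\<close>.\<close>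
  have succ: "p < p'" if p: "p \<in> {1..n}" "p' \<in> {1..n}" "A p' = A p + 1" for p p'
  proof (rule ccontr)
    assume "\<not> p < p'"
    then have le: "p' \<le> p" by simp
    then have "(k + 1) * lookup \<nu> p < (k + 1) * lookup \<nu> p'" using p(3) by (simp add: A_def)
    then have less: "lookup \<nu> p < lookup \<nu> p'" by (simp only: mult_less_cancel1)
    define m where "m = lookup \<nu> p' - lookup \<nu> p"
    have m: "lookup \<nu> p' = lookup \<nu> p + m" "m \<ge> 1" using less by (simp_all add: m_def)
    have "p' + (k + 1) * m = p + 1" using p(3) by (simp add: A_def m algebra_simps)
    then have "p' + m * k \<le> p" using m(2) by (simp add: algebra_simps)
    then have "lookup \<nu> p + 2 * m \<le> lookup \<nu> p'" using admissible_gap[OF \<nu>(2,1)] p by simp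
    then show False using m by simp
  qed
  have decr: "A p' < A p" if p: "p \<in> {1..n}" "p' \<in> {1..n}" "p < p'" "p mod (k + 1) = p' mod (k + 1)" for p p'
  proof -
    obtain m where m: "p' = p + (k + 1) * m"
      using p(3,4) by (auto elim: mod_eq_nat2E)
    then have "m \<ge> 1" using p(3) by (cases m) auto
    have "lookup \<nu> p' + 2 * m \<le> lookup \<nu> p" using p m by (intro admissible_gap[OF \<nu>(2,1)]) auto
    then have "(k + 1) * (lookup \<nu> p' + 2 * m) \<le> (k + 1) * lookup \<nu> p" by (rule mult_le_mono2)
    then have "A p' + (k + 1) * m \<le> A p" by (simp add: A_def m algebra_simps)
    moreover have "(k + 1) * m > 0" using \<open>m \<ge> 1\<close> by simp
    ultimately show ?thesis by linarith
  qed
  \<comment> \<open>A rise over distance \<open>k + 1\<close> forces \<open>\<mu>\<close> to be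
    constant on \<open>k + 2\<close> indices, so \<open>A\<close> along \<open>w\<close> runs
    through consecutive integers. By \<open>succ\<close> their positions increase; the end positions
    are congruent, so \<open>decr\<close> makes \<open>A\<close> fall, a contradiction.\<close>
  have step: "B (j + (k + 1)) \<le> B j" if j: "1 \<le> j" "j + (k + 1) \<le> n" for j
  proof (rule ccontr)
    assume "\<not> B (j + (k + 1)) \<le> B j"
    then have "(k + 1) * lookup \<mu> j < (k + 1) * (lookup \<mu> (j + (k + 1)) + 1)" by (simp add: B_def algebra_simps)
    then have "lookup \<mu> j \<le> lookup \<mu> (j + (k + 1))" by (simp only: mult_less_cancel1) simp
    then have const: "lookup \<mu> (j + t) = lookup \<mu> j" if "t \<le> k + 1" for t
      using that j partitionsD[OF \<mu>, of j "j + t"] partitionsD[OF \<mu>, of "j + t" "j + (k + 1)"] by simp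
    have run: "A (w (j + t)) = A (w j) + t" if "t \<le> k + 1" for t
      using that j const[OF that] BA[of "j + t"] BA[of j] by (simp add: B_def)
    have "w j + t \<le> w (j + t)" if "t \<le> k + 1" for t
      using that
    proof (induction t)
      case (Suc t)
      have "w (j + t) < w (j + Suc t)"
        using Suc.prems j run[of t] run[of "Suc t"] by (intro succ w_in) auto
      then show ?case using Suc by simp
    qed simp
    from this[of "k + 1"] have "w j < w (j + (k + 1))" by simp
    moreover have "w j mod (k + 1) = w (j + (k + 1)) mod (k + 1)"
      using res[of j] res[of "j + (k + 1)"] j mod_add_self2[of j "k + 1"] by auto
    ultimately have "A (w (j + (k + 1))) < A (w j)" using j by (intro decr w_in) auto
    then show False using run[of "k + 1"] by simp
  qed
  have weak: "B j \<le> B i" if i: "i \<in> {1..n}" "j \<in> {1..n}" "i < j" "i mod (k + 1) = j mod (k + 1)" for i j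
  proof -
    obtain m where m: "j = i + (k + 1) * m"
      using i(3,4) by (auto elim: mod_eq_nat2E)
    have "B (i + (k + 1) * m) \<le> B i" if "i + (k + 1) * m \<le> n" for m
      using that
    proof (induction m)
      case (Suc m)
      then show ?case using step[of "i + (k + 1) * m"] i(1) by (simp add: algebra_simps)
    qed simp
    then show ?thesis using m i by simp
  qed
  \<comment> \<open>An inversion of \<open>w\<close> inside a residue class would make
    \<open>B\<close> strictly larger at the later index, against \<open>weak\<close>.\<close>
  have "w = id"
  proof (rule ccontr)
    assume "w \<noteq> id"
    then obtain i j where ij: "i \<in> {1..n}" "j \<in> {1..n}" "i < j" "i mod (k + 1) = j mod (k + 1)" "w j < w i"
      using residue_preserving_inversion[OF w _ res] by blast
    have "A (w i) < A (w j)" using ij res by (intro decr w_in) auto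
    then show False using weak[OF ij(1-4)] BA ij by simp
  qed
  then have "lookup \<mu> i = lookup \<nu> i" if "i \<in> {1..n}" for i
    using eq[OF that] by (simp only: id_apply add_right_cancel mult_cancel1) simp
  then show ?thesis using \<mu> \<nu>(1) by (intro partitions_eqI)
qed

text \<open>Equal eigenvalues give a permutation matching the shifts of the linear factors.
  Multiplied by \<open>k + 1\<close>, the shift with index \<open>i\<close> becomes
  \<open>(k + 1) * lookup \<nu> i + i - n\<close>, so \<open>admissible_eqI\<close> applies.\<close>

lemma admissible_eigval_separates:
  fixes c :: complex and k n :: nat
  defines "c \<equiv> - 1 / (of_nat k + 1)"
  assumes k: "k \<ge> 1" and \<nu>: "\<nu> \<in> partitions n" "admissible k n \<nu>" and \<mu>: "\<mu> \<in> partitions n" "\<mu> \<noteq> \<nu>"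
  shows "\<exists>u. eigval n c u \<nu> \<noteq> eigval n c u \<mu>"
proof (rule ccontr)
  assume "\<not> ?thesis"
  then have "(\<Prod>i=1..n. u + (of_nat (lookup \<nu> i) + of_nat (n - i) * c))
      = (\<Prod>i=1..n. u + (of_nat (lookup \<mu> i) + of_nat (n - i) * c))" for u
    by (simp add: eigval_def add.assoc)
  then obtain w where w: "w permutes {1..n}"
    and eq: "\<And>i. i \<in> {1..n} \<Longrightarrow> of_nat (lookup \<mu> i) + of_nat (n - i) * c = of_nat (lookup \<nu> (w i)) + of_nat (n - w i) * c"
    by (rule permutes_of_prod_eq[rotated]) auto
  have "(k + 1) * lookup \<mu> i + i = (k + 1) * lookup \<nu> (w i) + w i" if i: "i \<in> {1..n}" for i
  proof -
    have wi: "w i \<in> {1..n}" using i permutes_in_image[OF w] by blast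
    have k0: "of_nat k + 1 \<noteq> (0 :: complex)" using of_nat_neq_0[of k, where 'a = complex] by (simp add: add.commute)
    have kc: "(of_nat k + 1) * c = - 1" using k0 by (simp add: c_def)
    have "(of_nat k + 1) * (of_nat (lookup \<mu> i) + of_nat (n - i) * c) = (of_nat k + 1) * (of_nat (lookup \<nu> (w i)) + of_nat (n - w i) * c)"
      using eq[OF i] by simp
    then have "(of_nat k + 1) * of_nat (lookup \<mu> i) + of_nat (n - i) * ((of_nat k + 1) * c)
        = (of_nat k + 1) * of_nat (lookup \<nu> (w i)) + of_nat (n - w i) * ((of_nat k + 1) * c)"
      by (simp only: distrib_left mult.left_commute)
    then have "(of_nat k + 1) * of_nat (lookup \<mu> i) + of_nat i = (of_nat k + 1) * of_nat (lookup \<nu> (w i)) + (of_nat (w i) :: complex)"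
      using i wi unfolding kc by (simp add: of_nat_diff algebra_simps)
    then have "of_nat ((k + 1) * lookup \<mu> i + i) = (of_nat ((k + 1) * lookup \<nu> (w i) + w i) :: complex)"
      by (simp add: algebra_simps)
    then show ?thesis by (simp only: of_nat_eq_iff)
  qed
  then have "\<mu> = \<nu>" using k \<nu> \<mu> w by (intro admissible_eqI)
  then show False using \<mu> by simp
qed

lemma admissible_eigvec_lead:
  assumes "k \<ge> 1" "\<nu> \<in> partitions n" "admissible k n \<nu>"
  shows "\<exists>u. eigvec_lead n (- 1 / (of_nat k + 1) :: complex) u \<nu> \<noteq> 0"
proof -
  have "\<exists>u. eigval n (- 1 / (of_nat k + 1) :: complex) u \<nu> \<noteq> eigval n (- 1 / (of_nat k + 1)) u \<mu>"
    if "\<mu> \<in> lower_parts n \<nu>" for \<mu>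
    using that assms by (intro admissible_eigval_separates) (auto simp: lower_parts_def)
  then show ?thesis using eigvec_lead_nonzero by metis
qed

section \<open>Polynomials vanishing when \<open>k + 1\<close> variables coincide\<close>

definition monom_at :: "(nat \<Rightarrow> 'a::comm_semiring_1) \<Rightarrow> expo \<Rightarrow> 'a" where
  "monom_at x \<alpha> = (\<Prod>i\<in>keys \<alpha>. x i ^ lookup \<alpha> i)"

lemma monom_at_superset:
  assumes "finite A" "keys \<alpha> \<subseteq> A"
  shows "monom_at x \<alpha> = (\<Prod>i\<in>A. x i ^ lookup \<alpha> i)"
  unfolding monom_at_def by (rule prod.mono_neutral_left) (use assms in \<open>auto simp: in_keys_iff\<close>)

lemma monom_at_add: "monom_at x (\<alpha> + \<gamma>) = monom_at x \<alpha> * monom_at x \<gamma>"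
proof -
  have "keys (\<alpha> + \<gamma>) \<subseteq> keys \<alpha> \<union> keys \<gamma>" by (rule keys_add)
  then show ?thesis
    using monom_at_superset[of "keys \<alpha> \<union> keys \<gamma>" "\<alpha> + \<gamma>" x] monom_at_superset[of "keys \<alpha> \<union> keys \<gamma>" \<alpha> x]
      monom_at_superset[of "keys \<alpha> \<union> keys \<gamma>" \<gamma> x]
    by (simp add: lookup_add power_add prod.distrib)
qed

lemma peval_superset:
  assumes "finite A" "keys p \<subseteq> A"
  shows "peval p x = (\<Sum>\<alpha>\<in>A. lookup p \<alpha> * monom_at x \<alpha>)"
  unfolding peval_def monom_at_def by (rule sum.mono_neutral_left) (use assms in \<open>auto simp: in_keys_iff\<close>)

lemma peval_add: "peval (p + q) x = peval p x + peval q x"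
  using peval_superset[of "keys p \<union> keys q" "p + q" x] peval_superset[of "keys p \<union> keys q" p x]
    peval_superset[of "keys p \<union> keys q" q x] keys_add[of p q]
  by (simp add: lookup_add distrib_right sum.distrib)

lemma peval_single: "peval (single \<alpha> c) x = c * monom_at x \<alpha>"
  using peval_superset[of "{\<alpha>}" "single \<alpha> c" x] by simp

lemma peval_0 [simp]: "peval 0 x = 0"
  by (simp add: peval_def)

lemma peval_Cst [simp]: "peval (Cst c) x = c"
  by (simp add: Cst_def peval_single monom_at_def)

lemma peval_sum: "peval (\<Sum>a\<in>A. f a) x = (\<Sum>a\<in>A. peval (f a) x)"
  by (induction A rule: infinite_finite_induct) (simp_all add: peval_add)

lemma peval_mult: "peval (p * q) x = peval p x * peval q x"
proof (induction p rule: poly_mapping_single_induct)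
  case (single \<alpha> c)
  show ?case
  proof (induction q rule: poly_mapping_single_induct)
    case (single \<gamma> d)
    then show ?case by (simp add: mult_single peval_single monom_at_add mult_ac)
  qed (simp_all add: distrib_left peval_add)
qed (simp_all add: distrib_right peval_add)

lemma peval_X [simp]: "peval (X i) x = x i"
  by (simp add: X_def Mon_def peval_single monom_at_def)

lemma peval_diff: "peval (p - q) x = peval p x - peval (q :: 'a::comm_ring_1 mpol) x"
  using peval_add[of "p - q" q x] by simp

lemma peval_permute_vars:
  assumes "bij \<sigma>"
  shows "peval (permute_vars \<sigma> p) x = peval p (x \<circ> \<sigma>)"
  by (induction p rule: mpol_induct) (simp_all add: assms peval_add peval_mult permute_vars_add permute_vars_mult)

text \<open>The chain rule along the line on which all variables in \<open>I\<close> share the value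
  \<open>t\<close>. It also supplies continuity along that line.\<close>

lemma peval_has_field_derivative:
  fixes p :: "complex mpol" and x :: "nat \<Rightarrow> complex"
  assumes "finite I"
  defines "y \<equiv> \<lambda>t i. if i \<in> I then t else x i"
  shows "((\<lambda>t. peval p (y t)) has_field_derivative (\<Sum>j\<in>I. peval (pdiff j p) (y t))) (at t)"
proof (induction p rule: mpol_induct)
  case (const c)
  then show ?case by simp
next
  case (add p q)
  then show ?case by (simp add: peval_add pdiff_add sum.distrib DERIV_add)
next
  case (var k p)
  have yk: "((\<lambda>t. y t k) has_field_derivative (if k \<in> I then 1 else 0)) (at t)"
    by (cases "k \<in> I") (simp_all add: y_def)
  have "(\<Sum>j\<in>I. peval (pdiff j (X k * p)) (y t))
      = (\<Sum>j\<in>I. (if j = k then peval p (y t) else 0) + y t k * peval (pdiff j p) (y t))"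
    by (intro sum.cong refl) (simp add: pdiff_X_mult peval_add peval_mult)
  also have "\<dots> = (if k \<in> I then 1 else 0) * peval p (y t) + (\<Sum>j\<in>I. peval (pdiff j p) (y t)) * y t k"
    using assms(1) by (simp add: sum.distrib sum.delta sum_distrib_left mult.commute)
  finally show ?case
    using DERIV_mult[OF yk var] by (simp add: peval_mult)
qed

lemma isCont_eq_0:
  fixes g :: "complex \<Rightarrow> complex"
  assumes "isCont g a" "\<And>t. t \<noteq> a \<Longrightarrow> g t = 0"
  shows "g a = 0"
proof -
  have "(g \<longlongrightarrow> 0) (at a)"
    by (rule tendsto_eventually) (simp add: assms(2) eventually_at_filter)
  then show ?thesis using assms(1) LIM_unique unfolding isCont_def by blast
qed

text \<open>All index sets of size \<open>k + 1\<close> are included and symmetry is not imposed,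
  because the individual Cherednik operators need not preserve symmetry.\<close>

definition vanishing :: "nat \<Rightarrow> nat \<Rightarrow> complex mpol set" where
  "vanishing k n = {p. \<forall>I\<subseteq>{1..n}. card I = k + 1 \<longrightarrow>
     (\<forall>x r. (\<forall>i\<in>I. x i = r) \<longrightarrow> peval p x = 0)}"

lemma vanishingD:
  assumes "p \<in> vanishing k n" "I \<subseteq> {1..n}" "card I = k + 1" "\<And>i. i \<in> I \<Longrightarrow> x i = r"
  shows "peval p x = 0"
  using assms(1)[unfolded vanishing_def mem_Collect_eq, rule_format, OF assms(2,3), of x r] assms(4) by simp

lemma vanishing_add: "p \<in> vanishing k n \<Longrightarrow> q \<in> vanishing k n \<Longrightarrow> p + q \<in> vanishing k n"
  by (simp add: vanishing_def peval_add)

lemma vanishing_diff: "p \<in> vanishing k n \<Longrightarrow> q \<in> vanishing k n \<Longrightarrow> p - q \<in> vanishing k n"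
  by (simp add: vanishing_def peval_diff)

lemma vanishing_mult: "p \<in> vanishing k n \<Longrightarrow> q * p \<in> vanishing k n"
  by (simp add: vanishing_def peval_mult)

context
  fixes p :: "complex mpol" and k n :: nat and I :: "nat set" and x :: "nat \<Rightarrow> complex" and r :: complex
  assumes p: "p \<in> vanishing k n" and I: "I \<subseteq> {1..n}" "card I = k + 1"
    and x: "\<And>i. i \<in> I \<Longrightarrow> x i = r"
begin

lemma finite_I: "finite I"
  using I(1) finite_subset by blast

text \<open>Moving the common value of the block, or one variable outside it, stays inside the zero
  set.\<close>

lemma directional_derivative_vanishes:
  assumes "J = I \<or> J = {i} \<and> i \<notin> I"
  shows "(\<Sum>j\<in>J. peval (pdiff j p) x) = 0"
proof (cases "J = {}")
  case False
  then obtain i where i: "i \<in> J" by blast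
  define y where "y = (\<lambda>t l. if l \<in> J then t else x l)"
  have fin: "finite J" using assms finite_I by auto
  have "y (x i) = x" using assms i x by (auto simp: y_def fun_eq_iff)
  moreover have "peval p (y t) = 0" for t
  proof (cases "J = I")
    case True
    show ?thesis by (rule vanishingD[OF p I, of _ t]) (simp add: y_def True)
  next
    case False
    show ?thesis by (rule vanishingD[OF p I, of _ r]) (use assms False x in \<open>auto simp: y_def\<close>)
  qed
  moreover have "((\<lambda>t. peval p (y t)) has_field_derivative (\<Sum>j\<in>J. peval (pdiff j p) (y (x i)))) (at (x i))"
    unfolding y_def by (rule peval_has_field_derivative[OF fin])
  ultimately show ?thesis
    using DERIV_unique[OF _ DERIV_const[of 0 "at (x i)"]] by simp
qed simp

text \<open>If \<open>i\<close> and \<open>j\<close> do not both lie in the block, both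
  \<open>p\<close> and its exchange vanish at the point, so the divided difference vanishes where
  \<open>x i\<close> and \<open>x j\<close> differ and, by continuity, also where they
  agree.\<close>

lemma ddiff_vanishes:
  assumes ij: "i \<in> {1..n}" "j \<in> {1..n}" "i \<noteq> j" and nI: "\<not> (i \<in> I \<and> j \<in> I)"
  shows "peval (ddiff i j p) x = 0"
proof -
  have off: "peval (ddiff i j p) y = 0" if y: "\<And>i. i \<in> I \<Longrightarrow> y i = s" and neq: "y i \<noteq> y j" for y s
  proof -
    have "peval p (y \<circ> transpose i j) = 0"
    proof (rule vanishingD[OF p])
      show "transpose i j ` I \<subseteq> {1..n}" using I ij by (auto simp: transpose_def)
      show "card (transpose i j ` I) = k + 1" using I by (subst card_image) (auto intro: inj_on_subset[OF bij_is_inj])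
      show "(y \<circ> transpose i j) a = s" if "a \<in> transpose i j ` I" for a
        using that by (auto simp: y)
    qed
    moreover have "peval p y = 0" by (rule vanishingD[OF p I]) (rule y)
    moreover have "peval ((X i - X j) * ddiff i j p) y = peval (p - swap_vars i j p) y"
      using ij by (simp add: ddiff_mult_X)
    ultimately have "(y i - y j) * peval (ddiff i j p) y = 0"
      by (simp add: peval_mult peval_diff peval_permute_vars)
    then show ?thesis using neq by simp
  qed
  show ?thesis
  proof (cases "x i = x j")
    case True
    \<comment> \<open>A direction that separates \<open>x i\<close> from \<open>x j\<close> within
      the locus: the whole block moves if it contains \<open>i\<close>. By \<open>nI\<close> the
      index \<open>j\<close> stays fixed.\<close>
    define J where "J = (if i \<in> I then I else {i})"
    define y where "y = (\<lambda>t l. if l \<in> J then t else x l)"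
    have fin: "finite J" using finite_I by (simp add: J_def)
    have "x l = x j" if "l \<in> J" for l using that True x by (auto simp: J_def split: if_splits)
    then have yx: "y (x j) = x" by (auto simp: y_def fun_eq_iff)
    have "isCont (\<lambda>t. peval (ddiff i j p) (y t)) (x j)"
      unfolding y_def by (rule DERIV_isCont[OF peval_has_field_derivative[OF fin]])
    moreover have "peval (ddiff i j p) (y t) = 0" if "t \<noteq> x j" for t
    proof (rule off)
      show "y t a = (if i \<in> I then t else r)" if "a \<in> I" for a
        using that x[OF that] by (auto simp: y_def J_def)
      show "y t i \<noteq> y t j" using that ij(3) nI by (auto simp: y_def J_def)
    qed
    ultimately have "peval (ddiff i j p) (y (x j)) = 0" by (rule isCont_eq_0)
    then show ?thesis using yx by simp
  next
    case False
    then show ?thesis by (intro off[of x r] x)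
  qed
qed

text \<open>Differentiate the defining equation of the quotient with respect to variable
  \<open>i\<close> and evaluate where the factor \<open>X i - X j\<close> is zero.\<close>

lemma ddiff_on_diagonal:
  assumes ij: "i \<in> I" "j \<in> I" "i \<noteq> j"
  shows "peval (ddiff i j p) x = peval (pdiff i p) x - peval (pdiff j p) x"
proof -
  have "pdiff i ((X i - X j) * ddiff i j p) = pdiff i (p - swap_vars i j p)"
    using ij by (simp add: ddiff_mult_X)
  then have "ddiff i j p + (X i - X j) * pdiff i (ddiff i j p) = pdiff i p - swap_vars i j (pdiff j p)"
    using ij by (simp add: pdiff_mult pdiff_diff pdiff_X permute_vars_pdiff)
  then have "peval (ddiff i j p + (X i - X j) * pdiff i (ddiff i j p)) x = peval (pdiff i p - swap_vars i j (pdiff j p)) x"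
    by simp
  moreover have "x \<circ> transpose i j = x" using x[OF ij(1)] x[OF ij(2)] by (auto simp: fun_eq_iff transpose_def)
  ultimately show ?thesis
    using x[OF ij(1)] x[OF ij(2)] by (simp add: peval_add peval_mult peval_diff peval_permute_vars)
qed

text \<open>For \<open>i\<close> in the block, let \<open>d_j\<close> be the partial derivatives at
  \<open>x\<close>. The other block members contribute \<open>c * x i * (d_i - d_j)\<close>, and the
  \<open>d_j\<close> of the block add up to 0, so the total is
  \<open>x i * d_i * (1 + c * (k + 1))\<close>. This is the origin of
  \<open>\<beta>\<^sub>0\<close>.\<close>

lemma Cherednik_vanishes:
  assumes i: "i \<in> {1..n}"
  shows "peval (Cherednik n (- 1 / (of_nat k + 1)) i p) x = 0"
proof -
  define c :: complex where "c = - 1 / (of_nat k + 1)"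
  have px: "peval p x = 0" by (rule vanishingD[OF p I x])
  have val: "peval (Cherednik n c i p) x = x i * peval (pdiff i p) x
      + c * (\<Sum>j\<in>{1..n} - {i}. x (max i j) * peval (ddiff i j p) x)"
    by (simp add: Cherednik_eq[OF i] peval_add peval_mult peval_sum px)
  show ?thesis
  proof (cases "i \<in> I")
    case False
    have "peval (ddiff i j p) x = 0" if "j \<in> {1..n} - {i}" for j
      using that i False by (intro ddiff_vanishes) auto
    moreover have "peval (pdiff i p) x = 0" using directional_derivative_vanishes[of "{i}" i] False by simp
    ultimately show ?thesis using val by (simp add: c_def)
  next
    case True
    let ?d = "\<lambda>j. peval (pdiff j p) x"
    have "(\<Sum>j\<in>{1..n} - {i}. x (max i j) * peval (ddiff i j p) x)
        = (\<Sum>j\<in>I - {i}. x (max i j) * peval (ddiff i j p) x)"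
      using I(1) i True by (intro sum.mono_neutral_right) (auto intro!: ddiff_vanishes)
    also have "\<dots> = (\<Sum>j\<in>I - {i}. x i * (?d i - ?d j))"
    proof (intro sum.cong refl)
      fix j assume "j \<in> I - {i}"
      then show "x (max i j) * peval (ddiff i j p) x = x i * (?d i - ?d j)"
        using ddiff_on_diagonal[OF True, of j] x[OF True] x[of j] by (auto simp: max_def)
    qed
    also have "\<dots> = x i * (of_nat k * ?d i - (\<Sum>j\<in>I - {i}. ?d j))"
      using True I(2) by (simp add: sum_subtractf card_Diff_singleton flip: sum_distrib_left)
    also have "(\<Sum>j\<in>I - {i}. ?d j) = - ?d i"
      using directional_derivative_vanishes[of I i] sum.remove[OF finite_I True, of ?d] by (simp add: eq_neg_iff_add_eq_0 add.commute)
    finally have "peval (Cherednik n c i p) x = x i * ?d i * (1 + c * (of_nat k + 1))"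
      unfolding val by (simp add: algebra_simps)
    also have "c * (of_nat k + 1) = - 1"
      using of_nat_neq_0[of k, where 'a = complex] by (simp add: c_def add.commute)
    finally show ?thesis by (simp add: c_def)
  qed
qed

end

lemma Cherednik_vanishing:
  assumes "c = - 1 / (of_nat k + 1)" "p \<in> vanishing k n" "i \<in> {1..n}"
  shows "Cherednik n c i p \<in> vanishing k n"
  unfolding vanishing_def assms(1)
  by (intro CollectI allI impI, rule Cherednik_vanishes[OF assms(2) _ _ _ assms(3)]) auto

lemma SekOp_vanishing:
  assumes c: "c = - 1 / (of_nat k + 1)" and p: "p \<in> vanishing k n"
  shows "SekOp n c u p \<in> vanishing k n"
proof -
  have "foldr (Cher_shift n c u) xs p \<in> vanishing k n" if "set xs \<subseteq> {1..n}" for xs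
    using that p
    by (induction xs) (simp_all add: Cher_shift_def vanishing_add vanishing_mult Cherednik_vanishing[OF c])
  then show ?thesis unfolding SekOp_def by (simp add: atLeastLessThanSuc_atLeastAtMost del: upt_Suc)
qed

lemma kill_eigs_vanishing:
  assumes c: "c = - 1 / (of_nat k + 1)" and p: "p \<in> vanishing k n"
  shows "kill_eigs n c u \<mu>s p \<in> vanishing k n"
  using p
  by (induction \<mu>s) (simp_all add: kill_eigs_def kill_eig_def vanishing_diff vanishing_mult SekOp_vanishing[OF c])

lemma permutes_onto:
  assumes "finite S" "A \<subseteq> S" "B \<subseteq> S" "card A = card B"
  obtains \<sigma> where "\<sigma> permutes S" "\<sigma> ` A = B"
proof -
  have fin: "finite A" "finite B" using assms finite_subset by auto
  obtain f where f: "bij_betw f A B" using finite_same_card_bij[OF fin assms(4)] by blast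
  have "card (S - A) = card (S - B)" using assms fin by (simp add: card_Diff_subset)
  then obtain g where g: "bij_betw g (S - A) (S - B)" using finite_same_card_bij[of "S - A" "S - B"] assms(1) by auto
  define \<sigma> where "\<sigma> i = (if i \<in> A then f i else if i \<in> S then g i else i)" for i
  have "bij_betw \<sigma> A B" using f by (simp add: \<sigma>_def cong: bij_betw_cong)
  moreover have "bij_betw \<sigma> (S - A) (S - B)" using g by (subst bij_betw_cong[where g = g]) (auto simp: \<sigma>_def)
  ultimately have "bij_betw \<sigma> (A \<union> (S - A)) (B \<union> (S - B))" by (rule bij_betw_combine) auto
  then have "bij_betw \<sigma> S S" using assms by (simp add: Un_absorb1)
  then have "\<sigma> permutes S" using assms(2) by (intro bij_imp_permutes) (auto simp: \<sigma>_def)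
  then show ?thesis using that \<open>bij_betw \<sigma> A B\<close> by (auto simp: bij_betw_def)
qed

text \<open>By symmetry the first \<open>k + 1\<close> variables can be moved to any block of that
  size.\<close>

lemma F_space_eq: "F_space k n = sym_polys n \<inter> vanishing k n"
proof (intro equalityI subsetI)
  fix p assume p: "p \<in> F_space k n"
  then have sym: "p \<in> sym_polys n" by (simp add: F_space_def)
  have "peval p x = 0"
    if I: "I \<subseteq> {1..n}" "card I = k + 1" and x: "\<forall>i\<in>I. x i = r" for I x r
  proof -
    have kn: "k + 1 \<le> n" using card_mono[OF _ I(1)] I(2) by simp
    obtain \<sigma> where \<sigma>: "\<sigma> permutes {1..n}" "\<sigma> ` {1..k+1} = I"
      using permutes_onto[of "{1..n}" "{1..k+1}" I] I kn by auto
    have "peval p x = peval (permute_vars \<sigma> p) x" using sym \<sigma> by (simp add: sym_polys_def)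
    also have "\<dots> = peval p (x \<circ> \<sigma>)" using \<sigma> by (simp add: peval_permute_vars permutes_bij)
    also have "\<dots> = 0"
    proof -
      have "\<sigma> i \<in> I" if "i \<in> {1..k+1}" for i using that \<sigma>(2) by blast
      then have "\<forall>i\<in>{1..k+1}. (x \<circ> \<sigma>) i = (x \<circ> \<sigma>) 1" using x by simp
      then show ?thesis using p kn unfolding F_space_def by blast
    qed
    finally show ?thesis .
  qed
  then show "p \<in> sym_polys n \<inter> vanishing k n" using sym unfolding vanishing_def by blast
next
  fix p assume p: "p \<in> sym_polys n \<inter> vanishing k n"
  have "peval p x = 0" if "k + 1 \<le> n" "\<forall>i\<in>{1..k+1}. x i = x 1" for x
  proof (rule vanishingD)
    show "p \<in> vanishing k n" using p by simp
    show "{1..k+1} \<subseteq> {1..n}" "card {1..k+1} = k + 1" using that by auto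
    show "x i = x 1" if "i \<in> {1..k+1}" for i using \<open>\<forall>i\<in>{1..k+1}. x i = x 1\<close> that by blast
  qed
  then show "p \<in> F_space k n" using p unfolding F_space_def by blast
qed

section \<open>Vanishing polynomials with admissible leading term\<close>

definition expo_of :: "nat \<Rightarrow> (nat \<Rightarrow> nat) \<Rightarrow> expo" where
  "expo_of n f = (\<Sum>i=1..n. single i (f i))"

lemma lookup_expo_of: "lookup (expo_of n f) i = (if i \<in> {1..n} then f i else 0)"
  by (simp add: expo_of_def lookup_sum lookup_single when_def sum.delta)

lemma sqnorm_map_key: "\<sigma> permutes {1..n} \<Longrightarrow> sqnorm n (map_key \<sigma> \<alpha>) = sqnorm n \<alpha>"
  using sum.permute[of \<sigma> "{1..n}" "\<lambda>i. (lookup \<alpha> i)\<^sup>2"] by (simp add: sqnorm_def lookup_map_key permutes_inj)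

lemma sum_map_key: "\<sigma> permutes {1..n} \<Longrightarrow> (\<Sum>i=1..n. lookup (map_key \<sigma> \<alpha>) i) = (\<Sum>i=1..n. lookup \<alpha> i)"
  using sum.permute[of \<sigma> "{1..n}" "lookup \<alpha>"] by (simp add: lookup_map_key permutes_inj)

section \<open>Alternants over residue classes modulo \<open>k\<close>\<close>

definition residue_perms :: "nat \<Rightarrow> nat \<Rightarrow> (nat \<Rightarrow> nat) set" where
  "residue_perms k n = {w. w permutes {1..n} \<and> (\<forall>i\<in>{1..n}. w i mod k = i mod k)}"

lemma finite_residue_perms: "finite (residue_perms k n)"
  by (rule finite_subset[OF _ finite_permutations[of "{1..n}"]]) (auto simp: residue_perms_def)

lemma residue_perms_transpose:
  assumes w: "w \<in> residue_perms k n" and ij: "i \<in> {1..n}" "j \<in> {1..n}" "i mod k = j mod k"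
  shows "w \<circ> transpose i j \<in> residue_perms k n"
proof -
  have "w (transpose i j l) mod k = l mod k" if "l \<in> {1..n}" for l
    using w ij that by (auto simp: residue_perms_def transpose_def)
  then show ?thesis
    using w permutes_compose[OF permutes_swap_id[OF ij(1,2)], of w] by (auto simp: residue_perms_def)
qed

text \<open>The rearrangement inequality inside residue classes: undoing an inversion strictly
  increases the sum.\<close>

lemma rearrangement_less:
  fixes r s :: "nat \<Rightarrow> nat"
  assumes decr: "\<And>i j. i \<in> {1..n} \<Longrightarrow> j \<in> {1..n} \<Longrightarrow> i < j \<Longrightarrow> i mod k = j mod k \<Longrightarrow> r j < r i \<and> s j < s i"
    and w: "w \<in> residue_perms k n" "w \<noteq> id"
  shows "(\<Sum>i=1..n. r i * s (w i)) < (\<Sum>i=1..n. r i * s i)"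
proof -
  let ?T = "\<lambda>w. \<Sum>i=1..n. r i * s (w i)"
  have improve: "\<exists>w'\<in>residue_perms k n. ?T w < ?T w'" if w: "w \<in> residue_perms k n" "w \<noteq> id" for w
  proof -
    have p: "w permutes {1..n}" and res: "\<And>i. i \<in> {1..n} \<Longrightarrow> w i mod k = i mod k"
      using w by (auto simp: residue_perms_def)
    obtain i j where ij: "i \<in> {1..n}" "j \<in> {1..n}" "i < j" "i mod k = j mod k" "w j < w i"
      using residue_preserving_inversion[OF p w(2) res] by blast
    let ?w = "w \<circ> transpose i j"
    have wij: "w i \<in> {1..n}" "w j \<in> {1..n}" using ij permutes_in_image[OF p] by blast+
    have r: "r j < r i" using decr[OF ij(1-4)] by simp
    have s: "s (w i) < s (w j)" using decr[OF wij(2,1) ij(5)] res[OF ij(1)] res[OF ij(2)] ij(4) by simp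
    have split: "?T v = r i * s (v i) + (r j * s (v j) + (\<Sum>l\<in>{1..n} - {i} - {j}. r l * s (v l)))" for v
      using ij sum.remove[of "{1..n}" i "\<lambda>l. r l * s (v l)"] sum.remove[of "{1..n} - {i}" j "\<lambda>l. r l * s (v l)"] by auto
    have rest: "(\<Sum>l\<in>{1..n} - {i} - {j}. r l * s (?w l)) = (\<Sum>l\<in>{1..n} - {i} - {j}. r l * s (w l))"
      by (intro sum.cong refl) (auto simp: transpose_def)
    obtain a where a: "r i = r j + Suc a" using r less_imp_Suc_add by fastforce
    obtain b where b: "s (w j) = s (w i) + Suc b" using s less_imp_Suc_add by fastforce
    have "r i * s (w i) + r j * s (w j) < r i * s (w j) + r j * s (w i)"
      unfolding a b by (simp add: algebra_simps)
    then have "?T w < ?T ?w" unfolding split[of w] split[of ?w] rest by simp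
    then show ?thesis using residue_perms_transpose[OF w(1) ij(1,2,4)] by blast
  qed
  have "id \<in> residue_perms k n" by (simp add: residue_perms_def permutes_id)
  \<comment> \<open>A maximum exists on the finite set and cannot be improved, so it is attained at
    the identity; one improvement of \<open>w\<close> already gives strictness.\<close>
  then obtain v where v: "v \<in> residue_perms k n" "\<And>w. w \<in> residue_perms k n \<Longrightarrow> ?T w \<le> ?T v"
    using finite_arg_max[OF finite_residue_perms, of k n ?T] by blast
  have "v = id" using improve[OF v(1)] v(2) by (meson leD)
  obtain w' where "w' \<in> residue_perms k n" "?T w < ?T w'" using improve[OF w] by blast
  then have "?T w < ?T v" using v(2)[of w'] by linarith
  then show ?thesis using \<open>v = id\<close> by simp
qed

text \<open>A product of ordinary alternants, one per residue class, expanded over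
  \<open>residue_perms\<close>.\<close>

definition alternant :: "nat \<Rightarrow> nat \<Rightarrow> expo \<Rightarrow> complex mpol" where
  "alternant k n \<rho> = (\<Sum>w\<in>residue_perms k n. Cst (of_int (sign w)) * Mon (map_key w \<rho>))"

text \<open>Composition with the transposition of two congruent indices pairs the terms with
  opposite signs and equal values.\<close>

lemma alternant_vanishes:
  assumes pq: "p \<in> {1..n}" "q \<in> {1..n}" "p \<noteq> q" "p mod k = q mod k" and y: "y p = y q"
  shows "peval (alternant k n \<rho>) y = 0"
proof -
  let ?t = "transpose p q"
  let ?F = "\<lambda>w. of_int (sign w) * peval (Mon (map_key w \<rho>)) y"
  have t: "?t permutes {1..n}" using pq by (simp add: permutes_swap_id)
  have swap: "?F (w \<circ> ?t) = - ?F w" if w: "w \<in> residue_perms k n" for w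
  proof -
    have wp: "w permutes {1..n}" using w by (simp add: residue_perms_def)
    have perm: "permutation w" "permutation ?t" using wp t by (auto simp: permutation_permutes)
    have "sign (w \<circ> ?t) = - sign w" using pq by (simp add: sign_compose[OF perm] sign_swap_id)
    moreover have "map_key (w \<circ> ?t) \<rho> = map_key ?t (map_key w \<rho>)"
      using wp by (simp add: map_key_comp permutes_inj)
    moreover have "peval (Mon (map_key ?t \<alpha>)) y = peval (Mon \<alpha>) y" for \<alpha>
    proof -
      have "y \<circ> ?t = y" using y by (auto simp: fun_eq_iff transpose_def)
      then show ?thesis using peval_permute_vars[of ?t "Mon \<alpha>" y] by (simp add: swap_vars_Mon)
    qed
    ultimately show ?thesis by simp
  qed
  have "bij_betw (\<lambda>w. w \<circ> ?t) (residue_perms k n) (residue_perms k n)"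
    using residue_perms_transpose[OF _ pq(1,2,4)]
    by (intro bij_betwI[where g = "\<lambda>w. w \<circ> ?t"]) (auto simp: comp_assoc)
  then have "(\<Sum>w\<in>residue_perms k n. ?F (w \<circ> ?t)) = (\<Sum>w\<in>residue_perms k n. ?F w)"
    by (rule sum.reindex_bij_betw)
  moreover have "(\<Sum>w\<in>residue_perms k n. ?F (w \<circ> ?t)) = - (\<Sum>w\<in>residue_perms k n. ?F w)"
    unfolding sum_negf[symmetric] by (rule sum.cong[OF refl swap])
  ultimately have "(\<Sum>w\<in>residue_perms k n. ?F w) = 0" by simp
  then show ?thesis by (simp add: alternant_def peval_sum peval_mult)
qed

text \<open>The sum runs over permutations and not over distinct images, so stabilizers enter the
  coefficients as multiplicities.\<close>

definition symmetrization :: "nat \<Rightarrow> 'a::comm_semiring_1 mpol \<Rightarrow> 'a mpol" where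
  "symmetrization n p = (\<Sum>\<sigma> | \<sigma> permutes {1..n}. permute_vars \<sigma> p)"

lemma lookup_symmetrization:
  "lookup (symmetrization n p) \<alpha> = (\<Sum>\<sigma> | \<sigma> permutes {1..n}. lookup p (map_key \<sigma> \<alpha>))"
  by (simp add: symmetrization_def lookup_sum lookup_permute_vars permutes_bij)

lemma symmetrization_sym:
  fixes p :: "'a::comm_semiring_1 mpol"
  assumes "\<And>\<alpha>. \<alpha> \<in> keys p \<Longrightarrow> keys \<alpha> \<subseteq> {1..n}"
  shows "symmetrization n p \<in> sym_polys n"
proof (rule sym_polysI)
  fix \<alpha> assume "lookup (symmetrization n p) \<alpha> \<noteq> 0"
  then obtain \<sigma> where \<sigma>: "\<sigma> permutes {1..n}" "lookup p (map_key \<sigma> \<alpha>) \<noteq> 0"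
    unfolding lookup_symmetrization by (auto elim: sum.not_neutral_contains_not_neutral)
  then have sub: "keys (map_key \<sigma> \<alpha>) \<subseteq> {1..n}" using assms by (simp add: in_keys_iff)
  show "keys \<alpha> \<subseteq> {1..n}"
  proof
    fix i assume "i \<in> keys \<alpha>"
    then have "inv \<sigma> i \<in> keys (map_key \<sigma> \<alpha>)"
      using \<sigma> by (simp add: in_keys_iff lookup_map_key permutes_inj permutes_inverses)
    then have "inv \<sigma> i \<in> {1..n}" using sub by blast
    then show "i \<in> {1..n}" using \<sigma>(1) permutes_inv permutes_in_image by metis
  qed
next
  fix \<tau> \<alpha> assume \<tau>: "\<tau> permutes {1..n}"
  have "lookup (symmetrization n p) (map_key \<tau> \<alpha>) = (\<Sum>\<sigma> | \<sigma> permutes {1..n}. lookup p (map_key (\<tau> \<circ> \<sigma>) \<alpha>))"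
    unfolding lookup_symmetrization using \<tau> by (intro sum.cong refl) (simp add: map_key_comp permutes_inj)
  also have "\<dots> = (\<Sum>\<sigma> | \<sigma> permutes {1..n}. lookup p (map_key \<sigma> \<alpha>))"
    using setum_permutations_compose_left[OF \<tau>, of "\<lambda>\<sigma>. lookup p (map_key \<sigma> \<alpha>)"] by (rule sym)
  finally show "lookup (symmetrization n p) (map_key \<tau> \<alpha>) = lookup (symmetrization n p) \<alpha>"
    by (simp add: lookup_symmetrization)
qed

text \<open>By the pigeonhole principle two of \<open>k + 1\<close> indices are congruent modulo \<open>k\<close>.\<close>

lemma symmetrization_alternant_vanishing:
  assumes "k \<ge> 1"
  shows "symmetrization n (g * alternant k n \<rho>) \<in> vanishing k n"
  unfolding vanishing_def
proof (intro CollectI allI impI)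
  fix I and x :: "nat \<Rightarrow> complex" and r
  assume I: "I \<subseteq> {1..n}" "card I = k + 1" and x: "\<forall>i\<in>I. x i = r"
  have "peval (permute_vars \<sigma> (g * alternant k n \<rho>)) x = 0" if \<sigma>: "\<sigma> permutes {1..n}" for \<sigma>
  proof -
    let ?J = "inv \<sigma> ` I"
    have inv: "inv \<sigma> permutes {1..n}" using \<sigma> by (rule permutes_inv)
    have "card ?J = k + 1" using I inv by (subst card_image) (auto intro: inj_on_subset[OF permutes_inj])
    moreover have "(\<lambda>i. i mod k) ` ?J \<subseteq> {..<k}" using assms by auto
    then have "card ((\<lambda>i. i mod k) ` ?J) \<le> k" using card_mono[of "{..<k}"] by fastforce
    ultimately have "\<not> inj_on (\<lambda>i. i mod k) ?J" using card_image[of "\<lambda>i. i mod k" ?J] by auto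
    then obtain p q where pq: "p \<in> ?J" "q \<in> ?J" "p \<noteq> q" "p mod k = q mod k" unfolding inj_on_def by blast
    have J: "?J \<subseteq> {1..n}" using I permutes_image[OF inv] by blast
    have "(x \<circ> \<sigma>) l = r" if "l \<in> ?J" for l using that x \<sigma> by (auto simp: permutes_inverses)
    then have "(x \<circ> \<sigma>) p = (x \<circ> \<sigma>) q" using pq by simp
    then have "peval (alternant k n \<rho>) (x \<circ> \<sigma>) = 0" using pq J by (intro alternant_vanishes[of p n q]) auto
    then show ?thesis using \<sigma> by (simp add: peval_permute_vars permutes_bij peval_mult)
  qed
  then show "peval (symmetrization n (g * alternant k n \<rho>)) x = 0"
    by (simp add: symmetrization_def peval_sum)
qed

text \<open>Split \<open>\<nu>\<close> into two exponents that both decrease strictly along the residue classes modulo \<open>k\<close>. By the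
  rearrangement inequality only the identity term of the alternant of one of them, multiplied by the
  monomial of the other, reaches the square norm of \<open>\<nu>\<close>.\<close>

lemma vanishing_with_leading_term:
  assumes k: "k \<ge> 1" and \<nu>: "\<nu> \<in> partitions n" "admissible k n \<nu>"
  obtains f where "f \<in> sym_polys n" "f \<in> vanishing k n" "lookup f \<nu> \<noteq> 0"
    "\<And>\<mu>. \<mu> \<in> partitions n \<Longrightarrow> \<mu> \<noteq> \<nu> \<Longrightarrow> lookup f \<mu> \<noteq> 0 \<Longrightarrow> \<mu> \<in> lower_parts n \<nu>"
proof -
  \<comment> \<open>\<open>s i\<close> counts the indices \<open>i + k\<close>,
    \<open>i + 2 * k\<close>, ... up to \<open>n\<close>, a staircase in each residue class.
    Admissibility gives at least \<open>2 * s i\<close> at \<open>i\<close>, so the subtraction is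
    not truncated. Of the gap \<open>2 * m\<close> between \<open>i\<close> and
    \<open>i + m * k\<close>, \<open>s\<close> uses \<open>m\<close> and at least \<open>m\<close>
    remains for \<open>r\<close>.\<close>
  define s r where "s i = (n - i) div k" and "r i = lookup \<nu> i - s i" for i
  define \<sigma>' \<rho> where "\<sigma>' = expo_of n s" and "\<rho> = expo_of n r"
  define f where "f = symmetrization n (Mon \<rho> * alternant k n \<sigma>')"
  let ?W = "residue_perms k n"
  have le: "s i \<le> lookup \<nu> i" if "i \<in> {1..n}" for i
  proof -
    have "(n - i) div k * k \<le> n - i" by simp
    then have "i + (n - i) div k * k \<le> n" using that unfolding atLeastAtMost_iff by linarith
    then have "2 * s i \<le> lookup \<nu> i"
      using admissible_gap[OF \<nu>(2,1), of i "(n - i) div k" n] that by (simp add: s_def)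
    then show ?thesis by simp
  qed
  have decr: "r j < r i \<and> s j < s i" if ij: "i \<in> {1..n}" "j \<in> {1..n}" "i < j" "i mod k = j mod k" for i j
  proof -
    obtain m where m: "j = i + k * m" using ij(3,4) by (auto elim: mod_eq_nat2E)
    then have "m \<ge> 1" using ij(3) by (cases m) auto
    have "n - i = (n - j) + k * m" using m ij by auto
    then have "s i = s j + m" using k by (simp add: s_def)
    moreover have "lookup \<nu> j + 2 * m \<le> lookup \<nu> i"
      using admissible_gap[OF \<nu>(2,1), of i m j] ij m by (simp add: mult.commute)
    ultimately show ?thesis using le[OF ij(1)] le[OF ij(2)] \<open>m \<ge> 1\<close> by (auto simp: r_def)
  qed
  have sum: "\<rho> + \<sigma>' = \<nu>"
  proof (rule poly_mapping_eqI)
    fix i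
    show "lookup (\<rho> + \<sigma>') i = lookup \<nu> i"
      using le[of i] lookup_outside[OF partitions_keys[OF \<nu>(1)], of i]
      by (auto simp: \<rho>_def \<sigma>'_def lookup_add lookup_expo_of r_def)
  qed
  have lw: "lookup (map_key w \<sigma>') i = s (w i)" if "w \<in> ?W" "i \<in> {1..n}" for w i
  proof -
    have w: "w permutes {1..n}" using that by (simp add: residue_perms_def)
    then have "w i \<in> {1..n}" using that permutes_in_image[OF w] by blast
    then show ?thesis using permutes_inj[OF w] unfolding \<sigma>'_def by (simp only: lookup_map_key lookup_expo_of if_True)
  qed
  \<comment> \<open>Only the mixed sum depends on \<open>w\<close>, so comparing square norms is
    exactly the rearrangement problem.\<close>
  have norm: "sqnorm n (\<rho> + map_key w \<sigma>') = (\<Sum>i=1..n. (r i)\<^sup>2) + (\<Sum>i=1..n. (s i)\<^sup>2) + 2 * (\<Sum>i=1..n. r i * s (w i))"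
    if w: "w \<in> ?W" for w
  proof -
    have "sqnorm n (\<rho> + map_key w \<sigma>') = (\<Sum>i=1..n. (r i)\<^sup>2 + (s (w i))\<^sup>2 + 2 * (r i * s (w i)))"
      unfolding sqnorm_def
      by (intro sum.cong refl) (simp add: lookup_add lw[OF w] lookup_expo_of \<rho>_def power2_sum)
    also have "\<dots> = (\<Sum>i=1..n. (r i)\<^sup>2) + (\<Sum>i=1..n. (s (w i))\<^sup>2) + 2 * (\<Sum>i=1..n. r i * s (w i))"
      by (simp add: sum.distrib sum_distrib_left)
    also have "(\<Sum>i=1..n. (s (w i))\<^sup>2) = (\<Sum>i=1..n. (s i)\<^sup>2)"
      using w sum.permute[of w "{1..n}" "\<lambda>i. (s i)\<^sup>2"] by (simp add: residue_perms_def)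
    finally show ?thesis .
  qed
  have id: "id \<in> ?W" by (simp add: residue_perms_def permutes_id)
  have map_id: "map_key id \<sigma>' = \<sigma>'" by (rule poly_mapping_eqI) (simp add: lookup_map_key)
  have less: "sqnorm n (\<rho> + map_key w \<sigma>') < sqnorm n \<nu>" if "w \<in> ?W" "w \<noteq> id" for w
  proof -
    have "(\<Sum>i=1..n. r i * s (w i)) < (\<Sum>i=1..n. r i * s i)"
      by (rule rearrangement_less[OF _ that]) (rule decr)
    then show ?thesis using norm[OF that(1)] norm[OF id] by (simp add: map_id sum)
  qed
  have g: "lookup (Mon \<rho> * alternant k n \<sigma>') \<alpha> = (\<Sum>w\<in>?W. if \<rho> + map_key w \<sigma>' = \<alpha> then of_int (sign w) else 0)" for \<alpha>
  proof -
    have "Mon \<rho> * alternant k n \<sigma>' = (\<Sum>w\<in>?W. Cst (of_int (sign w)) * Mon (\<rho> + map_key w \<sigma>'))"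
      by (simp add: alternant_def sum_distrib_left Mon_add mult.left_commute)
    then show ?thesis by (simp add: lookup_sum lookup_Cst_mult lookup_Mon if_distrib cong: if_cong)
  qed
  have g_cases: "\<alpha> = \<nu> \<or> (\<exists>w\<in>?W. w \<noteq> id \<and> \<alpha> = \<rho> + map_key w \<sigma>')"
    if nz: "lookup (Mon \<rho> * alternant k n \<sigma>') \<alpha> \<noteq> 0" for \<alpha>
  proof -
    obtain w where "w \<in> ?W" "(if \<rho> + map_key w \<sigma>' = \<alpha> then of_int (sign w) else 0) \<noteq> (0 :: complex)"
      using nz unfolding g by (rule sum.not_neutral_contains_not_neutral)
    then show ?thesis using map_id sum by (cases "w = id") (auto split: if_splits)
  qed
  have g_sum: "(\<Sum>i=1..n. lookup (\<rho> + map_key w \<sigma>') i) = (\<Sum>i=1..n. lookup \<nu> i)" if "w \<in> ?W" for w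
    using that sum_map_key[of w n \<sigma>'] by (simp add: residue_perms_def lookup_add sum.distrib flip: sum)
  show ?thesis
  proof (rule that[of f])
    show "f \<in> vanishing k n" unfolding f_def using k by (rule symmetrization_alternant_vanishing)
    show "f \<in> sym_polys n"
      unfolding f_def
    proof (rule symmetrization_sym)
      fix \<alpha> assume "\<alpha> \<in> keys (Mon \<rho> * alternant k n \<sigma>')"
      then have "lookup (Mon \<rho> * alternant k n \<sigma>') \<alpha> \<noteq> 0" by (simp add: in_keys_iff)
      then obtain w where w: "w permutes {1..n}" and \<alpha>: "\<alpha> = \<rho> + map_key w \<sigma>'"
        using g_cases[of \<alpha>] map_id sum permutes_id[of "{1..n}"] by (metis (no_types, lifting) mem_Collect_eq residue_perms_def)
      have "lookup \<alpha> i = 0" if "i \<notin> {1..n}" for i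
        using that permutes_not_in[OF w that] permutes_inj[OF w]
        by (simp add: \<alpha> lookup_add lookup_map_key \<rho>_def \<sigma>'_def lookup_expo_of del: atLeastAtMost_iff)
      then show "keys \<alpha> \<subseteq> {1..n}" by (meson in_keys_iff subsetI)
    qed
    have g\<nu>: "lookup (Mon \<rho> * alternant k n \<sigma>') \<nu> = 1"
    proof -
      have "(\<Sum>w\<in>?W. if \<rho> + map_key w \<sigma>' = \<nu> then of_int (sign w) else 0) = (\<Sum>w\<in>?W. if w = id then 1 else (0 :: complex))"
        using less by (intro sum.cong refl) (auto simp: map_id sum sign_id)
      then show ?thesis unfolding g using id by (simp add: sum.delta finite_residue_perms)
    qed
    have orbit: "lookup (Mon \<rho> * alternant k n \<sigma>') (map_key \<sigma> \<nu>) = (if map_key \<sigma> \<nu> = \<nu> then 1 else 0)"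
      if \<sigma>: "\<sigma> permutes {1..n}" for \<sigma>
    proof (cases "map_key \<sigma> \<nu> = \<nu>")
      case True
      then show ?thesis using g\<nu> by simp
    next
      case False
      have "lookup (Mon \<rho> * alternant k n \<sigma>') (map_key \<sigma> \<nu>) = 0"
      proof (rule ccontr)
        assume "lookup (Mon \<rho> * alternant k n \<sigma>') (map_key \<sigma> \<nu>) \<noteq> 0"
        then show False using g_cases less sqnorm_map_key[OF \<sigma>, of \<nu>] False by fastforce
      qed
      then show ?thesis using False by simp
    qed
    let ?S = "{\<sigma>. \<sigma> permutes {1..n} \<and> map_key \<sigma> \<nu> = \<nu>}"
    \<comment> \<open>A permuted copy of \<open>\<nu>\<close> has the full square norm and so can
      only be \<open>\<nu>\<close> itself; the coefficient is the order of its stabilizer.\<close>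
    have lead: "lookup f \<nu> = of_nat (card {\<sigma>. \<sigma> permutes {1..n} \<and> map_key \<sigma> \<nu> = \<nu>})"
      unfolding f_def lookup_symmetrization using orbit
      by (simp add: finite_permutations sum.If_cases Collect_conj_eq)
    have "id \<in> ?S"
      by (auto simp: permutes_id lookup_map_key intro!: poly_mapping_eqI)
    moreover have "finite ?S"
      by (rule finite_subset[OF _ finite_permutations[of "{1..n}"]]) auto
    ultimately have "card ?S \<noteq> 0" by (simp only: card_eq_0_iff) blast
    then show "lookup f \<nu> \<noteq> 0" by (simp only: lead of_nat_eq_0_iff) simp
    fix \<mu> assume \<mu>: "\<mu> \<in> partitions n" "\<mu> \<noteq> \<nu>" "lookup f \<mu> \<noteq> 0"
    then obtain \<sigma> where \<sigma>: "\<sigma> permutes {1..n}" "lookup (Mon \<rho> * alternant k n \<sigma>') (map_key \<sigma> \<mu>) \<noteq> 0"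
      unfolding f_def lookup_symmetrization by (auto elim: sum.not_neutral_contains_not_neutral)
    have "map_key \<sigma> \<mu> \<noteq> \<nu>"
    proof
      assume "map_key \<sigma> \<mu> = \<nu>"
      then have "\<nu> \<in> orbit n \<mu>" using \<sigma> by (auto simp: orbit_def)
      then show False using orbit_partition[OF \<nu>(1) \<mu>(1)] \<mu>(2) by simp
    qed
    then obtain w where w: "w \<in> ?W" "w \<noteq> id" "map_key \<sigma> \<mu> = \<rho> + map_key w \<sigma>'" using g_cases[OF \<sigma>(2)] by blast
    have "sqnorm n \<mu> < sqnorm n \<nu>" using less[OF w(1,2)] sqnorm_map_key[OF \<sigma>(1), of \<mu>] w(3) by simp
    moreover have "(\<Sum>i=1..n. lookup \<mu> i) = (\<Sum>i=1..n. lookup \<nu> i)"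
      using g_sum[OF w(1)] sum_map_key[OF \<sigma>(1), of \<mu>] w(3) by simp
    ultimately show "\<mu> \<in> lower_parts n \<nu>" using \<mu> by (simp add: lower_parts_def)
  qed
qed

text \<open>The product of factors preserves the ideal and sends the explicit element to a nonzero
  multiple of the eigenvector.\<close>

lemma eigvec_vanishing:
  assumes k: "k \<ge> 1" and \<nu>: "\<nu> \<in> partitions n" "admissible k n \<nu>" and c: "c = - 1 / (of_nat k + 1)"
  shows "eigvec n c u \<nu> \<in> vanishing k n"
proof -
  obtain f where f: "f \<in> sym_polys n" "f \<in> vanishing k n" "lookup f \<nu> \<noteq> 0"
    "\<And>\<mu>. \<mu> \<in> partitions n \<Longrightarrow> \<mu> \<noteq> \<nu> \<Longrightarrow> lookup f \<mu> \<noteq> 0 \<Longrightarrow> \<mu> \<in> lower_parts n \<nu>"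
    using vanishing_with_leading_term[OF k \<nu>] by blast
  have "Cst (lookup f \<nu>) * eigvec n c u \<nu> = kill_eigs n c u (lower_list n \<nu>) f"
    using kill_eigs_leading[OF f(1) \<nu>(1) f(4)] by simp
  also have "\<dots> \<in> vanishing k n" by (rule kill_eigs_vanishing[OF c f(2)])
  finally have "Cst (inverse (lookup f \<nu>)) * (Cst (lookup f \<nu>) * eigvec n c u \<nu>) \<in> vanishing k n"
    by (rule vanishing_mult)
  then show ?thesis using f(3) by (simp add: mult.assoc[symmetric] Cst_mult[symmetric])
qed

section \<open>Leading exponents of vanishing polynomials\<close>

text \<open>Up to nonzero factors the coefficients are derivatives at 0, and all derivatives of a
  function that vanishes everywhere vanish too.\<close>

lemma peval_eq_0_imp:
  fixes p :: "complex mpol"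
  assumes "\<And>x. peval p x = 0"
  shows "p = 0"
proof (rule poly_mapping_eqI)
  fix \<alpha>
  have "lookup p \<alpha> = 0" if "\<And>x. peval p x = 0" for p :: "complex mpol"
    using that
  proof (induction \<alpha> arbitrary: p rule: expo_induct)
    case zero
    have mono: "monom_at (\<lambda>_. 0 :: complex) \<alpha> = (if \<alpha> = 0 then 1 else 0)" for \<alpha>
    proof (cases "\<alpha> = 0")
      case False
      then obtain i where "i \<in> keys \<alpha>" by (metis keys_eq_empty all_not_in_conv)
      then show ?thesis using False unfolding monom_at_def by (auto intro!: prod_zero bexI[of _ i] simp: in_keys_iff)
    qed (simp add: monom_at_def)
    have "peval p (\<lambda>_. 0) = (\<Sum>\<alpha>\<in>keys p. if \<alpha> = 0 then lookup p 0 else 0)"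
      unfolding peval_superset[OF finite_keys subset_refl] mono by (intro sum.cong refl) simp
    then have "peval p (\<lambda>_. 0) = lookup p 0"
      by (simp add: sum.delta in_keys_iff)
    then show ?case using zero by simp
  next
    case (add \<alpha> i)
    have "peval (pdiff i p) x = 0" for x
    proof -
      have "((\<lambda>t. peval p (\<lambda>j. if j \<in> {i} then t else x j)) has_field_derivative
          (\<Sum>j\<in>{i}. peval (pdiff j p) (\<lambda>l. if l \<in> {i} then x i else x l))) (at (x i))"
        by (rule peval_has_field_derivative) simp
      moreover have "(\<lambda>l. if l \<in> {i} then x i else x l) = x" by auto
      ultimately show ?thesis
        using DERIV_unique[OF _ DERIV_const[of 0 "at (x i)"]] add.prems by simp
    qed
    then have "lookup (pdiff i p) \<alpha> = 0" by (rule add.IH)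
    then show ?case by (simp add: lookup_pdiff flip: of_nat_Suc)
  qed
  then show "lookup p \<alpha> = lookup 0 \<alpha>" using assms by simp
qed

text \<open>The exponent obtained from \<open>\<alpha>\<close> under the substitution of
  \<open>X (r j)\<close> for \<open>X j\<close>; entries sent to the same variable add up.\<close>

definition merge_expo :: "(nat \<Rightarrow> nat) \<Rightarrow> expo \<Rightarrow> expo" where
  "merge_expo r \<alpha> = (\<Sum>j\<in>keys \<alpha>. single (r j) (lookup \<alpha> j))"

lemma lookup_merge_expo:
  assumes "finite A" "keys \<alpha> \<subseteq> A"
  shows "lookup (merge_expo r \<alpha>) l = (\<Sum>j\<in>{j\<in>A. r j = l}. lookup \<alpha> j)"
proof -
  have "lookup (merge_expo r \<alpha>) l = (\<Sum>j\<in>A. if r j = l then lookup \<alpha> j else 0)"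
    unfolding merge_expo_def lookup_sum lookup_single when_def
    by (rule sum.mono_neutral_left) (use assms in \<open>auto simp: in_keys_iff\<close>)
  then show ?thesis using assms(1) by (simp add: sum.inter_filter)
qed

lemma monom_at_merge_expo: "monom_at x (merge_expo r \<alpha>) = monom_at (x \<circ> r) \<alpha>"
proof -
  have "monom_at x (\<Sum>j\<in>A. single (r j) (lookup \<alpha> j)) = (\<Prod>j\<in>A. x (r j) ^ lookup \<alpha> j)" if "finite A" for A
    using that
  proof (induction A rule: finite_induct)
    case empty
    then show ?case by (simp add: monom_at_def)
  next
    case (insert a A)
    have "monom_at x (single (r a) (lookup \<alpha> a)) = x (r a) ^ lookup \<alpha> a"
      using monom_at_superset[of "{r a}" "single (r a) (lookup \<alpha> a)" x] by (simp add: keys_single)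
    then show ?case using insert by (simp add: monom_at_add)
  qed
  then show ?thesis by (simp add: merge_expo_def monom_at_def)
qed

text \<open>The polynomial obtained by the substitution is zero as a function, hence zero, and its
  coefficients are sums over exponents that merge.\<close>

lemma merged_coefficients_sum:
  fixes p :: "complex mpol"
  assumes "\<And>x. peval p (x \<circ> r) = 0"
  shows "(\<Sum>\<gamma> | \<gamma> \<in> keys p \<and> merge_expo r \<gamma> = \<alpha>. lookup p \<gamma>) = 0"
proof -
  define q where "q = (\<Sum>\<gamma>\<in>keys p. single (merge_expo r \<gamma>) (lookup p \<gamma>))"
  have "peval q x = peval p (x \<circ> r)" for x
    using peval_superset[of "keys p" p "x \<circ> r"] by (simp add: q_def peval_sum peval_single monom_at_merge_expo)
  then have "q = 0" using assms by (intro peval_eq_0_imp) simp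
  then have "0 = lookup q \<alpha>" by simp
  also have "\<dots> = (\<Sum>\<gamma>\<in>keys p. if merge_expo r \<gamma> = \<alpha> then lookup p \<gamma> else 0)"
    by (simp add: q_def lookup_sum lookup_single when_def)
  finally show ?thesis by (simp add: sum.inter_filter)
qed

text \<open>If the entries of \<open>\<nu>\<close> in the block \<open>{i..i+k}\<close> differ by at most one, then every other way to
  distribute their sum over the block has larger square norm.\<close>

lemma admissible_leading:
  assumes sym: "p \<in> sym_polys n" and van: "p \<in> vanishing k n"
    and \<nu>: "\<nu> \<in> partitions n" "lookup p \<nu> \<noteq> 0"
    and max: "\<And>\<mu>. \<mu> \<in> partitions n \<Longrightarrow> lookup p \<mu> \<noteq> 0 \<Longrightarrow> sqnorm n \<mu> \<le> sqnorm n \<nu>"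
  shows "admissible k n \<nu>"
  unfolding admissible_def
proof (intro allI impI, rule ccontr)
  fix i assume i: "1 \<le> i \<and> i + k \<le> n" and gap: "\<not> lookup \<nu> (i + k) + 2 \<le> lookup \<nu> i"
  define B where "B = {i..i+k}"
  define c where "c = lookup \<nu> (i + k)"
  define r where "r j = (if j \<in> B then i else j)" for j
  have B: "B \<subseteq> {1..n}" "finite B" "card B = k + 1" "i \<in> B" using i by (auto simp: B_def)
  have \<nu>B: "lookup \<nu> j = c \<or> lookup \<nu> j = Suc c" if "j \<in> B" for j
    using that i gap partitionsD[OF \<nu>(1), of j "i + k"] partitionsD[OF \<nu>(1), of i j] by (auto simp: B_def c_def)
  have "peval p (x \<circ> r) = 0" for x
    by (rule vanishingD[OF van B(1,3), of _ "x i"]) (simp add: r_def)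
  then have zero: "(\<Sum>\<gamma> | \<gamma> \<in> keys p \<and> merge_expo r \<gamma> = merge_expo r \<nu>. lookup p \<gamma>) = 0"
    by (rule merged_coefficients_sum)
  \<comment> \<open>All exponents that merge with \<open>\<nu>\<close> turn out to be permutations
    of it, so by symmetry the sum in \<open>zero\<close> is a positive multiple of
    \<open>lookup p \<nu>\<close>.\<close>
  have "lookup p \<gamma> = lookup p \<nu>" if \<gamma>: "\<gamma> \<in> keys p" "merge_expo r \<gamma> = merge_expo r \<nu>" for \<gamma>
  proof -
    have keys: "keys \<gamma> \<subseteq> {1..n}" "keys \<nu> \<subseteq> {1..n}"
      using sym_polys_keys[OF sym] \<gamma>(1) \<nu> partitions_keys by (auto simp: in_keys_iff)
    have merged: "(\<Sum>j\<in>{j\<in>{1..n}. r j = l}. lookup \<gamma> j) = (\<Sum>j\<in>{j\<in>{1..n}. r j = l}. lookup \<nu> j)" for l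
      using arg_cong[OF \<gamma>(2), of "\<lambda>\<alpha>. lookup \<alpha> l"] lookup_merge_expo[OF _ keys(1), of r l] lookup_merge_expo[OF _ keys(2), of r l]
      by simp
    have "{j\<in>{1..n}. r j = i} = B" using B by (auto simp: r_def split: if_splits)
    then have sumB: "(\<Sum>j\<in>B. lookup \<gamma> j) = (\<Sum>j\<in>B. lookup \<nu> j)" using merged[of i] by simp
    have off: "lookup \<gamma> l = lookup \<nu> l" if "l \<notin> B" for l
    proof (cases "l \<in> {1..n}")
      case True
      then have "{j\<in>{1..n}. r j = l} = {l}" using that B(4) by (auto simp: r_def split: if_splits)
      then show ?thesis using merged[of l] by simp
    next
      case False
      then show ?thesis using lookup_outside[OF keys(1)] lookup_outside[OF keys(2)] by simp
    qed
    obtain \<sigma> where \<sigma>: "\<sigma> permutes {1..n}" "map_key \<sigma> \<gamma> \<in> partitions n" using expo_sort[OF keys(1)] by blast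
    have "lookup p (map_key \<sigma> \<gamma>) \<noteq> 0" using sym_polys_lookup[OF sym \<sigma>(1)] \<gamma>(1) by (simp add: in_keys_iff)
    then have "sqnorm n \<gamma> \<le> sqnorm n \<nu>" using max[OF \<sigma>(2)] sqnorm_map_key[OF \<sigma>(1)] by simp
    moreover have split: "sqnorm n \<alpha> = (\<Sum>j\<in>B. (lookup \<alpha> j)\<^sup>2) + (\<Sum>j\<in>{1..n} - B. (lookup \<alpha> j)\<^sup>2)" for \<alpha>
      unfolding sqnorm_def using B sum.subset_diff[of B "{1..n}" "\<lambda>j. (lookup \<alpha> j)\<^sup>2"] by (simp add: add.commute)
    moreover have "(\<Sum>j\<in>{1..n} - B. (lookup \<gamma> j)\<^sup>2) = (\<Sum>j\<in>{1..n} - B. (lookup \<nu> j)\<^sup>2)"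
      using off by (intro sum.cong) auto
    ultimately have sqB: "(\<Sum>j\<in>B. (lookup \<gamma> j)\<^sup>2) \<le> (\<Sum>j\<in>B. (lookup \<nu> j)\<^sup>2)" by simp
    \<comment> \<open>On integers this quadratic is nonnegative and vanishes exactly at
      \<open>c\<close> and \<open>c + 1\<close>. Its sum over the block depends only on the sum and
      the square sum of the entries.\<close>
    let ?h = "\<lambda>m :: nat. (int m - int c) * (int m - int c - 1)"
    have h: "(\<Sum>j\<in>B. ?h (lookup \<alpha> j)) = int (\<Sum>j\<in>B. (lookup \<alpha> j)\<^sup>2)
        - (2 * int c + 1) * int (\<Sum>j\<in>B. lookup \<alpha> j) + int (card B) * (int c * (int c + 1))" for \<alpha>
    proof -
      have "(\<Sum>j\<in>B. ?h (lookup \<alpha> j)) = (\<Sum>j\<in>B. int ((lookup \<alpha> j)\<^sup>2) - (2 * int c + 1) * int (lookup \<alpha> j) + int c * (int c + 1))"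
        by (intro sum.cong refl) (simp add: power2_eq_square algebra_simps)
      then show ?thesis by (simp add: sum.distrib sum_subtractf flip: sum_distrib_left)
    qed
    have "(\<Sum>j\<in>B. ?h (lookup \<gamma> j)) \<le> (\<Sum>j\<in>B. ?h (lookup \<nu> j))"
      unfolding h sumB using sqB[folded of_nat_le_iff[where ?'a = int]] by linarith
    also have "\<dots> = 0"
    proof (intro sum.neutral ballI)
      fix j assume "j \<in> B"
      then show "?h (lookup \<nu> j) = 0" using \<nu>B[of j] by auto
    qed
    finally have le0: "(\<Sum>j\<in>B. ?h (lookup \<gamma> j)) \<le> 0" .
    have h_nonneg: "?h m \<ge> 0" for m
      by (cases "m \<le> c") (auto intro: mult_nonneg_nonneg mult_nonpos_nonpos)
    have "(\<Sum>j\<in>B. ?h (lookup \<gamma> j)) = 0" by (intro order_antisym[OF le0] sum_nonneg h_nonneg)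
    then have "?h (lookup \<gamma> j) = 0" if "j \<in> B" for j
      using that sum_nonneg_eq_0_iff[of B "\<lambda>j. ?h (lookup \<gamma> j)"] h_nonneg B(2) by blast
    then have \<gamma>B: "lookup \<gamma> j = c \<or> lookup \<gamma> j = Suc c" if "j \<in> B" for j
      using that by (fastforce simp: mult_eq_0_iff)
    \<comment> \<open>With only the values \<open>c\<close> and \<open>c + 1\<close>, the block sum
      determines how often each occurs, so the blocks of \<open>\<gamma>\<close> and
      \<open>\<nu>\<close> are rearrangements of each other.\<close>
    have count: "(\<Sum>j\<in>B. lookup \<alpha> j) = c * card B + card {j\<in>B. lookup \<alpha> j = Suc c}"
      if "\<And>j. j \<in> B \<Longrightarrow> lookup \<alpha> j = c \<or> lookup \<alpha> j = Suc c" for \<alpha>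
    proof -
      have "(\<Sum>j\<in>B. lookup \<alpha> j) = (\<Sum>j\<in>B. c + (if lookup \<alpha> j = Suc c then 1 else 0))"
        using that by (intro sum.cong refl) auto
      then show ?thesis using B(2) by (simp add: sum.distrib flip: sum.inter_filter)
    qed
    have "card {j\<in>B. lookup \<gamma> j = Suc c} = card {j\<in>B. lookup \<nu> j = Suc c}"
      using count[of \<gamma>] count[of \<nu>] \<gamma>B \<nu>B sumB by simp
    then obtain \<tau> where \<tau>: "\<tau> permutes B" "\<tau> ` {j\<in>B. lookup \<gamma> j = Suc c} = {j\<in>B. lookup \<nu> j = Suc c}"
      using permutes_onto[OF B(2), of "{j\<in>B. lookup \<gamma> j = Suc c}" "{j\<in>B. lookup \<nu> j = Suc c}"] by blast
    have \<tau>n: "\<tau> permutes {1..n}" using \<tau>(1) B(1) by (rule permutes_subset)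
    have "\<gamma> = map_key \<tau> \<nu>"
    proof (rule poly_mapping_eqI)
      fix j
      have "lookup \<gamma> j = lookup \<nu> (\<tau> j)"
      proof (cases "j \<in> B")
        case False
        then show ?thesis using off permutes_not_in[OF \<tau>(1)] by simp
      next
        case True
        then have \<tau>j: "\<tau> j \<in> B" using permutes_in_image[OF \<tau>(1)] by blast
        have "lookup \<gamma> j = Suc c \<longleftrightarrow> \<tau> j \<in> \<tau> ` {j\<in>B. lookup \<gamma> j = Suc c}"
          using True permutes_inj[OF \<tau>(1)] by (auto simp: inj_eq)
        also have "\<dots> \<longleftrightarrow> lookup \<nu> (\<tau> j) = Suc c" unfolding \<tau>(2) using \<tau>j by simp
        finally show ?thesis using \<gamma>B[OF True] \<nu>B[OF \<tau>j] by auto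
      qed
      then show "lookup \<gamma> j = lookup (map_key \<tau> \<nu>) j" using \<tau>n by (simp add: lookup_map_key permutes_inj)
    qed
    then show ?thesis using sym_polys_lookup[OF sym \<tau>n] by simp
  qed
  then have "(\<Sum>\<gamma> | \<gamma> \<in> keys p \<and> merge_expo r \<gamma> = merge_expo r \<nu>. lookup p \<gamma>)
      = of_nat (card {\<gamma>. \<gamma> \<in> keys p \<and> merge_expo r \<gamma> = merge_expo r \<nu>}) * lookup p \<nu>"
    by simp
  then have "card {\<gamma>. \<gamma> \<in> keys p \<and> merge_expo r \<gamma> = merge_expo r \<nu>} = 0" using zero \<nu>(2) by simp
  moreover have "finite {\<gamma>. \<gamma> \<in> keys p \<and> merge_expo r \<gamma> = merge_expo r \<nu>}" by simp
  moreover have "\<nu> \<in> {\<gamma>. \<gamma> \<in> keys p \<and> merge_expo r \<gamma> = merge_expo r \<nu>}" using \<nu> by (simp add: in_keys_iff)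
  ultimately show False by (simp only: card_eq_0_iff) blast
qed

theorem theorem4p2:
  fixes k n :: nat
  assumes "k \<ge> 1"
  shows "F_space k n = I_space k n"
proof -
  define c :: complex where "c = - 1 / (of_nat k + 1)"
  define S where "S = {specialize c (jack n \<nu>) | \<nu>. \<nu> \<in> partitions n \<and> admissible k n \<nu>}"
  have I: "I_space k n = span_over_field S"
    by (simp add: I_space_def S_def c_def admissible_def)
  have jack: "unitriangular n \<nu> (specialize c (jack n \<nu>)) \<and> specialize c (jack n \<nu>) \<in> F_space k n"
    if \<nu>: "\<nu> \<in> partitions n" "admissible k n \<nu>" for \<nu>
  proof -
    obtain u where u: "eigvec_lead n c u \<nu> \<noteq> 0"
      using admissible_eigvec_lead[OF assms \<nu>] unfolding c_def by blast
    show ?thesis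
      using unitriangular_eigvec[OF \<nu>(1) u] eigvec_vanishing[OF assms \<nu> c_def, of u]
      unfolding specialize_jack[OF \<nu>(1) u] F_space_eq by (simp add: unitriangular_def vanishing_mult)
  qed
  have F_diff: "p - scale a q \<in> F_space k n" if "p \<in> F_space k n" "q \<in> F_space k n" for p q a
    using that by (simp add: F_space_eq scale_def sym_polys_diff sym_polys_Cst_mult vanishing_diff vanishing_mult)
  show ?thesis
    unfolding I
  proof
    show "span_over_field S \<subseteq> F_space k n"
    proof (rule mpol.span_minimal)
      show "S \<subseteq> F_space k n" using jack by (auto simp: S_def)
      have "0 \<in> F_space k n" by (simp add: F_space_eq vanishing_def)
      then show "mpol.subspace (F_space k n)"
        by (auto simp: mpol.subspace_def F_space_eq scale_def intro: sym_polys_add sym_polys_Cst_mult vanishing_add vanishing_mult)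
    qed
    show "F_space k n \<subseteq> span_over_field S"
    proof
      fix p assume "p \<in> F_space k n"
      then show "p \<in> span_over_field S"
      proof (rule span_unitriangular[where n = n, rotated 2])
        show "F_space k n \<subseteq> sym_polys n" by (simp add: F_space_eq)
        fix p \<mu> assume p: "p \<in> F_space k n" and \<mu>: "\<mu> \<in> partitions n" "lookup p \<mu> \<noteq> 0"
          and max: "\<And>\<nu>. \<nu> \<in> partitions n \<Longrightarrow> lookup p \<nu> \<noteq> 0 \<Longrightarrow> sqnorm n \<nu> \<le> sqnorm n \<mu>"
        have "admissible k n \<mu>"
          using p by (intro admissible_leading[OF _ _ \<mu> max]) (auto simp: F_space_eq)
        then show "\<exists>q\<in>S. unitriangular n \<mu> q \<and> (\<forall>a. p - scale a q \<in> F_space k n)"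
          using jack[OF \<mu>(1)] F_diff[OF p] \<mu>(1) by (auto simp: S_def)
      qed
    qed
  qed
qed

end
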